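(* In each of the two cases (L) and (H): let $\Delta\ge 84\,C_\varphi$ and $\kappa\ge1$, and let $\widehat f_w=\sum_{k=1}^{M_n}w_k\widehat f_k$ be the aggregated estimator using either the Bayesian weights $w=\widetilde w$ or the model selection weights $w=\widehat w$. Let $L>0$ and let $\omega=(\omega_k)_{k\in\mathbb{N}}$ be a strictly positive, monotonically non-increasing sequence with $\omega_1\le1$ and $\lim_{k\to\infty}\omega_k=0$, and suppose there is a constant $C_{\omega,L}>0$ such that $1\le L\vee v_f\vee\|f\|_A^2\vee\|f\|_\infty^2\le C_{\omega,L}$ for all $f\in\mathcal{D}^\omega_2(A,L)$. Then there is a numerical constant $C$ such that for all $n\ge3$ (with $M_n\ge1$) $$\sup_{f\in\mathcal{D}^\omega_2(A,L)}\mathbb{E}^n_f\|\widehat f_w-f\|_A^2\le C\big(C_{\omega,L}\,\mathcal{R}_n(\omega)+C_{\omega,L}^3\,n^{-1}\big),$$ where $$\mathcal{R}_n(\omega):=\min_{1\le k\le M_n}\Big\{R_n^k(\omega)\vee\exp\Big(-\frac{C_\varphi k^{1/2}}{400\,C_{\omega,L}}\Big)\Big\},\qquad R_n^k(\omega):=\omega_k\vee n^{-1}k^{1/2}.$$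
   Context: Two cases are considered. Case (L): $A=(0,\infty)$, $\varphi_j=\ell_j$ are the Laguerre functions $\ell_j(x)=\sqrt2\,L_j(2x)e^{-x}\mathbf 1_{(0,\infty)}(x)$, $L_j(x)=\sum_{k=0}^j(-1)^k\binom jk\frac{x^k}{k!}$; $\alpha=-1/2$, $d=1$, $M_n=\lfloor n^2(600\log n)^{-4}\rfloor$. Case (H): $A=\mathbb{R}$, $\varphi_j=h_j$ are the Hermite functions $h_j(x)=(2^jj!\sqrt\pi)^{-1/2}H_j(x)e^{-x^2/2}$, $H_j(x)=(-1)^je^{x^2}\frac{d^j}{dx^j}e^{-x^2}$; $\alpha=2/3$, $d=10/12$, $M_n=n^2$. In each case $(\varphi_j)_{j\ge0}$ is an orthonormal basis of $L^2(A)$ with usual inner product $\langle\cdot,\cdot\rangle_A$ and norm $\|\cdot\|_A$; $\|\cdot\|_\infty$ is the sup norm; $a\vee b=\max(a,b)$. $X_1,\dots,X_n$ are i.i.d. with probability density $f\in L^2(A)$ supported in $A$; $\mathbb{E}_f$, $\mathbb{E}_f^n$ denote expectation under the marginal and joint law. Put $a_j(f)=\langle f,\varphi_j\rangle_A$, $v_f=\mathbb{E}_f(|X_1|^{\alpha})+1$, $\widehat v=1+\frac1n\sum_{i=1}^n|X_i|^\alpha$. For $\omega=(\omega_k)_{k\in\mathbb{N}}$ strictly positive and $L>0$, $$\mathcal{D}^{\omega}_{2}(A,L):=\Big\{f\in L^2(A): f\text{ is a probability density},\ \sum_{k\in\mathbb{N}}|a_k(f)|^2/\omega_k\le L,\ \mathbb{E}_f(|X_1|^{2\alpha})\le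 L\Big\}.$$ $C_\varphi\ge1$ is a fixed numerical constant such that for all $k\in\mathbb{N}$ (and all densities $f$): $\|\sum_{j=0}^{k-1}\varphi_j^2\|_\infty\le C_\varphi k^{d}$ and $\sum_{j=0}^{k-1}\mathbb{E}_f(\varphi_j^2(X_1))\le C_\varphi v_fk^{1/2}$. Orthogonal series estimators: $\widehat f_k=\sum_{j=0}^{k-1}\widehat a_j\varphi_j$, $\widehat a_j=\frac1n\sum_{i=1}^n\varphi_j(X_i)$. Penalties: $\widehat{\mathrm{pen}}_k=\Delta\,\widehat v\,k^{1/2}n^{-1}$. Bayesian weights: $$\widetilde w_k=\frac{\exp(-\kappa n\{-\|\widehat f_k\|_A^2+\widehat{\mathrm{pen}}_k\})}{\sum_{l=1}^{M_n}\exp(-\kappa n\{-\|\widehat f_l\|_A^2+\widehat{\mathrm{pen}}_l\})},\quad 1\le k\le M_n.$$ Model selection weights: $\widehat w_k=\mathbf 1\{k=\widehat k\}$, where $\widehat k$ is the smallest minimiser of $k\mapsto-\|\widehat f_k\|_A^2+\widehat{\mathrm{pen}}_k$ over $\{1,\dots,M_n\}$. $\Delta$ and $\kappa$ are fixed numerical constants; a "numerical constant" depends neither on $f$, $n$, $\omega$ nor $L$. *)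

theory Defs
  imports "HOL-Probability.Probability"
begin

datatype setting = Laguerre | Hermite

definition laguerre_poly :: "nat \<Rightarrow> real \<Rightarrow> real" where
  "laguerre_poly j x = (\<Sum>k=0..j. (-1) ^ k * real (j choose k) * x ^ k / fact k)"

definition laguerre_fun :: "nat \<Rightarrow> real \<Rightarrow> real" where
  "laguerre_fun j x = sqrt 2 * laguerre_poly j (2 * x) * exp (- x) * indicator {0<..} x"

definition hermite_poly :: "nat \<Rightarrow> real \<Rightarrow> real" where
  "hermite_poly j x = (-1) ^ j * exp (x\<^sup>2) * (deriv ^^ j) (\<lambda>y. exp (- y\<^sup>2)) x"

definition hermite_fun :: "nat \<Rightarrow> real \<Rightarrow> real" where
  "hermite_fun j x = (2 ^ j * fact j * sqrt pi) powr (- 1 / 2) * hermite_poly j x * exp (- x\<^sup>2 / 2)"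

fun dom_of :: "setting \<Rightarrow> real set" where
  "dom_of Laguerre = {0<..}"
| "dom_of Hermite = UNIV"

fun phi :: "setting \<Rightarrow> nat \<Rightarrow> real \<Rightarrow> real" where
  "phi Laguerre = laguerre_fun"
| "phi Hermite = hermite_fun"

fun alpha :: "setting \<Rightarrow> real" where
  "alpha Laguerre = - 1 / 2"
| "alpha Hermite = 2 / 3"

fun dexp :: "setting \<Rightarrow> real" where
  "dexp Laguerre = 1"
| "dexp Hermite = 10 / 12"

fun max_dim :: "setting \<Rightarrow> nat \<Rightarrow> nat" where
  "max_dim Laguerre n = nat \<lfloor>(real n)\<^sup>2 * (600 * ln (real n)) powr (- 4)\<rfloor>"
| "max_dim Hermite n = n\<^sup>2"

definition L2_on :: "real set \<Rightarrow> (real \<Rightarrow> real) set" where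
  "L2_on A = {g. set_borel_measurable lborel A g \<and> set_integrable lborel A (\<lambda>x. (g x)\<^sup>2)}"

text \<open>The Lebesgue integral of a non-integrable function is 0 in the library; \<open>inner_on A\<close>
  and \<open>norm_on A\<close> are only applied to members of \<open>L2_on A\<close>.\<close>

definition inner_on :: "real set \<Rightarrow> (real \<Rightarrow> real) \<Rightarrow> (real \<Rightarrow> real) \<Rightarrow> real" where
  "inner_on A f g = (LBINT x:A. f x * g x)"

definition norm_on :: "real set \<Rightarrow> (real \<Rightarrow> real) \<Rightarrow> real" where
  "norm_on A g = sqrt (inner_on A g g)"

text \<open>Elements of \<open>L\<^sup>2(A)\<close> are classes modulo null sets, so the sup norm is the essential
  supremum; for continuous functions on the open set \<open>A\<close> it is the pointwise supremum.\<close>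

definition sup_norm_on :: "real set \<Rightarrow> (real \<Rightarrow> real) \<Rightarrow> ennreal" where
  "sup_norm_on A g = esssup (restrict_space lborel A) (\<lambda>x. ennreal \<bar>g x\<bar>)"

text \<open>Densities are represented by Borel functions that are non-negative everywhere and vanish
  outside \<open>A\<close>; every class of densities has such a representative.\<close>

definition densities :: "setting \<Rightarrow> (real \<Rightarrow> real) set" where
  "densities s = {f. f \<in> borel_measurable borel \<and> (\<forall>x. 0 \<le> f x) \<and> (\<forall>x. x \<notin> dom_of s \<longrightarrow> f x = 0)
     \<and> (\<integral>\<^sup>+ x. ennreal (f x) \<partial>lborel) = 1 \<and> f \<in> L2_on (dom_of s)}"

definition law :: "(real \<Rightarrow> real) \<Rightarrow> real measure" where
  "law f = density lborel (\<lambda>x. ennreal (f x))"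

definition sample_law :: "(real \<Rightarrow> real) \<Rightarrow> nat \<Rightarrow> (nat \<Rightarrow> real) measure" where
  "sample_law f n = PiM {1..n} (\<lambda>_. law f)"

text \<open>Moments may be infinite. Since \<open>0 powr a = 0\<close>, the integrand with a negative exponent is 0
  at the origin, which is a null set.\<close>

definition moment :: "(real \<Rightarrow> real) \<Rightarrow> real \<Rightarrow> ennreal" where
  "moment f b = (\<integral>\<^sup>+ x. ennreal (\<bar>x\<bar> powr b) \<partial>law f)"

definition v_mom :: "setting \<Rightarrow> (real \<Rightarrow> real) \<Rightarrow> ennreal" where
  "v_mom s f = moment f (alpha s) + 1"

definition vhat :: "setting \<Rightarrow> nat \<Rightarrow> (nat \<Rightarrow> real) \<Rightarrow> real" where
  "vhat s n X = 1 + (1 / real n) * (\<Sum>i=1..n. \<bar>X i\<bar> powr alpha s)"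

definition coef :: "setting \<Rightarrow> (real \<Rightarrow> real) \<Rightarrow> nat \<Rightarrow> real" where
  "coef s f j = inner_on (dom_of s) f (phi s j)"

text \<open>The index \<open>k\<close> of \<open>\<omega>\<close> ranges over \<open>{1, 2, \<dots>}\<close>, that of the basis over \<open>{0, 1, \<dots>}\<close>; so the
  series defining the ellipsoid starts with the coefficient \<open>coef s f 1\<close>.\<close>

definition ellipsoid :: "setting \<Rightarrow> (nat \<Rightarrow> real) \<Rightarrow> real \<Rightarrow> (real \<Rightarrow> real) set" where
  "ellipsoid s \<omega> L = {f \<in> densities s.
     (\<Sum>k. ennreal (\<bar>coef s f (Suc k)\<bar>\<^sup>2 / \<omega> (Suc k))) \<le> ennreal L
     \<and> moment f (2 * alpha s) \<le> ennreal L}"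

definition basis_constant :: "setting \<Rightarrow> real \<Rightarrow> bool" where
  "basis_constant s Cphi \<longleftrightarrow> 1 \<le> Cphi \<and>
     (\<forall>k\<ge>1. sup_norm_on (dom_of s) (\<lambda>x. \<Sum>j<k. (phi s j x)\<^sup>2) \<le> ennreal (Cphi * real k powr dexp s)) \<and>
     (\<forall>f\<in>densities s. \<forall>k\<ge>1. (\<Sum>j<k. \<integral>\<^sup>+ x. ennreal ((phi s j x)\<^sup>2) \<partial>law f)
        \<le> ennreal Cphi * v_mom s f * ennreal (real k powr (1 / 2)))"

definition ahat :: "setting \<Rightarrow> nat \<Rightarrow> (nat \<Rightarrow> real) \<Rightarrow> nat \<Rightarrow> real" where
  "ahat s n X j = (1 / real n) * (\<Sum>i=1..n. phi s j (X i))"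

definition fhat :: "setting \<Rightarrow> nat \<Rightarrow> (nat \<Rightarrow> real) \<Rightarrow> nat \<Rightarrow> real \<Rightarrow> real" where
  "fhat s n X k x = (\<Sum>j<k. ahat s n X j * phi s j x)"

definition penhat :: "setting \<Rightarrow> real \<Rightarrow> nat \<Rightarrow> (nat \<Rightarrow> real) \<Rightarrow> nat \<Rightarrow> real" where
  "penhat s \<Delta> n X k = \<Delta> * vhat s n X * real k powr (1 / 2) / real n"

definition crit :: "setting \<Rightarrow> real \<Rightarrow> nat \<Rightarrow> (nat \<Rightarrow> real) \<Rightarrow> nat \<Rightarrow> real" where
  "crit s \<Delta> n X k = - (norm_on (dom_of s) (fhat s n X k))\<^sup>2 + penhat s \<Delta> n X k"

definition bayes_weight :: "setting \<Rightarrow> real \<Rightarrow> real \<Rightarrow> nat \<Rightarrow> (nat \<Rightarrow> real) \<Rightarrow> nat \<Rightarrow> real" where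
  "bayes_weight s \<Delta> \<kappa> n X k = exp (- \<kappa> * real n * crit s \<Delta> n X k)
     / (\<Sum>l=1..max_dim s n. exp (- \<kappa> * real n * crit s \<Delta> n X l))"

definition khat :: "setting \<Rightarrow> real \<Rightarrow> nat \<Rightarrow> (nat \<Rightarrow> real) \<Rightarrow> nat" where
  "khat s \<Delta> n X = (LEAST k. k \<in> {1..max_dim s n}
     \<and> (\<forall>l\<in>{1..max_dim s n}. crit s \<Delta> n X k \<le> crit s \<Delta> n X l))"

definition ms_weight :: "setting \<Rightarrow> real \<Rightarrow> nat \<Rightarrow> (nat \<Rightarrow> real) \<Rightarrow> nat \<Rightarrow> real" where
  "ms_weight s \<Delta> n X k = (if k = khat s \<Delta> n X then 1 else 0)"

definition aggregate ::
  "setting \<Rightarrow> nat \<Rightarrow> ((nat \<Rightarrow> real) \<Rightarrow> nat \<Rightarrow> real) \<Rightarrow> (nat \<Rightarrow> real) \<Rightarrow> real \<Rightarrow> real" where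
  "aggregate s n w X x = (\<Sum>k=1..max_dim s n. w X k * fhat s n X k x)"

definition risk ::
  "setting \<Rightarrow> nat \<Rightarrow> ((nat \<Rightarrow> real) \<Rightarrow> nat \<Rightarrow> real) \<Rightarrow> (real \<Rightarrow> real) \<Rightarrow> ennreal" where
  "risk s n w f =
     (\<integral>\<^sup>+ X. ennreal ((norm_on (dom_of s) (\<lambda>x. aggregate s n w X x - f x))\<^sup>2) \<partial>sample_law f n)"

definition rate_k :: "(nat \<Rightarrow> real) \<Rightarrow> nat \<Rightarrow> nat \<Rightarrow> real" where
  "rate_k \<omega> n k = max (\<omega> k) (real k powr (1 / 2) / real n)"

definition rate :: "setting \<Rightarrow> real \<Rightarrow> real \<Rightarrow> (nat \<Rightarrow> real) \<Rightarrow> nat \<Rightarrow> real" where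
  "rate s Cphi Comega \<omega> n = Min ((\<lambda>k. max (rate_k \<omega> n k)
     (exp (- (Cphi * real k powr (1 / 2) / (400 * Comega))))) ` {1..max_dim s n})"

end

theory Submission
  imports Defs
begin

text \<open>
  The criterion compares squared coefficient sums, so both families of weights satisfy
  $w_k \le \exp(-n(c_k - c_l))$ for all $k, l$; with convexity of the squared norm this alone yields
  a deterministic oracle inequality. Its only random ingredients are the excesses
  $(\|\widehat f_k - f_k\|^2 - 25 C_\varphi v_f k^{1/2}/(4n))_+$ and the event $\widehat v < v_f/2$,
  whose probability is $O(n^{-1})$.

  Instead of Talagrand's inequality, the excesses are bounded by running an exponential
  supermartingale argument with the smoothed norm $W(s) = (a^2 + \|s\|^2)^{1/2}$: the tangent bound
  $W(s + y) \le W(s) + (2\langle s, y\rangle + \|y\|^2)/(2 W(s))$ makes the variance of a direction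
  (controlled by $\|f\|_\infty$), and not the full trace, enter the quadratic term. Here $a^2 = nT$,
  where $T$ bounds the trace of the covariance.

  The bias is controlled by Parseval's identity. Completeness of the bases reduces to the fact
  that an exponentially integrable function with vanishing moments is zero: its Fourier transform
  vanishes near $0$ by a Taylor expansion, hence everywhere by repeating the expansion.
\<close>

section \<open>Functions determined by their moments\<close>

text \<open>The constants fit together as follows. With a^2 = nT the smoothed norm costs an exponent
  of about 2 l a, so the excess of the norm over (5/2) a keeps a factor exp(-l a / 2); squaring
  gives the threshold 25/4. The penalty at k must outweigh twice this threshold and the errors of
  the comparison dimension, for which 42 times C_phi v / n suffices. As the penalty contains
  \<open>vhat\<close> instead of v, the event \<open>vhat\<close> >= v/2 doubles this to 84.

  The concentration bound has two regimes. The variance of a direction is at most sqrt K, with K =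
  C_{omega,L}; it leads to exp(-sqrt k / (8 sqrt K)), whose sum over k is of order K^2, and a
  prefactor K makes K^3 / n. The sup bound on the basis leads to exp(-sqrt(n sqrt k / k^d) / 8).
  This has to be O(n^{-3}), because it is multiplied by sqrt k <= n and summed over up to n^2
  dimensions. The two choices of M_n guarantee this: for d = 1 the exponent is at least a multiple
  of log n, for d = 10/12 a power of n.\<close>

lemma power_le_fact_exp:
  fixes c x :: real
  assumes "c > 0" "x \<ge> 0"
  shows "x ^ k \<le> fact k / c ^ k * exp (c * x)"
proof -
  have "(c * x) ^ k / fact k \<le> exp (c * x)"
  proof -
    have "(c * x) ^ k /\<^sub>R fact k = (\<Sum>m\<in>{k}. (c * x) ^ m /\<^sub>R fact m)" by simp
    also have "\<dots> \<le> (\<Sum>m. (c * x) ^ m /\<^sub>R fact m)"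
      using assms by (intro sum_le_suminf summable_exp_generic) auto
    finally show ?thesis by (simp add: exp_def field_simps)
  qed
  then show ?thesis using assms by (simp add: power_mult_distrib field_simps)
qed

lemma integrable_power_times_if_exp:
  fixes g :: "real \<Rightarrow> real"
  assumes [measurable]: "g \<in> borel_measurable borel"
    and a: "a > 0" and int: "integrable lborel (\<lambda>x. exp (a * \<bar>x\<bar>) * \<bar>g x\<bar>)"
  shows "integrable lborel (\<lambda>x. x ^ k * g x)"
proof (rule Bochner_Integration.integrable_bound)
  show "integrable lborel (\<lambda>x. fact k / a ^ k * (exp (a * \<bar>x\<bar>) * \<bar>g x\<bar>))"
    using int by simp
  have "\<bar>x\<bar> ^ k * \<bar>g x\<bar> \<le> fact k / a ^ k * exp (a * \<bar>x\<bar>) * \<bar>g x\<bar>" for x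
    using a by (intro mult_right_mono power_le_fact_exp) auto
  then show "AE x in lborel. norm (x ^ k * g x) \<le> norm (fact k / a ^ k * (exp (a * \<bar>x\<bar>) * \<bar>g x\<bar>))"
    using a by (auto simp: abs_mult power_abs mult.assoc)
qed measurable

theorem AE_zero_if_moments_zero:
  fixes g :: "real \<Rightarrow> real"
  assumes meas [measurable]: "g \<in> borel_measurable borel"
    and a: "a > 0" and int: "integrable lborel (\<lambda>x. exp (a * \<bar>x\<bar>) * \<bar>g x\<bar>)"
    and mom: "\<And>k. (\<integral>x. x ^ k * g x \<partial>lborel) = 0"
  shows "AE x in lborel. g x = 0"
proof -
  \<comment> \<open>Half of the exponential rate absorbs the power \<open>x ^ k\<close>, the other
    half dominates the Taylor series in steps of length at most c.\<close>
  define c where "c = a / 2"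
  have c: "c > 0" using a by (simp add: c_def)
  define D where "D k x = fact k / c ^ k * (exp (a * \<bar>x\<bar>) * \<bar>g x\<bar>)" for k x
  have intD: "integrable lborel (D k)" for k unfolding D_def using int by simp
  have Dbound: "\<bar>x\<bar> ^ k * \<bar>g x\<bar> * exp (c * \<bar>x\<bar>) \<le> D k x" for k x
  proof -
    have "\<bar>x\<bar> ^ k * (\<bar>g x\<bar> * exp (c * \<bar>x\<bar>)) \<le> (fact k / c ^ k * exp (c * \<bar>x\<bar>)) * (\<bar>g x\<bar> * exp (c * \<bar>x\<bar>))"
      using c by (intro mult_right_mono power_le_fact_exp) auto
    also have "\<dots> = D k x" by (simp add: D_def c_def exp_add[symmetric] field_simps)
    finally show ?thesis by (simp add: mult.assoc)
  qed
  have exp1: "exp (c * \<bar>x\<bar>) \<ge> 1" for x using c by simp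
  have Dbound0: "\<bar>x\<bar> ^ k * \<bar>g x\<bar> \<le> D k x" for k x
    using mult_left_mono[OF exp1[of x], of "\<bar>x\<bar> ^ k * \<bar>g x\<bar>"] Dbound[of x k] by simp
  \<comment> \<open>Up to the factor i^k this is the k-th derivative of the Fourier transform of g.
    All k are carried together, since a Taylor expansion at t needs every derivative there.\<close>
  define \<Phi> where "\<Phi> k t = (CLINT x|lborel. complex_of_real (x ^ k * g x) * iexp (t * x))" for k t
  have intPhi: "integrable lborel (\<lambda>x. complex_of_real (x ^ k * g x) * iexp (t * x))" for k t
    by (rule Bochner_Integration.integrable_bound[OF intD[of k]])
       (use Dbound0 in \<open>auto simp: norm_mult norm_power abs_mult power_abs intro!: AE_I2 order_trans[OF Dbound0]\<close>)
  \<comment> \<open>The admissible step length c depends neither on t nor on k, so finitely many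
    equal steps from 0 reach any point of the line.\<close>
  have step: "\<Phi> k (t + s) = 0" if z: "\<And>k. \<Phi> k t = 0" and s: "\<bar>s\<bar> \<le> c" for k t s
  proof -
    define P where "P N x = (\<Sum>m<N. (\<i> * s) ^ m / fact m * (complex_of_real (x ^ (k + m) * g x) * iexp (t * x)))" for N x
    have lim: "(\<lambda>N. P N x) \<longlonglongrightarrow> complex_of_real (x ^ k * g x) * iexp ((t + s) * x)" for x
    proof -
      have "(\<lambda>N. \<Sum>m<N. (\<i> * (s * x)) ^ m /\<^sub>R fact m) \<longlonglongrightarrow> iexp (s * x)"
        using exp_converges[of "\<i> * complex_of_real (s * x)"] by (simp add: sums_def)
      then have "(\<lambda>N. (complex_of_real (x ^ k * g x) * iexp (t * x)) * (\<Sum>m<N. (\<i> * (s * x)) ^ m /\<^sub>R fact m))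
         \<longlonglongrightarrow> (complex_of_real (x ^ k * g x) * iexp (t * x)) * iexp (s * x)"
        by (rule tendsto_mult_left)
      moreover have "(complex_of_real (x ^ k * g x) * iexp (t * x)) * (\<Sum>m<N. (\<i> * (s * x)) ^ m /\<^sub>R fact m) = P N x" for N
        unfolding P_def sum_distrib_left
        by (intro sum.cong) (auto simp: power_mult_distrib power_add scaleR_conv_of_real field_simps)
      ultimately show ?thesis by (simp add: ring_distribs exp_add mult.assoc)
    qed
    have bnd: "norm (P N x) \<le> D k x" for N x
    proof -
      have "norm (P N x) \<le> (\<Sum>m<N. \<bar>x\<bar> ^ k * \<bar>g x\<bar> * ((\<bar>s\<bar> * \<bar>x\<bar>) ^ m / fact m))"
        unfolding P_def
        by (rule sum_norm_le)
           (simp add: norm_mult norm_divide norm_power power_add power_mult_distrib mult_ac)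
      also have "\<dots> = \<bar>x\<bar> ^ k * \<bar>g x\<bar> * (\<Sum>m<N. (\<bar>s\<bar> * \<bar>x\<bar>) ^ m /\<^sub>R fact m)"
        by (simp add: sum_distrib_left field_simps)
      also have "\<dots> \<le> \<bar>x\<bar> ^ k * \<bar>g x\<bar> * exp (\<bar>s\<bar> * \<bar>x\<bar>)"
        unfolding exp_def
        by (intro mult_left_mono sum_le_suminf summable_exp_generic) auto
      also have "\<dots> \<le> \<bar>x\<bar> ^ k * \<bar>g x\<bar> * exp (c * \<bar>x\<bar>)"
        using s by (intro mult_left_mono) (auto intro: mult_right_mono)
      also have "\<dots> \<le> D k x" by (rule Dbound)
      finally show ?thesis .
    qed
    have "(\<lambda>N. \<integral>x. P N x \<partial>lborel) \<longlonglongrightarrow> \<Phi> k (t + s)"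
      unfolding \<Phi>_def
    proof (rule integral_dominated_convergence[where w = "D k"])
      show "\<And>N. P N \<in> borel_measurable lborel" unfolding P_def by measurable
    qed (use lim bnd intD in auto)
    moreover have "(\<integral>x. P N x \<partial>lborel) = 0" for N
      unfolding P_def using intPhi z[unfolded \<Phi>_def]
      by (subst Bochner_Integration.integral_sum) auto
    ultimately show ?thesis by (simp add: LIMSEQ_const_iff)
  qed
  have Phi0: "\<Phi> k 0 = 0" for k
    unfolding \<Phi>_def using mom[of k] integral_complex_of_real[of lborel "\<lambda>x. x ^ k * g x"]
    by (simp del: of_real_mult of_real_power)
  have Phin: "\<Phi> k (real n * s) = 0" if "\<bar>s\<bar> \<le> c" for n s k
  proof (induction n arbitrary: k)
    case (Suc n)
    show ?case using step[OF Suc that] by (simp add: algebra_simps)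
  qed (use Phi0 in simp)
  have Phi: "\<Phi> k t = 0" for k t
  proof -
    obtain n where n: "\<bar>t\<bar> / c < real n" using reals_Archimedean2 by blast
    have n0: "real n > 0" using n c by (smt (verit) divide_nonneg_pos)
    have "\<bar>t / real n\<bar> \<le> c" using n n0 c by (simp add: field_simps)
    from Phin[OF this, of k n] show ?thesis using n0 by simp
  qed
  \<comment> \<open>Levy's uniqueness theorem speaks about probability measures. The positive and
    negative parts of g have the same mass m, by the vanishing zeroth moment, so both can be divided
    by it unless m = 0.\<close>
  define gp where "gp x = max 0 (g x)" for x
  define gm where "gm x = max 0 (- g x)" for x
  have [measurable]: "gp \<in> borel_measurable borel" "gm \<in> borel_measurable borel"
    unfolding gp_def gm_def by measurable
  have g_eq: "g x = gp x - gm x" for x by (simp add: gp_def gm_def)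
  have intg: "integrable lborel g"
    by (rule Bochner_Integration.integrable_bound[OF intD[of 0]]) (use Dbound0[of _ 0] in \<open>auto intro!: AE_I2 order_trans[OF _ abs_ge_self]\<close>)
  have ip: "integrable lborel gp" and im: "integrable lborel gm"
    by (rule Bochner_Integration.integrable_bound[OF intg]; auto simp: gp_def gm_def)+
  define m where "m = (\<integral>x. gp x \<partial>lborel)"
  have mm: "m = (\<integral>x. gm x \<partial>lborel)"
    using mom[of 0] ip im by (simp add: m_def g_eq)
  have pos: "gp x \<ge> 0" "gm x \<ge> 0" for x by (auto simp: gp_def gm_def)
  show ?thesis
  proof (cases "m = 0")
    case True
    have "AE x in lborel. gp x = 0" "AE x in lborel. gm x = 0"
      using integral_nonneg_eq_0_iff_AE[OF ip] integral_nonneg_eq_0_iff_AE[OF im] True mm pos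
      by (auto simp: m_def)
    then show ?thesis by eventually_elim (simp add: g_eq)
  next
    case False
    then have mpos: "m > 0" using pos unfolding m_def
      by (metis Bochner_Integration.integral_nonneg less_eq_real_def)
    have rd: "real_distribution (density lborel (\<lambda>x. ennreal (h x / m)))"
      if [measurable]: "h \<in> borel_measurable borel" and "integrable lborel h" "\<And>x. h x \<ge> 0" "(\<integral>x. h x \<partial>lborel) = m" for h
    proof -
      have "emeasure (density lborel (\<lambda>x. ennreal (h x / m))) UNIV = (\<integral>\<^sup>+x. ennreal (h x / m) \<partial>lborel)"
        by (simp add: emeasure_density)
      also have "\<dots> = ennreal (\<integral>x. h x / m \<partial>lborel)"
        using that mpos by (intro nn_integral_eq_integral) auto
      also have "\<dots> = 1" using that mpos by simp
      finally interpret prob_space "density lborel (\<lambda>x. ennreal (h x / m))"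
        by (intro prob_spaceI) simp
      show ?thesis by standard simp
    qed
    have ch: "char (density lborel (\<lambda>x. ennreal (h x / m))) t = (CLINT x|lborel. h x * iexp (t * x)) / m"
      if [measurable]: "h \<in> borel_measurable borel" and "\<And>x. h x \<ge> 0" for h t
    proof -
      have "char (density lborel (\<lambda>x. ennreal (h x / m))) t = (CLINT x|lborel. (h x / m) *\<^sub>R iexp (t * x))"
        unfolding char_def using that mpos by (subst integral_density) auto
      also have "\<dots> = (CLINT x|lborel. (1 / m) *\<^sub>R (h x * iexp (t * x)))"
        by (simp add: scaleR_conv_of_real)
      finally show ?thesis by (simp add: scaleR_conv_of_real field_simps)
    qed
    have ii: "integrable lborel (\<lambda>x. complex_of_real (h x) * iexp (t * x))"
      if "integrable lborel h" for h t
      by (rule Bochner_Integration.integrable_bound[OF that]) (use that in \<open>auto simp: norm_mult\<close>)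
    have "density lborel (\<lambda>x. ennreal (gp x / m)) = density lborel (\<lambda>x. ennreal (gm x / m))"
    proof (rule Levy_uniqueness[OF rd rd])
      show "char (density lborel (\<lambda>x. ennreal (gp x / m))) = char (density lborel (\<lambda>x. ennreal (gm x / m)))"
      proof
        fix t
        have "(CLINT x|lborel. gp x * iexp (t * x)) - (CLINT x|lborel. gm x * iexp (t * x)) = \<Phi> 0 t"
          unfolding \<Phi>_def using ii[OF ip, of t] ii[OF im, of t]
          by (simp add: g_eq left_diff_distrib)
        then show "char (density lborel (\<lambda>x. ennreal (gp x / m))) t = char (density lborel (\<lambda>x. ennreal (gm x / m))) t"
          using Phi[of 0 t] pos by (subst (1 2) ch) auto
      qed
    qed (use ip im pos mm in \<open>auto simp: m_def\<close>)
    then have "AE x in lborel. ennreal (gp x / m) = ennreal (gm x / m)"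
      by (intro sigma_finite_measure.density_unique[OF lborel.sigma_finite_measure_axioms]) auto
    then show ?thesis
    proof eventually_elim
      case (elim x)
      then show ?case using mpos pos[of x] by (simp add: g_eq)
    qed
  qed
qed

section \<open>Laguerre functions\<close>

text \<open>The polynomials have exact degree k and hence span all monomials: strong induction
  removes the lower moments, and the non-zero leading coefficient leaves the k-th one. In this form
  both bases obtain their completeness.\<close>

lemma AE_zero_if_orthogonal_to_polynomials:
  fixes g :: "real \<Rightarrow> real" and c :: "nat \<Rightarrow> nat \<Rightarrow> real"
  assumes meas [measurable]: "g \<in> borel_measurable borel"
    and a: "a > 0" and int: "integrable lborel (\<lambda>x. exp (a * \<bar>x\<bar>) * \<bar>g x\<bar>)"
    and c: "\<And>k. c k k \<noteq> 0"
    and orth: "\<And>k. (\<integral>x. (\<Sum>m\<le>k. c k m * x ^ m) * g x \<partial>lborel) = 0"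
  shows "AE x in lborel. g x = 0"
proof (rule AE_zero_if_moments_zero[OF meas a int])
  note i = integrable_power_times_if_exp[OF meas a int]
  show "(\<integral>x. x ^ k * g x \<partial>lborel) = 0" for k
  proof (induction k rule: less_induct)
    case (less k)
    have "0 = (\<integral>x. (\<Sum>m\<le>k. c k m * (x ^ m * g x)) \<partial>lborel)"
      using orth[of k] by (simp add: sum_distrib_right mult.assoc)
    also have "\<dots> = (\<Sum>m\<le>k. c k m * (\<integral>x. x ^ m * g x \<partial>lborel))"
      using i by (subst Bochner_Integration.integral_sum) auto
    also have "\<dots> = c k k * (\<integral>x. x ^ k * g x \<partial>lborel) + (\<Sum>m<k. c k m * (\<integral>x. x ^ m * g x \<partial>lborel))"
      by (simp add: lessThan_Suc_atMost[symmetric])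
    also have "(\<Sum>m<k. c k m * (\<integral>x. x ^ m * g x \<partial>lborel)) = 0"
      by (rule sum.neutral) (simp add: less.IH)
    finally have "c k k * (\<integral>x. x ^ k * g x \<partial>lborel) = 0" by simp
    then show ?case using c[of k] by (metis mult_eq_0_iff)
  qed
qed

lemma abs_mult_le_sum_squares: "\<bar>x * y\<bar> \<le> x\<^sup>2 + y\<^sup>2" for x y :: real
proof -
  have "2 * (\<bar>x\<bar> * \<bar>y\<bar>) \<le> x\<^sup>2 + y\<^sup>2" using sum_squares_bound[of "\<bar>x\<bar>" "\<bar>y\<bar>"] by simp
  moreover have "0 \<le> \<bar>x\<bar> * \<bar>y\<bar>" by simp
  ultimately show ?thesis unfolding abs_mult by linarith
qed

lemma integrable_mult_L2:
  fixes f g :: "'a \<Rightarrow> real"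
  assumes [measurable]: "f \<in> borel_measurable M" "g \<in> borel_measurable M"
    and "integrable M (\<lambda>x. (f x)\<^sup>2)" "integrable M (\<lambda>x. (g x)\<^sup>2)"
  shows "integrable M (\<lambda>x. f x * g x)"
  by (rule Bochner_Integration.integrable_bound[of M "\<lambda>x. (f x)\<^sup>2 + (g x)\<^sup>2"])
     (use assms abs_mult_le_sum_squares in auto)

text \<open>Up to the sign (-1)^i the left side is the i-th forward difference of x -> binomial(x,
  m) at x = r, and each difference lowers m by one. Pascal's rule drives the induction, in which r
  and m must vary.\<close>

lemma alternating_binomial_sum:
  "(\<Sum>k\<le>i. (-1) ^ k * real (i choose k) * real ((k + r) choose m))
    = (if i \<le> m then (-1) ^ i * real (r choose (m - i)) else 0)"
proof (induction i arbitrary: r m)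
  case (Suc i)
  define f where "f r k = (-1) ^ k * real (i choose k) * real ((k + r) choose m)" for r k
  have s: "(\<Sum>k\<le>i. f r k) = f r 0 + (\<Sum>k\<le>i. f r (Suc k))" for r
  proof -
    have "(\<Sum>k\<le>i. f r k) = (\<Sum>k\<le>Suc i. f r k)" by (simp add: f_def)
    then show ?thesis by (simp only: sum.atMost_Suc_shift)
  qed
  have "(\<Sum>k\<le>Suc i. (-1) ^ k * real (Suc i choose k) * real ((k + r) choose m))
      = f r 0 + (\<Sum>k\<le>i. f r (Suc k) - f (Suc r) k)"
    by (subst sum.atMost_Suc_shift) (auto simp: f_def algebra_simps intro!: sum.cong)
  also have "\<dots> = (\<Sum>k\<le>i. f r k) - (\<Sum>k\<le>i. f (Suc r) k)"
    by (simp add: s[of r] sum_subtractf)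
  finally have eq: "(\<Sum>k\<le>Suc i. (-1) ^ k * real (Suc i choose k) * real ((k + r) choose m))
      = (\<Sum>k\<le>i. f r k) - (\<Sum>k\<le>i. f (Suc r) k)" .
  show ?case
  proof (cases m)
    case 0
    then show ?thesis unfolding eq by (simp add: f_def)
  next
    case (Suc m')
    have "(\<Sum>k\<le>i. f r k) - (\<Sum>k\<le>i. f (Suc r) k) = - (\<Sum>k\<le>i. (-1) ^ k * real (i choose k) * real ((k + r) choose m'))"
      unfolding sum_subtractf[symmetric] sum_negf[symmetric]
      by (auto simp: f_def Suc algebra_simps intro!: sum.cong)
    then show ?thesis unfolding eq Suc.IH using Suc by simp
  qed
qed simp

lemma laguerre_fun_eq:
  "laguerre_fun j x = (\<Sum>k\<le>j. sqrt 2 * ((-1) ^ k * real (j choose k) / fact k) * (2 * x) ^ k) * (exp (- x) * indicator {0<..} x)"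
  by (simp add: laguerre_fun_def laguerre_poly_def atLeast0AtMost sum_distrib_left sum_distrib_right field_simps)

lemma laguerre_fun_measurable [measurable]: "laguerre_fun j \<in> borel_measurable borel"
  unfolding laguerre_fun_eq[abs_def] by measurable

lemma has_bochner_integral_power_exp_2:
  "has_bochner_integral lborel (\<lambda>x::real. 2 * ((2 * x) ^ k * exp (- (2 * x)) * indicator {0<..} x)) (fact k)"
proof -
  have "has_bochner_integral lborel (\<lambda>x::real. (0 + 2 * x) ^ k * exp (- (0 + 2 * x)) * indicator {0<..} (0 + 2 * x)) (fact k /\<^sub>R \<bar>2::real\<bar>)"
    by (subst lborel_has_bochner_integral_real_affine_iff[symmetric]) (auto intro: has_bochner_integral_I0i_power_exp_m)
  then have "has_bochner_integral lborel (\<lambda>x::real. 2 * ((0 + 2 * x) ^ k * exp (- (0 + 2 * x)) * indicator {0<..} (0 + 2 * x))) (2 * (fact k /\<^sub>R \<bar>2::real\<bar>))"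
    by (rule has_bochner_integral_mult_right)
  moreover have "indicator {0<..} (2 * x) = (indicator {0<..} x :: real)" for x :: real
    by (simp add: indicator_def)
  ultimately show ?thesis by (simp add: power_mult_distrib)
qed

text \<open>As (k + m)! / (k! m!) is a binomial coefficient, the inner sum over k is an alternating
  one that vanishes unless i <= m. Together with m <= j <= i this leaves only m = i = j; the
  hypothesis j <= i decides which factor is summed first.\<close>

lemma laguerre_fun_has_integral:
  assumes ij: "j \<le> i"
  shows "has_bochner_integral lborel (\<lambda>x. laguerre_fun i x * laguerre_fun j x) (if i = j then 1 else 0)"
proof -
  define c where "c i k = (-1) ^ k * real (i choose k)" for i k :: nat
  have eq: "laguerre_fun i x * laguerre_fun j x =
     (\<Sum>m\<le>j. \<Sum>k\<le>i. c j m * c i k / (fact m * fact k) * (2 * ((2 * x) ^ (k + m) * exp (- (2 * x)) * indicator {0<..} x)))" for x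
  proof -
    have "laguerre_fun i x * laguerre_fun j x = (2 * (exp (- (2 * x)) * indicator {0<..} x)) *
      ((\<Sum>m\<le>j. c j m / fact m * (2 * x) ^ m) * (\<Sum>k\<le>i. c i k / fact k * (2 * x) ^ k))"
      by (simp add: laguerre_fun_def laguerre_poly_def atLeast0AtMost c_def mult_exp_exp indicator_def field_simps)
    also have "\<dots> = (2 * (exp (- (2 * x)) * indicator {0<..} x)) *
      (\<Sum>m\<le>j. \<Sum>k\<le>i. (c j m / fact m * (2 * x) ^ m) * (c i k / fact k * (2 * x) ^ k))"
      by (simp only: sum_product)
    finally show ?thesis
      by (simp add: sum_distrib_left power_add mult_ac)
  qed
  have "has_bochner_integral lborel (\<lambda>x. laguerre_fun i x * laguerre_fun j x)
     (\<Sum>m\<le>j. \<Sum>k\<le>i. c j m * c i k / (fact m * fact k) * fact (k + m))"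
    unfolding eq
    by (intro has_bochner_integral_sum has_bochner_integral_mult_right has_bochner_integral_power_exp_2)
  moreover have "(\<Sum>m\<le>j. \<Sum>k\<le>i. c j m * c i k / (fact m * fact k) * fact (k + m)) = (if i = j then 1 else 0)"
  proof -
    have inner: "(\<Sum>k\<le>i. c j m * c i k / (fact m * fact k) * fact (k + m))
       = (if i \<le> m then c j m * ((-1) ^ i * real (m choose (m - i))) else 0)" for m
    proof -
      have "(\<Sum>k\<le>i. c j m * c i k / (fact m * fact k) * fact (k + m))
        = c j m * (\<Sum>k\<le>i. (-1) ^ k * real (i choose k) * real ((k + m) choose m))"
        unfolding sum_distrib_left
        by (intro sum.cong refl) (simp add: c_def binomial_fact field_simps)
      then show ?thesis by (simp add: alternating_binomial_sum)
    qed
    have "(\<Sum>m\<le>j. \<Sum>k\<le>i. c j m * c i k / (fact m * fact k) * fact (k + m))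
      = (\<Sum>m\<le>j. if m = i then (if i = j then 1 else 0) else 0)"
      unfolding inner using ij
      by (intro sum.cong refl) (auto simp: c_def power_mult_distrib[symmetric])
    then show ?thesis by (simp add: sum.delta)
  qed
  ultimately show ?thesis by simp
qed

lemma laguerre_fun_orthonormal:
  "integrable lborel (\<lambda>x. laguerre_fun i x * laguerre_fun j x)"
  "(\<integral>x. laguerre_fun i x * laguerre_fun j x \<partial>lborel) = (if i = j then 1 else 0)"
proof -
  have "has_bochner_integral lborel (\<lambda>x. laguerre_fun i x * laguerre_fun j x) (if i = j then 1 else 0)"
    using laguerre_fun_has_integral[of j i] laguerre_fun_has_integral[of i j]
    by (cases "j \<le> i") (auto simp: mult.commute)
  then show "integrable lborel (\<lambda>x. laguerre_fun i x * laguerre_fun j x)"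
    "(\<integral>x. laguerre_fun i x * laguerre_fun j x \<partial>lborel) = (if i = j then 1 else 0)"
    by (auto simp: has_bochner_integral_iff)
qed

lemma laguerre_fun_complete:
  assumes [measurable]: "g \<in> borel_measurable borel" and g2: "integrable lborel (\<lambda>x. (g x)\<^sup>2)"
    and supp: "\<And>x. x \<le> 0 \<Longrightarrow> g x = 0"
    and orth: "\<And>j. (\<integral>x. g x * laguerre_fun j x \<partial>lborel) = 0"
  shows "AE x in lborel. g x = 0"
proof -
  define h where "h x = g x * (exp (- x) * indicator {0<..} x)" for x
  have [measurable]: "h \<in> borel_measurable borel" unfolding h_def by measurable
  have "AE x in lborel. h x = 0"
  proof (rule AE_zero_if_orthogonal_to_polynomials[where a = "1/2" and c = "\<lambda>j k. sqrt 2 * ((-1) ^ k * real (j choose k) / fact k) * 2 ^ k"])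
    show "integrable lborel (\<lambda>x. exp (1 / 2 * \<bar>x\<bar>) * \<bar>h x\<bar>)"
    proof (rule Bochner_Integration.integrable_bound)
      show "integrable lborel (\<lambda>x. (g x)\<^sup>2 + x ^ 0 * exp (- x) * indicator {0<..} x)"
        using g2 has_bochner_integral_I0i_power_exp_m[of 0]
        by (intro Bochner_Integration.integrable_add) (auto simp: has_bochner_integral_iff)
      have "exp (1 / 2 * \<bar>x\<bar>) * \<bar>h x\<bar> \<le> (g x)\<^sup>2 + x ^ 0 * exp (- x) * indicator {0<..} x" for x :: real
      proof (cases "x > 0")
        case True
        \<comment> \<open>Half of the weight exp(-x) is spent on the growth factor; the remaining
          exp(-x/2) is still square integrable on the half line.\<close>
        have "exp (1 / 2 * \<bar>x\<bar>) * \<bar>h x\<bar> = \<bar>g x * exp (- x / 2)\<bar>"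
          using True by (simp add: h_def abs_mult mult_exp_exp)
        also have "\<dots> \<le> (g x)\<^sup>2 + (exp (- x / 2))\<^sup>2" by (rule abs_mult_le_sum_squares)
        also have "(exp (- x / 2))\<^sup>2 = exp (- x)" by (simp add: exp_double[symmetric])
        finally show ?thesis using True by simp
      qed (simp add: h_def)
      then show "AE x in lborel. norm (exp (1 / 2 * \<bar>x\<bar>) * \<bar>h x\<bar>) \<le> norm ((g x)\<^sup>2 + x ^ 0 * exp (- x) * indicator {0<..} x)"
        by (auto intro!: AE_I2 order_trans[OF _ abs_ge_self])
    qed measurable
    show "(\<integral>x. (\<Sum>m\<le>k. sqrt 2 * ((-1) ^ m * real (k choose m) / fact m) * 2 ^ m * x ^ m) * h x \<partial>lborel) = 0" for k
      using orth[of k] by (simp add: h_def laguerre_fun_eq power_mult_distrib mult_ac)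
  qed simp_all
  then show ?thesis
  proof eventually_elim
    case (elim x)
    then show ?case using supp[of x] by (cases "x > 0") (auto simp: h_def)
  qed
qed

section \<open>Hermite functions\<close>

definition gauss_moment :: "nat \<Rightarrow> real" where
  "gauss_moment m = (if even m then sqrt pi * fact m / (2 ^ m * fact (m div 2)) else 0)"

lemma has_bochner_integral_gauss_moment:
  "has_bochner_integral lborel (\<lambda>x. exp (- x\<^sup>2) * x ^ m) (gauss_moment m)"
proof (cases "even m")
  case True
  then obtain k where k: "m = 2 * k" by blast
  have "has_bochner_integral lborel (\<lambda>x. exp (- x\<^sup>2) * x ^ (2 * k)) (2 *\<^sub>R ((sqrt pi / 2) * (fact (2 * k) / (2 ^ (2 * k) * fact k))))"
    by (rule has_bochner_integral_even_function[OF gaussian_moment_even_pos]) simp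
  then show ?thesis by (simp add: k gauss_moment_def)
next
  case False
  then obtain k where k: "m = 2 * k + 1" by (rule oddE)
  have "has_bochner_integral lborel (\<lambda>x::real. exp (- x\<^sup>2) * x ^ (2 * k + 1)) 0"
    by (rule has_bochner_integral_odd_function[OF gaussian_moment_odd_pos]) simp
  then show ?thesis by (simp add: k gauss_moment_def)
qed

text \<open>The derivative of x^m exp(-x^2) integrates to 0, written in moments. For even m both
  sides vanish; at m = 0 the truncated index is harmless thanks to the factor m.\<close>

lemma gauss_moment_rec: "real m * gauss_moment (m - 1) = 2 * gauss_moment (Suc m)"
proof (cases "even m")
  case True
  then show ?thesis by (cases m) (auto simp: gauss_moment_def)
next
  case False
  then obtain k where k: "m = 2 * k + 1" by (rule oddE)
  define L where "L = real k + 1"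
  have L: "L > 0" by (simp add: L_def)
  have "gauss_moment (Suc m) = sqrt pi * (2 * L * (real m * fact (2 * k))) / (4 * 2 ^ (2 * k) * (L * fact k))"
    by (simp add: k L_def gauss_moment_def algebra_simps)
  then show ?thesis using L by (simp add: k gauss_moment_def mult_ac)
qed

definition gauss_integral :: "real poly \<Rightarrow> real" where
  "gauss_integral p = (\<integral>x. poly p x * exp (- x\<^sup>2) \<partial>lborel)"

lemma has_bochner_integral_gauss_poly:
  "has_bochner_integral lborel (\<lambda>x. poly p x * exp (- x\<^sup>2)) (\<Sum>i\<le>degree p. coeff p i * gauss_moment i)"
proof -
  have "has_bochner_integral lborel (\<lambda>x. \<Sum>i\<le>degree p. coeff p i * (exp (- x\<^sup>2) * x ^ i)) (\<Sum>i\<le>degree p. coeff p i * gauss_moment i)"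
    by (intro has_bochner_integral_sum has_bochner_integral_mult_right has_bochner_integral_gauss_moment)
  then show ?thesis by (simp add: poly_altdef sum_distrib_left sum_distrib_right mult_ac)
qed

lemma integrable_gauss_poly: "integrable lborel (\<lambda>x::real. poly p x * exp (- x\<^sup>2))"
  using has_bochner_integral_gauss_poly[of p] by (simp add: has_bochner_integral_iff)

lemma gauss_integral_add: "gauss_integral (p + q) = gauss_integral p + gauss_integral q"
  using integrable_gauss_poly[of p] integrable_gauss_poly[of q]
  by (simp add: gauss_integral_def distrib_right)

lemma gauss_integral_sum: "gauss_integral (\<Sum>i\<in>I. p i) = (\<Sum>i\<in>I. gauss_integral (p i))"
proof (induction I rule: infinite_finite_induct)
qed (simp_all add: gauss_integral_add gauss_integral_def[of 0])

lemma gauss_integral_monom: "gauss_integral (monom c m) = c * gauss_moment m"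
proof -
  have "has_bochner_integral lborel (\<lambda>x. c * (exp (- x\<^sup>2) * x ^ m)) (c * gauss_moment m)"
    by (intro has_bochner_integral_mult_right has_bochner_integral_gauss_moment)
  then show ?thesis
    by (simp add: gauss_integral_def poly_monom has_bochner_integral_iff mult_ac)
qed

text \<open>Differentiation conjugated with the Gaussian weight: the derivative of p exp(-x^2) is
  this polynomial times exp(-x^2).\<close>

definition gauss_deriv :: "real poly \<Rightarrow> real poly" where
  "gauss_deriv p = pderiv p - [:0, 2:] * p"

text \<open>A total derivative has integral 0. By linearity it is enough to treat monomials, where
  this is the moment recursion; thus no boundary terms at infinity have to be discussed.\<close>

lemma gauss_integral_gauss_deriv: "gauss_integral (gauss_deriv p) = 0"
proof -
  have sum: "gauss_deriv (\<Sum>i\<in>I. q i) = (\<Sum>i\<in>I. gauss_deriv (q i))" for I :: "nat set" and q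
    by (induction I rule: infinite_finite_induct)
       (simp_all add: gauss_deriv_def pderiv_add algebra_simps smult_add_right)
  have monom: "gauss_integral (gauss_deriv (monom c m)) = 0" for c m
  proof -
    have "gauss_deriv (monom c m) = monom (real m * c) (m - 1) + monom (- 2 * c) (Suc m)"
      by (rule poly_eqI) (auto simp: gauss_deriv_def pderiv_monom coeff_pCons monom_Suc split: nat.splits)
    then have "gauss_integral (gauss_deriv (monom c m)) = c * (real m * gauss_moment (m - 1) - 2 * gauss_moment (Suc m))"
      by (simp add: gauss_integral_add gauss_integral_monom algebra_simps)
    then show ?thesis using gauss_moment_rec[of m] by simp
  qed
  have "gauss_integral (gauss_deriv (\<Sum>i\<le>degree p. monom (coeff p i) i)) = 0"
    by (simp add: sum gauss_integral_sum monom)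
  then show ?thesis by (simp add: poly_as_sum_of_monoms)
qed

lemma gauss_integral_by_parts:
  "gauss_integral (p * gauss_deriv q) = - gauss_integral (pderiv p * q)"
proof -
  have "gauss_deriv (p * q) = p * gauss_deriv q + pderiv p * q"
    by (simp add: gauss_deriv_def pderiv_mult algebra_simps)
  then show ?thesis
    using gauss_integral_gauss_deriv[of "p * q"] by (simp add: gauss_integral_add)
qed

text \<open>The Hermite polynomial without its sign (-1)^j, so that it arises by iterating a single
  operator.\<close>

definition hermite_aux :: "nat \<Rightarrow> real poly" where
  "hermite_aux j = (gauss_deriv ^^ j) 1"

lemma deriv_iter_gauss: "(deriv ^^ j) (\<lambda>y. exp (- y\<^sup>2)) = (\<lambda>x. poly (hermite_aux j) x * exp (- x\<^sup>2))"
proof (induction j)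
  case (Suc j)
  have "deriv (\<lambda>x. poly (hermite_aux j) x * exp (- x\<^sup>2)) x = poly (hermite_aux (Suc j)) x * exp (- x\<^sup>2)" for x
    by (rule DERIV_imp_deriv)
       (auto intro!: derivative_eq_intros simp: hermite_aux_def gauss_deriv_def algebra_simps)
  then show ?case by (simp add: Suc.IH)
qed (simp add: hermite_aux_def)

lemma hermite_poly_eq: "hermite_poly j x = (-1) ^ j * poly (hermite_aux j) x"
  by (simp add: hermite_poly_def deriv_iter_gauss mult_exp_exp mult.assoc)

text \<open>The non-zero leading coefficient serves twice: for the norm of the Hermite functions and
  as the diagonal of the triangular system in the completeness proof.\<close>

lemma degree_hermite_aux: "degree (hermite_aux j) \<le> j"
  and coeff_hermite_aux: "coeff (hermite_aux j) j = (- 2) ^ j"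
proof (induction j)
  case (Suc j)
  have eq: "hermite_aux (Suc j) = pderiv (hermite_aux j) - pCons 0 (smult 2 (hermite_aux j))"
    by (simp add: hermite_aux_def gauss_deriv_def)
  { case 1
    show ?case unfolding eq using Suc(1)
      by (intro degree_diff_le) (auto simp: degree_pderiv intro!: order_trans[OF degree_pCons_le]) }
  { case 2
    show ?case unfolding eq using Suc by (simp add: coeff_pderiv coeff_eq_0) }
qed (auto simp: hermite_aux_def)

text \<open>Integrating by parts j times moves all derivatives to p, of which only j! times its j-th
  coefficient survives. This yields orthogonality when the degree is below j and the norm when it is
  j.\<close>

lemma gauss_integral_hermite_aux:
  "degree p \<le> j \<Longrightarrow> gauss_integral (p * hermite_aux j) = (-1) ^ j * fact j * coeff p j * sqrt pi"
proof (induction j arbitrary: p)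
  case 0
  then have "p = monom (coeff p 0) 0" by (auto elim: degree_eq_zeroE simp: monom_0)
  then show ?case using gauss_integral_monom[of "coeff p 0" 0]
    by (simp add: hermite_aux_def gauss_moment_def)
next
  case (Suc j)
  have "gauss_integral (p * hermite_aux (Suc j)) = - gauss_integral (pderiv p * hermite_aux j)"
    using gauss_integral_by_parts by (simp add: hermite_aux_def)
  also have "\<dots> = - ((-1) ^ j * fact j * coeff (pderiv p) j * sqrt pi)"
    using Suc by (simp add: degree_pderiv)
  finally show ?case by (simp add: coeff_pderiv algebra_simps)
qed

lemma hermite_fun_eq:
  "hermite_fun j x = (2 ^ j * fact j * sqrt pi) powr (- 1 / 2) * (-1) ^ j * poly (hermite_aux j) x * exp (- x\<^sup>2 / 2)"
  by (simp add: hermite_fun_def hermite_poly_eq)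

lemma hermite_fun_measurable [measurable]: "hermite_fun j \<in> borel_measurable borel"
  unfolding hermite_fun_eq[abs_def] poly_altdef by measurable

lemma hermite_fun_orthonormal:
  shows "integrable lborel (\<lambda>x. hermite_fun i x * hermite_fun j x)"
    and "(\<integral>x. hermite_fun i x * hermite_fun j x \<partial>lborel) = (if i = j then 1 else 0)"
proof -
  define c where "c j = (2 ^ j * fact j * sqrt pi) powr (- 1 / 2) * (-1) ^ j" for j
  have eq: "hermite_fun i x * hermite_fun j x = (c i * c j) * (poly (hermite_aux i * hermite_aux j) x * exp (- x\<^sup>2))" for i j x
    by (simp add: hermite_fun_eq c_def mult_exp_exp)
  show "integrable lborel (\<lambda>x. hermite_fun i x * hermite_fun j x)"
    unfolding eq by (intro integrable_mult_right integrable_gauss_poly)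
  have int: "(\<integral>x. hermite_fun i x * hermite_fun j x \<partial>lborel) = (c i * c j) * gauss_integral (hermite_aux i * hermite_aux j)" for i j
    unfolding eq gauss_integral_def by simp
  have lt: "gauss_integral (hermite_aux i * hermite_aux j) = 0" if "i < j" for i j
    using that degree_hermite_aux[of i] gauss_integral_hermite_aux[of "hermite_aux i" j]
    by (simp add: coeff_eq_0)
  have cc: "c j * c j * (2 ^ j * fact j * sqrt pi) = 1" for j
  proof -
    define t where "t = 2 ^ j * fact j * sqrt pi"
    have "t > 0" by (simp add: t_def)
    then have "t powr (- 1 / 2) * t powr (- 1 / 2) * t = 1"
      by (subst powr_add[symmetric]) (simp add: powr_minus)
    moreover have "c j * c j = t powr (- 1 / 2) * t powr (- 1 / 2)"
      by (simp add: c_def t_def power_mult_distrib[symmetric])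
    ultimately show ?thesis by (simp add: t_def)
  qed
  have eqj: "gauss_integral (hermite_aux j * hermite_aux j) = 2 ^ j * fact j * sqrt pi" for j
    using gauss_integral_hermite_aux[OF degree_hermite_aux, of j]
    by (simp add: coeff_hermite_aux power_mult_distrib[symmetric])
  show "(\<integral>x. hermite_fun i x * hermite_fun j x \<partial>lborel) = (if i = j then 1 else 0)"
  proof (cases i j rule: linorder_cases)
    case less
    then show ?thesis by (simp add: int lt)
  next
    case equal
    then show ?thesis by (simp add: int eqj cc)
  next
    case greater
    then show ?thesis using lt[of j i] by (simp add: int mult.commute)
  qed
qed

lemma hermite_fun_complete:
  assumes [measurable]: "g \<in> borel_measurable borel" and g2: "integrable lborel (\<lambda>x. (g x)\<^sup>2)"
    and orth: "\<And>j. (\<integral>x. g x * hermite_fun j x \<partial>lborel) = 0"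
  shows "AE x in lborel. g x = 0"
proof -
  define h where "h x = g x * exp (- x\<^sup>2 / 2)" for x
  have [measurable]: "h \<in> borel_measurable borel" unfolding h_def by measurable
  have "AE x in lborel. h x = 0"
  proof (rule AE_zero_if_orthogonal_to_polynomials[where a = "1/4" and c = "\<lambda>j k. coeff (hermite_aux j) k"])
    show "integrable lborel (\<lambda>x. exp (1 / 4 * \<bar>x\<bar>) * \<bar>h x\<bar>)"
    proof (rule Bochner_Integration.integrable_bound)
      have "has_bochner_integral lborel (\<lambda>x. exp (- (0 + (1 / sqrt 2) * x)\<^sup>2) * (0 + (1 / sqrt 2) * x) ^ 0) (gauss_moment 0 /\<^sub>R \<bar>1 / sqrt 2\<bar>)"
        by (subst lborel_has_bochner_integral_real_affine_iff[symmetric]) (auto intro: has_bochner_integral_gauss_moment[of 0, simplified])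
      then have "integrable lborel (\<lambda>x::real. exp (- x\<^sup>2 / 2))"
        by (simp add: has_bochner_integral_iff power_divide)
      then show "integrable lborel (\<lambda>x. (g x)\<^sup>2 + exp (1/2) * exp (- x\<^sup>2 / 2))"
        using g2 by auto
      have "exp (1 / 4 * \<bar>x\<bar>) * \<bar>h x\<bar> \<le> (g x)\<^sup>2 + exp (1/2) * exp (- x\<^sup>2 / 2)" for x :: real
      proof -
        have "exp (1 / 4 * \<bar>x\<bar>) * \<bar>h x\<bar> = \<bar>g x * exp (1 / 4 * \<bar>x\<bar> - x\<^sup>2 / 2)\<bar>"
          by (simp add: h_def abs_mult mult_exp_exp)
        also have "\<dots> \<le> (g x)\<^sup>2 + (exp (1 / 4 * \<bar>x\<bar> - x\<^sup>2 / 2))\<^sup>2" by (rule abs_mult_le_sum_squares)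
        also have "(exp (1 / 4 * \<bar>x\<bar> - x\<^sup>2 / 2))\<^sup>2 = exp (\<bar>x\<bar> / 2 - x\<^sup>2)" by (simp add: exp_double[symmetric])
        also have "\<dots> \<le> exp (1/2 + - x\<^sup>2 / 2)"
        proof -
          \<comment> \<open>Hence |x|/2 - x^2 <= 1/2 - x^2/2, which is the source of the factor
            exp(1/2) in the majorant.\<close>
          have "\<bar>x\<bar> \<le> 1 + x\<^sup>2" using zero_le_power2[of "\<bar>x\<bar> - 1/2"] by (simp add: power2_diff power_divide)
          then show ?thesis by simp
        qed
        finally show ?thesis by (simp add: mult_exp_exp)
      qed
      then show "AE x in lborel. norm (exp (1 / 4 * \<bar>x\<bar>) * \<bar>h x\<bar>) \<le> norm ((g x)\<^sup>2 + exp (1/2) * exp (- x\<^sup>2 / 2))"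
        by (auto intro!: AE_I2 order_trans[OF _ abs_ge_self])
    qed measurable
    show "(\<integral>x. (\<Sum>m\<le>k. coeff (hermite_aux k) m * x ^ m) * h x \<partial>lborel) = 0" for k
    proof -
      define c where "c = (2 ^ k * fact k * sqrt pi) powr (- 1 / 2) * (-1) ^ k"
      have "c \<noteq> 0" by (simp add: c_def)
      have p: "(\<Sum>m\<le>k. coeff (hermite_aux k) m * x ^ m) = poly (hermite_aux k) x" for x
        using degree_hermite_aux[of k] by (auto simp: poly_altdef intro!: sum.mono_neutral_right le_degree)
      have "0 = (\<integral>x. c * (poly (hermite_aux k) x * h x) \<partial>lborel)"
        using orth[of k] by (simp add: h_def hermite_fun_eq c_def mult_ac)
      then show ?thesis using \<open>c \<noteq> 0\<close> unfolding p by simp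
    qed
  qed (simp_all add: coeff_hermite_aux)
  then show ?thesis by eventually_elim (auto simp: h_def)
qed

section \<open>Parseval's identity\<close>

text \<open>All functions live on the whole line and vanish outside A, so integrals over A become
  integrals over the line. Completeness is assumed in its weak form, that only null functions are
  orthogonal to the whole system; Parseval's identity is derived from it.\<close>

locale orthonormal_basis =
  fixes A :: "real set" and \<phi> :: "nat \<Rightarrow> real \<Rightarrow> real"
  assumes meas [measurable]: "\<And>j. \<phi> j \<in> borel_measurable borel"
    and supp: "\<And>j x. x \<notin> A \<Longrightarrow> \<phi> j x = 0"
    and integrable_mult: "\<And>i j. integrable lborel (\<lambda>x. \<phi> i x * \<phi> j x)"
    and ortho: "\<And>i j. (\<integral>x. \<phi> i x * \<phi> j x \<partial>lborel) = (if i = j then 1 else 0)"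
    and complete: "\<And>g. \<lbrakk>g \<in> borel_measurable borel; integrable lborel (\<lambda>x. (g x)\<^sup>2);
       \<And>x. x \<notin> A \<Longrightarrow> g x = 0; \<And>j. (\<integral>x. g x * \<phi> j x \<partial>lborel) = 0\<rbrakk> \<Longrightarrow> AE x in lborel. g x = 0"
begin

definition fcoeff :: "(real \<Rightarrow> real) \<Rightarrow> nat \<Rightarrow> real" where
  "fcoeff f j = (\<integral>x. f x * \<phi> j x \<partial>lborel)"

lemma integrable_sq: "integrable lborel (\<lambda>x. (\<phi> j x)\<^sup>2)"
  using integrable_mult[of j j] by (simp add: power2_eq_square)

lemma combination_sq:
  assumes "finite J"
  shows "integrable lborel (\<lambda>x. (\<Sum>j\<in>J. c j * \<phi> j x)\<^sup>2)"
    and "(\<integral>x. (\<Sum>j\<in>J. c j * \<phi> j x)\<^sup>2 \<partial>lborel) = (\<Sum>j\<in>J. (c j)\<^sup>2)"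
proof -
  have eq: "(\<Sum>j\<in>J. c j * \<phi> j x)\<^sup>2 = (\<Sum>i\<in>J. \<Sum>j\<in>J. (c i * c j) * (\<phi> i x * \<phi> j x))" for x
    by (simp add: power2_eq_square sum_product mult_ac)
  show "integrable lborel (\<lambda>x. (\<Sum>j\<in>J. c j * \<phi> j x)\<^sup>2)"
    unfolding eq using integrable_mult by (intro Bochner_Integration.integrable_sum integrable_mult_right) auto
  have "(\<integral>x. (\<Sum>j\<in>J. c j * \<phi> j x)\<^sup>2 \<partial>lborel) = (\<Sum>i\<in>J. \<Sum>j\<in>J. (c i * c j) * (if i = j then 1 else 0))"
    unfolding eq using integrable_mult
    by (subst Bochner_Integration.integral_sum Bochner_Integration.integral_sum
        | intro sum.cong Bochner_Integration.integrable_sum integrable_mult_right | simp add: ortho)+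
  also have "\<dots> = (\<Sum>i\<in>J. (c i)\<^sup>2)"
    using assms by (simp add: power2_eq_square if_distrib[where f = "\<lambda>x. _ * x"] sum.delta cong: if_cong)
  finally show "(\<integral>x. (\<Sum>j\<in>J. c j * \<phi> j x)\<^sup>2 \<partial>lborel) = (\<Sum>j\<in>J. (c j)\<^sup>2)" .
qed

lemma fcoeff_combination:
  assumes "finite J"
  shows "(\<integral>x. (\<Sum>j\<in>J. c j * \<phi> j x) * \<phi> i x \<partial>lborel) = (if i \<in> J then c i else 0)"
proof -
  have "(\<integral>x. (\<Sum>j\<in>J. c j * \<phi> j x) * \<phi> i x \<partial>lborel) = (\<integral>x. (\<Sum>j\<in>J. c j * (\<phi> j x * \<phi> i x)) \<partial>lborel)"
    by (simp add: sum_distrib_right mult.assoc)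
  also have "\<dots> = (\<Sum>j\<in>J. c j * (if j = i then 1 else 0))"
    using integrable_mult by (subst Bochner_Integration.integral_sum) (auto simp: ortho)
  finally show ?thesis
    using assms by (simp add: if_distrib[where f = "\<lambda>x. _ * x"] sum.delta cong: if_cong)
qed

context
  fixes f :: "real \<Rightarrow> real"
  assumes fm [measurable]: "f \<in> borel_measurable borel" and f2: "integrable lborel (\<lambda>x. (f x)\<^sup>2)"
begin

lemma integrable_fcoeff: "integrable lborel (\<lambda>x. f x * \<phi> j x)"
  using f2 integrable_sq by (intro integrable_mult_L2) auto

text \<open>Pythagoras: if c holds estimated coefficients, the first two terms are the squared bias
  and the last is the estimation error. With c = \<open>fcoeff f\<close> the identity yields
  Bessel's inequality.\<close>

lemma diff_combination_sq:
  assumes "finite J"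
  shows "integrable lborel (\<lambda>x. ((\<Sum>j\<in>J. c j * \<phi> j x) - f x)\<^sup>2)"
    and "(\<integral>x. ((\<Sum>j\<in>J. c j * \<phi> j x) - f x)\<^sup>2 \<partial>lborel)
      = (\<integral>x. (f x)\<^sup>2 \<partial>lborel) - (\<Sum>j\<in>J. (fcoeff f j)\<^sup>2) + (\<Sum>j\<in>J. (c j - fcoeff f j)\<^sup>2)"
proof -
  have eq: "((\<Sum>j\<in>J. c j * \<phi> j x) - f x)\<^sup>2
    = (\<Sum>j\<in>J. c j * \<phi> j x)\<^sup>2 + (f x)\<^sup>2 - (\<Sum>j\<in>J. 2 * c j * (f x * \<phi> j x))" for x
    by (simp add: power2_diff sum_distrib_left sum_distrib_right mult_ac)
  show "integrable lborel (\<lambda>x. ((\<Sum>j\<in>J. c j * \<phi> j x) - f x)\<^sup>2)"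
    unfolding eq using combination_sq[OF assms] f2 integrable_fcoeff
    by (intro Bochner_Integration.integrable_diff Bochner_Integration.integrable_add
        Bochner_Integration.integrable_sum integrable_mult_right) auto
  have "(\<integral>x. ((\<Sum>j\<in>J. c j * \<phi> j x) - f x)\<^sup>2 \<partial>lborel)
     = (\<integral>x. (\<Sum>j\<in>J. c j * \<phi> j x)\<^sup>2 \<partial>lborel) + (\<integral>x. (f x)\<^sup>2 \<partial>lborel) - (\<integral>x. (\<Sum>j\<in>J. 2 * c j * (f x * \<phi> j x)) \<partial>lborel)"
    unfolding eq using combination_sq[OF assms] f2 integrable_fcoeff
    by (subst Bochner_Integration.integral_diff Bochner_Integration.integral_add
        | intro refl Bochner_Integration.integrable_add Bochner_Integration.integrable_sum integrable_mult_right | simp)+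
  also have "(\<integral>x. (\<Sum>j\<in>J. 2 * c j * (f x * \<phi> j x)) \<partial>lborel) = (\<Sum>j\<in>J. 2 * c j * fcoeff f j)"
    unfolding fcoeff_def using integrable_fcoeff by (subst Bochner_Integration.integral_sum) auto
  finally show "(\<integral>x. ((\<Sum>j\<in>J. c j * \<phi> j x) - f x)\<^sup>2 \<partial>lborel)
      = (\<integral>x. (f x)\<^sup>2 \<partial>lborel) - (\<Sum>j\<in>J. (fcoeff f j)\<^sup>2) + (\<Sum>j\<in>J. (c j - fcoeff f j)\<^sup>2)"
    by (simp add: combination_sq(2)[OF assms] power2_diff sum.distrib sum_subtractf)
qed

lemma bessel:
  assumes "finite J"
  shows "(\<Sum>j\<in>J. (fcoeff f j)\<^sup>2) \<le> (\<integral>x. (f x)\<^sup>2 \<partial>lborel)"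
proof -
  have "0 \<le> (\<integral>x. ((\<Sum>j\<in>J. fcoeff f j * \<phi> j x) - f x)\<^sup>2 \<partial>lborel)" by simp
  then show ?thesis unfolding diff_combination_sq(2)[OF assms] by simp
qed

lemma summable_coeff_sq: "summable (\<lambda>j. (fcoeff f j)\<^sup>2)"
  by (rule summableI_nonneg_bounded[where x = "\<integral>x. (f x)\<^sup>2 \<partial>lborel"]) (simp_all add: bessel)

end

text \<open>The integrals of 2^i d_i^2 are summable, so the sum of these functions is finite almost
  everywhere. Moreover |d| <= 2^{-i} + 2^i d^2, since |d| > 2^{-i} implies |d| <= 2^i d^2.\<close>

lemma AE_abs_summable:
  fixes d :: "nat \<Rightarrow> real \<Rightarrow> real"
  assumes [measurable]: "\<And>i. d i \<in> borel_measurable lborel"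
    and int: "\<And>i. integrable lborel (\<lambda>x. (d i x)\<^sup>2)"
    and le: "\<And>i. (\<integral>x. (d i x)\<^sup>2 \<partial>lborel) \<le> (1 / 4) ^ i"
  shows "AE x in lborel. summable (\<lambda>i. d i x)"
proof -
  have "(\<integral>\<^sup>+x. (\<Sum>i. ennreal (2 ^ i * (d i x)\<^sup>2)) \<partial>lborel) = (\<Sum>i. \<integral>\<^sup>+x. ennreal (2 ^ i * (d i x)\<^sup>2) \<partial>lborel)"
    by (rule nn_integral_suminf) measurable
  also have "\<dots> = (\<Sum>i. ennreal (2 ^ i * (\<integral>x. (d i x)\<^sup>2 \<partial>lborel)))"
    using int by (intro suminf_cong) (subst nn_integral_eq_integral, auto)
  also have "\<dots> \<le> (\<Sum>i. ennreal ((1 / 2) ^ i))"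
  proof (intro suminf_le ennreal_leI)
    fix i
    have "2 ^ i * (\<integral>x. (d i x)\<^sup>2 \<partial>lborel) \<le> 2 ^ i * (1 / 4) ^ i" using le[of i] by simp
    also have "\<dots> = (1 / 2 :: real) ^ i" by (simp add: power_mult_distrib[symmetric])
    finally show "2 ^ i * (\<integral>x. (d i x)\<^sup>2 \<partial>lborel) \<le> (1 / 2) ^ i" .
  qed auto
  also have "\<dots> = ennreal (\<Sum>i. (1 / 2) ^ i)"
    by (rule suminf_ennreal2) (auto intro: summable_geometric)
  also have "\<dots> < \<infinity>" by simp
  finally have "AE x in lborel. (\<Sum>i. ennreal (2 ^ i * (d i x)\<^sup>2)) \<noteq> \<infinity>"
    by (intro nn_integral_PInf_AE) auto
  then show ?thesis
  proof eventually_elim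
    case (elim x)
    have s: "summable (\<lambda>i. (1 / 2) ^ i + 2 ^ i * (d i x)\<^sup>2)"
      using elim by (intro summable_add summable_geometric summable_suminf_not_top) auto
    have "norm (d i x) \<le> (1 / 2) ^ i + 2 ^ i * (d i x)\<^sup>2" for i
    proof (cases "\<bar>d i x\<bar> \<le> (1 / 2) ^ i")
      case False
      then have "1 \<le> 2 ^ i * \<bar>d i x\<bar>" by (simp add: power_divide field_simps)
      from mult_right_mono[OF this, of "\<bar>d i x\<bar>"]
      have "\<bar>d i x\<bar> \<le> 2 ^ i * (d i x)\<^sup>2" by (simp add: power2_eq_square)
      then show ?thesis by (simp add: add_increasing)
    qed (simp add: add_increasing2)
    then show ?case by (intro summable_comparison_test[OF _ s]) auto
  qed
qed

text \<open>The Riesz-Fischer construction: a subsequence of the Fourier partial sums converges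
  almost everywhere and in L^2 to some g with the coefficients of f, and completeness identifies g
  with f.\<close>

theorem parseval:
  assumes fm [measurable]: "f \<in> borel_measurable borel" and f2: "integrable lborel (\<lambda>x. (f x)\<^sup>2)"
    and fA: "\<And>x. x \<notin> A \<Longrightarrow> f x = 0"
  shows "(\<lambda>j. (fcoeff f j)\<^sup>2) sums (\<integral>x. (f x)\<^sup>2 \<partial>lborel)"
proof -
  define a where "a = fcoeff f"
  have suma: "summable (\<lambda>j. (a j)\<^sup>2)" unfolding a_def by (rule summable_coeff_sq[OF fm f2])
  define r where "r N = (\<Sum>j. (a (j + N))\<^sup>2)" for N
  have rle: "(\<Sum>j\<in>J. (a j)\<^sup>2) \<le> r N" if "J \<subseteq> {N..}" "finite J" for J N
  proof -
    have "(\<Sum>j\<in>J. (a j)\<^sup>2) = (\<Sum>j\<in>(\<lambda>j. j - N) ` J. (a (j + N))\<^sup>2)"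
      using that by (subst sum.reindex) (auto intro!: inj_on_diff_nat sum.cong)
    also have "\<dots> \<le> r N"
      unfolding r_def using summable_ignore_initial_segment[OF suma] that by (intro sum_le_suminf) auto
    finally show ?thesis .
  qed
  have "r \<longlonglongrightarrow> 0" unfolding r_def by (rule suminf_exist_split2[OF suma])
  then have ex: "\<exists>n. r n \<le> (1 / 4) ^ i" for i :: nat
    using LIMSEQ_le_const[of r 0] order_tendstoD(2)[of r 0 sequentially "(1/4) ^ i"]
    by (metis (no_types, lifting) eventually_sequentially less_eq_real_def order_refl zero_less_divide_1_iff zero_less_numeral zero_less_power)
  \<comment> \<open>Tails of at most 4^{-i} make the sum of consecutive differences converge almost
    everywhere. Taking the least such index makes \<open>N\<close> monotone.\<close>
  define N where "N i = (LEAST n. r n \<le> (1 / 4) ^ i)" for i :: nat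
  have rN: "r (N i) \<le> (1 / 4) ^ i" for i unfolding N_def by (rule LeastI_ex[OF ex])
  have Nmono: "N i \<le> N j" if "i \<le> j" for i j
    unfolding N_def using that rN[of j]
    by (intro Least_le) (auto simp: N_def[symmetric] intro!: order_trans[OF rN[of j]] power_decreasing)
  define s where "s i x = (\<Sum>j<N i. a j * \<phi> j x)" for i x
  have sdiff: "s m x - s i x = (\<Sum>j\<in>{N i..<N m}. a j * \<phi> j x)" if "i \<le> m" for i m x
  proof -
    have eq: "{..<N m} = {..<N i} \<union> {N i..<N m}" using Nmono[OF that] by auto
    have "(\<Sum>j<N m. a j * \<phi> j x) = (\<Sum>j<N i. a j * \<phi> j x) + (\<Sum>j\<in>{N i..<N m}. a j * \<phi> j x)"
      unfolding eq by (rule sum.union_disjoint) auto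
    then show ?thesis by (simp add: s_def)
  qed
  have [measurable]: "s i \<in> borel_measurable borel" for i unfolding s_def by measurable
  have sint: "integrable lborel (\<lambda>x. (s m x - s i x)\<^sup>2)" "(\<integral>x. (s m x - s i x)\<^sup>2 \<partial>lborel) \<le> (1 / 4) ^ i" if "i \<le> m" for i m
    unfolding sdiff[OF that] using order_trans[OF rle rN, of "{N i..<N m}" i]
    by (auto simp: combination_sq subset_iff)
  have "AE x in lborel. summable (\<lambda>i. s (Suc i) x - s i x)"
    by (rule AE_abs_summable) (use sint[of _ "Suc _"] in auto)
  then have conv: "AE x in lborel. (\<lambda>i. s i x) \<longlonglongrightarrow> lim (\<lambda>i. s i x)"
  proof eventually_elim
    case (elim x)
    then have "convergent (\<lambda>n. \<Sum>i<n. s (Suc i) x - s i x)" by (rule summable_iff_convergent[THEN iffD1])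
    then have "convergent (\<lambda>n. s n x - s 0 x)" by (simp add: sum_lessThan_telescope[of "\<lambda>i. s i x"])
    then have "convergent (\<lambda>n. (s n x - s 0 x) + s 0 x)" by (intro convergent_add) (auto simp: convergent_const)
    then show ?case by (simp add: convergent_LIMSEQ_iff)
  qed
  define g where "g x = lim (\<lambda>i. s i x)" for x
  have [measurable]: "g \<in> borel_measurable borel" unfolding g_def by measurable
  have gA: "g x = 0" if "x \<notin> A" for x using that by (simp add: g_def s_def supp)
  \<comment> \<open>Fatou's lemma, applied as the later partial sums tend to g while i stays
    fixed.\<close>
  have gs: "(\<integral>\<^sup>+x. ennreal ((g x - s i x)\<^sup>2) \<partial>lborel) \<le> ennreal ((1 / 4) ^ i)" for i
  proof -
    have "(\<integral>\<^sup>+x. ennreal ((g x - s i x)\<^sup>2) \<partial>lborel) = (\<integral>\<^sup>+x. liminf (\<lambda>m. ennreal ((s m x - s i x)\<^sup>2)) \<partial>lborel)"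
    proof (rule nn_integral_cong_AE)
      show "AE x in lborel. ennreal ((g x - s i x)\<^sup>2) = liminf (\<lambda>m. ennreal ((s m x - s i x)\<^sup>2))"
        using conv
      proof eventually_elim
        case (elim x)
        have "(\<lambda>m. ennreal ((s m x - s i x)\<^sup>2)) \<longlonglongrightarrow> ennreal ((g x - s i x)\<^sup>2)"
          unfolding g_def using elim by (intro tendsto_intros)
        from lim_imp_Liminf[OF sequentially_bot this] show ?case by (rule sym)
      qed
    qed
    also have "\<dots> \<le> liminf (\<lambda>m. \<integral>\<^sup>+x. ennreal ((s m x - s i x)\<^sup>2) \<partial>lborel)"
      by (rule nn_integral_liminf) measurable
    also have "\<dots> \<le> ennreal ((1 / 4) ^ i)"
    proof -
      have "\<forall>\<^sub>F m in sequentially. (\<integral>\<^sup>+x. ennreal ((s m x - s i x)\<^sup>2) \<partial>lborel) \<le> ennreal ((1 / 4) ^ i)"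
        using eventually_ge_at_top[of i]
      proof eventually_elim
        case (elim m)
        then show ?case using sint[OF elim] by (subst nn_integral_eq_integral) (auto intro: ennreal_leI)
      qed
      then show ?thesis by (intro Liminf_le) auto
    qed
    finally show ?thesis .
  qed
  have gsi: "integrable lborel (\<lambda>x. (g x - s i x)\<^sup>2)" for i
  proof (rule integrableI_nonneg)
    show "(\<integral>\<^sup>+x. ennreal ((g x - s i x)\<^sup>2) \<partial>lborel) < \<infinity>"
      using le_less_trans[OF gs[of i]] by simp
  qed auto
  have gsl: "(\<integral>x. (g x - s i x)\<^sup>2 \<partial>lborel) \<le> (1 / 4) ^ i" for i
    using gs[of i] gsi[of i] by (subst (asm) nn_integral_eq_integral) auto
  have s2: "integrable lborel (\<lambda>x. (s i x)\<^sup>2)" for i unfolding s_def by (rule combination_sq) simp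
  have g2: "integrable lborel (\<lambda>x. (g x)\<^sup>2)"
  proof (rule Bochner_Integration.integrable_bound)
    show "integrable lborel (\<lambda>x. 2 * (g x - s 0 x)\<^sup>2 + 2 * (s 0 x)\<^sup>2)" using gsi s2 by auto
    have "(g x)\<^sup>2 \<le> 2 * (g x - s 0 x)\<^sup>2 + 2 * (s 0 x)\<^sup>2" for x
      using zero_le_power2[of "g x - 2 * s 0 x"] by (simp add: power2_eq_square algebra_simps)
    then show "AE x in lborel. norm ((g x)\<^sup>2) \<le> norm (2 * (g x - s 0 x)\<^sup>2 + 2 * (s 0 x)\<^sup>2)" by auto
  qed measurable
  have cg: "fcoeff g j = a j" for j
  proof -
    \<comment> \<open>The coefficient of g - \<open>s i\<close> is at most 2^{-i} by Bessel. A
      coefficient \<open>a j\<close> that \<open>s i\<close> does not yet contain lies in a tail of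
      at most 4^{-i}, which costs the other 2^{-i}.\<close>
    have b: "\<bar>fcoeff g j - a j\<bar> \<le> 2 * (1 / 2) ^ i" for i
    proof -
      have half: "((1 / 2) ^ i)\<^sup>2 = (1 / 4 :: real) ^ i"
        by (simp add: power_mult[symmetric] power_even_eq mult.commute power2_eq_square power_mult_distrib[symmetric])
      have cs: "(\<integral>x. s i x * \<phi> j x \<partial>lborel) = (if j < N i then a j else 0)"
        unfolding s_def by (subst fcoeff_combination) auto
      have "fcoeff (\<lambda>x. g x - s i x) j = fcoeff g j - (if j < N i then a j else 0)"
        unfolding fcoeff_def cs[symmetric] using integrable_fcoeff[OF _ g2, of j] integrable_fcoeff[OF _ s2, of i j]
        by (simp add: left_diff_distrib)
      moreover have "\<bar>fcoeff (\<lambda>x. g x - s i x) j\<bar> \<le> (1 / 2) ^ i"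
      proof (rule power2_le_imp_le)
        have "(fcoeff (\<lambda>x. g x - s i x) j)\<^sup>2 \<le> (1 / 4) ^ i"
          using bessel[OF _ gsi[of i], of "{j}"] gsl[of i] by auto
        then show "\<bar>fcoeff (\<lambda>x. g x - s i x) j\<bar>\<^sup>2 \<le> ((1 / 2) ^ i)\<^sup>2" by (simp add: half)
      qed simp
      moreover have "\<bar>a j\<bar> \<le> (1 / 2) ^ i" if "\<not> j < N i"
      proof (rule power2_le_imp_le)
        show "\<bar>a j\<bar>\<^sup>2 \<le> ((1 / 2) ^ i)\<^sup>2" using rle[of "{j}" "N i"] rN[of i] that by (simp add: half)
      qed simp
      moreover have "(0::real) \<le> (1 / 2) ^ i" by simp
      ultimately show ?thesis by (smt (verit))
    qed
    have "(\<lambda>i. 2 * (1 / 2 :: real) ^ i) \<longlonglongrightarrow> 2 * 0"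
      by (intro tendsto_mult_left LIMSEQ_realpow_zero) auto
    then have "\<bar>fcoeff g j - a j\<bar> \<le> 0"
      by (intro LIMSEQ_le_const[of "\<lambda>i. 2 * (1 / 2 :: real) ^ i"]) (use b in auto)
    then show ?thesis by simp
  qed
  have "AE x in lborel. f x - g x = 0"
  proof (rule complete)
    show "integrable lborel (\<lambda>x. (f x - g x)\<^sup>2)"
      using integrable_mult_L2[OF _ _ f2 g2] f2 g2 by (auto simp: power2_diff mult.assoc)
    show "(\<integral>x. (f x - g x) * \<phi> j x \<partial>lborel) = 0" for j
      using cg[of j] integrable_fcoeff[OF _ g2, of j] integrable_fcoeff[OF _ f2, of j]
      by (simp add: left_diff_distrib fcoeff_def a_def)
  qed (use fA gA in auto)
  then have fg: "AE x in lborel. f x = g x" by eventually_elim simp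
  have up: "(\<integral>x. (f x)\<^sup>2 \<partial>lborel) \<le> (\<Sum>j. (a j)\<^sup>2) + (1 / 4) ^ i" for i
  proof -
    have "(\<integral>x. (f x)\<^sup>2 \<partial>lborel) - (\<Sum>j<N i. (a j)\<^sup>2) = (\<integral>x. (s i x - f x)\<^sup>2 \<partial>lborel)"
      unfolding s_def by (subst diff_combination_sq(2)[OF fm f2]) (auto simp: a_def)
    also have "\<dots> = (\<integral>x. (g x - s i x)\<^sup>2 \<partial>lborel)"
      using fg by (intro integral_cong_AE) (auto simp: power2_commute)
    finally show ?thesis using gsl[of i] sum_le_suminf[OF suma, of "{..<N i}"] by simp
  qed
  have "(\<lambda>i. (\<Sum>j. (a j)\<^sup>2) + (1 / 4) ^ i) \<longlonglongrightarrow> (\<Sum>j. (a j)\<^sup>2) + 0"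
    by (intro tendsto_intros LIMSEQ_realpow_zero) auto
  then have "(\<integral>x. (f x)\<^sup>2 \<partial>lborel) \<le> (\<Sum>j. (a j)\<^sup>2)"
    by (intro LIMSEQ_le_const[of "\<lambda>i. (\<Sum>j. (a j)\<^sup>2) + (1 / 4) ^ i"]) (use up in auto)
  moreover have "(\<Sum>j. (a j)\<^sup>2) \<le> (\<integral>x. (f x)\<^sup>2 \<partial>lborel)"
    using suma by (intro suminf_le_const) (auto simp: a_def bessel[OF fm f2])
  ultimately show ?thesis using suma by (simp add: a_def sums_iff)
qed

text \<open>Monotonicity gives a_j^2 <= \<omega>_k a_j^2 / \<omega>_j for j >= k. The series of the
  hypothesis starts at index 1, and k >= 1 keeps the tail inside it.\<close>

lemma parseval_tail_le:
  assumes fm: "f \<in> borel_measurable borel" and f2: "integrable lborel (\<lambda>x. (f x)\<^sup>2)"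
    and fA: "\<And>x. x \<notin> A \<Longrightarrow> f x = 0"
    and pos: "\<And>k. k \<ge> 1 \<Longrightarrow> \<omega> k > 0" and anti: "antimono_on {1..} \<omega>"
    and ell: "(\<Sum>k. ennreal (\<bar>fcoeff f (Suc k)\<bar>\<^sup>2 / \<omega> (Suc k))) \<le> ennreal L" and L: "L \<ge> 0"
    and k: "k \<ge> 1"
  shows "(\<integral>x. (f x)\<^sup>2 \<partial>lborel) - (\<Sum>j<k. (fcoeff f j)\<^sup>2) \<le> L * \<omega> k"
proof -
  define a where "a = fcoeff f"
  have partial: "(\<Sum>j\<in>J. (a j)\<^sup>2 / \<omega> j) \<le> L" if "finite J" "J \<subseteq> {1..}" for J
  proof -
    \<comment> \<open>Shifting by one matches the index set with the series; on positive indices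
      truncated subtraction is injective.\<close>
    have inj: "inj_on (\<lambda>j. j - 1) J" using that by (intro inj_on_diff_nat) auto
    have "(\<Sum>j\<in>J. (a j)\<^sup>2 / \<omega> j) = (\<Sum>j\<in>(\<lambda>j. j - 1) ` J. \<bar>a (Suc j)\<bar>\<^sup>2 / \<omega> (Suc j))"
      unfolding sum.reindex[OF inj]
    proof (rule sum.cong)
      fix j assume "j \<in> J"
      then have "Suc (j - 1) = j" using that by (auto simp: subset_iff)
      then show "(a j)\<^sup>2 / \<omega> j = ((\<lambda>j. \<bar>a (Suc j)\<bar>\<^sup>2 / \<omega> (Suc j)) \<circ> (\<lambda>j. j - 1)) j" by simp
    qed simp
    then have "ennreal (\<Sum>j\<in>J. (a j)\<^sup>2 / \<omega> j) = ennreal (\<Sum>j\<in>(\<lambda>j. j - 1) ` J. \<bar>a (Suc j)\<bar>\<^sup>2 / \<omega> (Suc j))"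
      by (rule arg_cong)
    also have "\<dots> = (\<Sum>j\<in>(\<lambda>j. j - 1) ` J. ennreal (\<bar>a (Suc j)\<bar>\<^sup>2 / \<omega> (Suc j)))"
      using pos by (subst sum_ennreal) (auto intro!: divide_nonneg_pos)
    also have "\<dots> \<le> (\<Sum>k. ennreal (\<bar>a (Suc k)\<bar>\<^sup>2 / \<omega> (Suc k)))"
      using that by (intro sum_le_suminf) auto
    also have "\<dots> \<le> ennreal L" using ell by (simp add: a_def)
    finally show ?thesis using L by (simp add: ennreal_le_iff)
  qed
  have fin: "(\<Sum>j<n. (a j)\<^sup>2) \<le> (\<Sum>j<k. (a j)\<^sup>2) + L * \<omega> k" if "n \<ge> k" for n
  proof -
    have "(\<Sum>j<n. (a j)\<^sup>2) = (\<Sum>j<k. (a j)\<^sup>2) + (\<Sum>j\<in>{k..<n}. (a j)\<^sup>2)"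
      using that by (simp add: lessThan_atLeast0 sum.atLeastLessThan_concat)
    also have "(\<Sum>j\<in>{k..<n}. (a j)\<^sup>2) \<le> (\<Sum>j\<in>{k..<n}. \<omega> k * ((a j)\<^sup>2 / \<omega> j))"
    proof (rule sum_mono)
      fix j assume j: "j \<in> {k..<n}"
      then have "\<omega> j \<le> \<omega> k" "\<omega> j > 0" using anti pos[of j] k by (auto simp: monotone_on_def)
      then show "(a j)\<^sup>2 \<le> \<omega> k * ((a j)\<^sup>2 / \<omega> j)"
        using mult_right_mono[of "\<omega> j" "\<omega> k" "(a j)\<^sup>2"] by (simp add: field_simps)
    qed
    also have "\<dots> = \<omega> k * (\<Sum>j\<in>{k..<n}. (a j)\<^sup>2 / \<omega> j)" by (simp add: sum_distrib_left)
    also have "\<dots> \<le> \<omega> k * L" using pos[OF k] k by (intro mult_left_mono partial) auto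
    finally show ?thesis by (simp add: mult.commute)
  qed
  have "(\<lambda>n. \<Sum>j<n. (a j)\<^sup>2) \<longlonglongrightarrow> (\<integral>x. (f x)\<^sup>2 \<partial>lborel)"
    using parseval[OF fm f2 fA] by (simp add: sums_def a_def)
  then have "(\<integral>x. (f x)\<^sup>2 \<partial>lborel) \<le> (\<Sum>j<k. (a j)\<^sup>2) + L * \<omega> k"
    by (rule LIMSEQ_le_const2) (use fin in auto)
  then show ?thesis by (simp add: a_def)
qed

end

section \<open>Concentration of norms of sums of independent vectors\<close>

text \<open>Only an upper bound on z is required, which suits exponents that are controlled from
  above. For z = -y < 0 the claim says (1 - y + y^2) exp y >= 1, and the quadratic Taylor bound
  makes the left side at least 1 + (y^2 + y^3 + y^4) / 2.\<close>

lemma exp_le_quadratic: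
  fixes z :: real
  assumes "z \<le> 1"
  shows "exp z \<le> 1 + z + z\<^sup>2"
proof (cases "z \<ge> 0")
  case True
  then show ?thesis using exp_bound assms by simp
next
  case False
  define y where "y = - z"
  have y: "y > 0" using False by (simp add: y_def)
  have e: "1 + y + y\<^sup>2 / 2 \<le> exp y" using exp_lower_Taylor_quadratic y by simp
  have q: "1 - y + y\<^sup>2 \<ge> 0"
    using zero_le_power2[of "y - 1/2"] by (simp add: power2_eq_square algebra_simps)
  have "1 \<le> (1 - y + y\<^sup>2) * (1 + y + y\<^sup>2 / 2)"
  proof -
    have "(1 - y + y\<^sup>2) * (1 + y + y\<^sup>2 / 2) = 1 + (y\<^sup>2 + y ^ 3 + y ^ 4) / 2"
      by (simp add: field_simps power2_eq_square power3_eq_cube power4_eq_xxxx)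
    then show ?thesis using y by simp
  qed
  also have "\<dots> \<le> (1 - y + y\<^sup>2) * exp y"
    using e q by (rule mult_left_mono)
  finally have "exp (- y) \<le> 1 - y + y\<^sup>2"
    by (simp add: exp_minus field_simps)
  then show ?thesis by (simp add: y_def)
qed

lemma sqrt_add_le_tangent:
  fixes A B w :: real
  assumes "w > 0" "w\<^sup>2 = A" "A + B \<ge> 0"
  shows "sqrt (A + B) \<le> w + B / (2 * w)"
proof (rule real_le_lsqrt)
  have "2 * w * (w + B / (2 * w)) = w\<^sup>2 + (A + B)"
    using assms by (simp add: field_simps power2_eq_square)
  then have "2 * w * (w + B / (2 * w)) \<ge> 0" using assms(3) zero_le_power2[of w] by linarith
  then show "0 \<le> w + B / (2 * w)" using assms
    by (simp add: zero_le_mult_iff)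
  have "(w + B / (2 * w))\<^sup>2 = A + B + (B / (2 * w))\<^sup>2"
    using assms by (simp add: power2_sum)
  then show "A + B \<le> (w + B / (2 * w))\<^sup>2" by simp
qed

text \<open>Here \<open>s\<close> is the sum of the vectors seen so far and \<open>Y\<close> the
  next one. Of the three terms added to the exponent, the first is the drift caused by the curvature
  of the norm, the second the variance in the direction of \<open>s\<close>, the third the square of
  the curvature term. None of them depends on \<open>s\<close>, which permits iteration.\<close>

lemma (in prob_space) nn_integral_exp_smooth_norm_step:
  fixes Y :: "'b \<Rightarrow> 'a \<Rightarrow> real" and s :: "'b \<Rightarrow> real"
  assumes fin: "finite J"
    and meas [measurable]: "\<And>j. j \<in> J \<Longrightarrow> Y j \<in> borel_measurable M"
    and bound: "AE x in M. (\<Sum>j\<in>J. (Y j x)\<^sup>2) \<le> b\<^sup>2" "0 \<le> b"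
    and cent: "\<And>j. j \<in> J \<Longrightarrow> (\<integral>x. Y j x \<partial>M) = 0"
    and tr: "(\<integral>x. (\<Sum>j\<in>J. (Y j x)\<^sup>2) \<partial>M) \<le> T"
    and weak: "\<And>u. (\<integral>x. (\<Sum>j\<in>J. u j * Y j x)\<^sup>2 \<partial>M) \<le> \<sigma> * (\<Sum>j\<in>J. (u j)\<^sup>2)"
    and a: "0 < a" "b \<le> 2 * a" and l: "0 \<le> l" "l * b \<le> 1 / 2" and \<sigma>: "0 \<le> \<sigma>"
  shows "(\<integral>\<^sup>+x. ennreal (exp (l * sqrt (a\<^sup>2 + (\<Sum>j\<in>J. (s j + Y j x)\<^sup>2)))) \<partial>M)
    \<le> ennreal (exp (l * sqrt (a\<^sup>2 + (\<Sum>j\<in>J. (s j)\<^sup>2))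
         + (l * T / (2 * a) + 2 * l\<^sup>2 * \<sigma> + l\<^sup>2 * b\<^sup>2 * T / (2 * a\<^sup>2))))"
proof -
  define S where "S = (\<Sum>j\<in>J. (s j)\<^sup>2)"
  define W where "W = sqrt (a\<^sup>2 + S)"
  have S0: "S \<ge> 0" by (simp add: S_def sum_nonneg)
  have W2: "W\<^sup>2 = a\<^sup>2 + S" using S0 by (simp add: W_def)
  have Wa: "a \<le> W" unfolding W_def using S0 a by (simp add: real_le_rsqrt)
  have Wpos: "W > 0" using Wa a by simp
  \<comment> \<open>The gradient of the smoothed norm at \<open>s\<close>. Its length is at most 1,
    so the weak variance bound applies with the constant \<sigma>.\<close>
  define u where "u j = s j / W" for j
  define N where "N x = (\<Sum>j\<in>J. (Y j x)\<^sup>2)" for x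
  define I where "I x = (\<Sum>j\<in>J. u j * Y j x)" for x
  have uu: "(\<Sum>j\<in>J. (u j)\<^sup>2) \<le> 1"
  proof -
    have "(\<Sum>j\<in>J. (u j)\<^sup>2) = S / W\<^sup>2"
      by (simp add: u_def S_def power_divide sum_divide_distrib)
    also have "\<dots> \<le> 1" using W2 Wpos a S0 by (simp add: add_pos_nonneg)
    finally show ?thesis .
  qed
  have N0: "N x \<ge> 0" for x by (simp add: N_def sum_nonneg)
  have [measurable]: "N \<in> borel_measurable M" "I \<in> borel_measurable M"
    unfolding N_def I_def by measurable
  have Nb: "AE x in M. N x \<le> b\<^sup>2" using bound by (simp add: N_def)
  have I2: "(I x)\<^sup>2 \<le> N x" for x
  proof -
    have "(I x)\<^sup>2 \<le> (\<Sum>j\<in>J. (u j)\<^sup>2) * N x"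
      unfolding I_def N_def by (rule Cauchy_Schwarz_ineq_sum)
    also have "\<dots> \<le> 1 * N x" by (rule mult_right_mono[OF uu N0])
    finally show ?thesis by simp
  qed
  have Ib: "\<bar>I x\<bar> \<le> b" if "N x \<le> b\<^sup>2" for x
    using order_trans[OF I2 that] bound(2) abs_le_square_iff[of "I x" b] by simp
  define z where "z x = l * (I x + N x / (2 * W))" for x
  have pt: "exp (l * sqrt (a\<^sup>2 + (\<Sum>j\<in>J. (s j + Y j x)\<^sup>2))) \<le> exp (l * W) * exp (z x)" for x
  proof -
    have "(\<Sum>j\<in>J. (s j + Y j x)\<^sup>2) = S + (2 * W * I x + N x)"
      using Wpos by (simp add: S_def I_def N_def u_def power2_sum sum.distrib sum_distrib_left algebra_simps)
    then have eq: "a\<^sup>2 + (\<Sum>j\<in>J. (s j + Y j x)\<^sup>2) = (a\<^sup>2 + S) + (2 * W * I x + N x)" by simp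
    have "sqrt (a\<^sup>2 + (\<Sum>j\<in>J. (s j + Y j x)\<^sup>2)) \<le> W + (2 * W * I x + N x) / (2 * W)"
      unfolding eq by (rule sqrt_add_le_tangent[OF Wpos W2]) (simp add: eq[symmetric] sum_nonneg)
    also have "\<dots> = W + (I x + N x / (2 * W))" using Wpos by (simp add: field_simps)
    finally have "l * sqrt (a\<^sup>2 + (\<Sum>j\<in>J. (s j + Y j x)\<^sup>2)) \<le> l * (W + (I x + N x / (2 * W)))"
      using l(1) by (rule mult_left_mono)
    then show ?thesis by (simp add: z_def exp_add[symmetric] algebra_simps)
  qed
  \<comment> \<open>By b <= 2a the curvature term is at most b, like the directional term; so the
    exponent stays below 2 l b <= 1, the range of the quadratic bound for exp.\<close>
  have b2: "b\<^sup>2 / (2 * a) \<le> b"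
    using a(1) mult_right_mono[OF a(2) bound(2)] by (simp add: field_simps power2_eq_square)
  have NW: "N x / (2 * W) \<le> N x / (2 * a)" for x
    using Wa a N0 by (intro divide_left_mono) auto
  have zle: "exp (z x) \<le> 1 + l * I x + l / (2 * a) * N x + (2 * l\<^sup>2 * (I x)\<^sup>2 + l\<^sup>2 * b\<^sup>2 / (2 * a\<^sup>2) * N x)"
    if "N x \<le> b\<^sup>2" for x
  proof -
    have "N x / (2 * W) \<le> b\<^sup>2 / (2 * a)"
      using NW[of x] that a by (smt (verit) divide_right_mono)
    then have n1: "N x / (2 * W) \<le> b" using b2 by simp
    have "I x + N x / (2 * W) \<le> 2 * b" using n1 Ib[OF that] by simp
    then have "z x \<le> l * (2 * b)" unfolding z_def using l by (intro mult_left_mono) auto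
    also have "\<dots> \<le> 1" using l by simp
    finally have "exp (z x) \<le> 1 + z x + (z x)\<^sup>2" by (rule exp_le_quadratic)
    moreover have "z x \<le> l * I x + l / (2 * a) * N x"
      using mult_left_mono[OF NW[of x] l(1)] by (simp add: z_def algebra_simps)
    \<comment> \<open>One factor N of the squared curvature term is replaced by its bound b^2; the
      other stays, and its expectation is at most T.\<close>
    moreover have "(z x)\<^sup>2 \<le> 2 * l\<^sup>2 * (I x)\<^sup>2 + l\<^sup>2 * b\<^sup>2 / (2 * a\<^sup>2) * N x"
    proof -
      have "(I x + N x / (2 * W))\<^sup>2 \<le> 2 * (I x)\<^sup>2 + 2 * (N x / (2 * W))\<^sup>2"
        using zero_le_power2[of "I x - N x / (2 * W)"] unfolding power2_diff power2_sum by linarith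
      also have "(N x / (2 * W))\<^sup>2 \<le> (N x / (2 * a))\<^sup>2"
        using NW[of x] N0[of x] Wpos by (intro power_mono) auto
      also have "(N x / (2 * a))\<^sup>2 \<le> b\<^sup>2 * N x / (4 * a\<^sup>2)"
        using mult_right_mono[OF that N0[of x]] by (simp add: power_divide power_mult_distrib power2_eq_square divide_right_mono)
      finally have "(I x + N x / (2 * W))\<^sup>2 \<le> 2 * (I x)\<^sup>2 + b\<^sup>2 / (2 * a\<^sup>2) * N x"
        by (simp add: mult.commute)
      then have "l\<^sup>2 * (I x + N x / (2 * W))\<^sup>2 \<le> l\<^sup>2 * (2 * (I x)\<^sup>2 + b\<^sup>2 / (2 * a\<^sup>2) * N x)"
        by (rule mult_left_mono) simp
      then show ?thesis unfolding z_def power_mult_distrib by (simp add: algebra_simps)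
    qed
    ultimately show ?thesis by linarith
  qed
  have intY: "integrable M (Y j)" if "j \<in> J" for j
  proof (rule integrable_const_bound[where B = b])
    show "AE x in M. norm (Y j x) \<le> b"
      using Nb
    proof eventually_elim
      case (elim x)
      have "(Y j x)\<^sup>2 \<le> N x" unfolding N_def using that fin by (intro member_le_sum) auto
      then show ?case using elim bound(2) abs_le_square_iff[of "Y j x" b] by simp
    qed
  qed (use that in measurable)
  have intI: "integrable M I" unfolding I_def using intY by auto
  have EI: "(\<integral>x. I x \<partial>M) = 0" unfolding I_def using intY cent by (subst Bochner_Integration.integral_sum) auto
  have intN: "integrable M N"
    by (rule integrable_const_bound[where B = "b\<^sup>2"]) (use Nb N0 in auto)
  have intI2: "integrable M (\<lambda>x. (I x)\<^sup>2)"
  proof (rule integrable_const_bound[where B = "b\<^sup>2"])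
    show "AE x in M. norm ((I x)\<^sup>2) \<le> b\<^sup>2" using Nb by eventually_elim (use I2 order_trans in auto)
  qed measurable
  have EN: "(\<integral>x. N x \<partial>M) \<le> T" using tr by (simp add: N_def)
  have EI2: "(\<integral>x. (I x)\<^sup>2 \<partial>M) \<le> \<sigma>"
    using weak[of u] mult_left_mono[OF uu \<sigma>] by (simp add: I_def)
  define F where "F x = 1 + l * I x + l / (2 * a) * N x + (2 * l\<^sup>2 * (I x)\<^sup>2 + l\<^sup>2 * b\<^sup>2 / (2 * a\<^sup>2) * N x)" for x
  have intF: "integrable M F" unfolding F_def using intI intN intI2 by auto
  have EF: "(\<integral>x. F x \<partial>M) = 1 + (l / (2 * a) * (\<integral>x. N x \<partial>M) + 2 * l\<^sup>2 * (\<integral>x. (I x)\<^sup>2 \<partial>M) + l\<^sup>2 * b\<^sup>2 / (2 * a\<^sup>2) * (\<integral>x. N x \<partial>M))"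
    unfolding F_def using intI intN intI2 EI by (simp add: prob_space)
  define K where "K = l * T / (2 * a) + 2 * l\<^sup>2 * \<sigma> + l\<^sup>2 * b\<^sup>2 * T / (2 * a\<^sup>2)"
  have "l / (2 * a) * (\<integral>x. N x \<partial>M) \<le> l / (2 * a) * T"
    "2 * l\<^sup>2 * (\<integral>x. (I x)\<^sup>2 \<partial>M) \<le> 2 * l\<^sup>2 * \<sigma>"
    "l\<^sup>2 * b\<^sup>2 / (2 * a\<^sup>2) * (\<integral>x. N x \<partial>M) \<le> l\<^sup>2 * b\<^sup>2 / (2 * a\<^sup>2) * T"
    using EN EI2 l a by (auto intro!: mult_left_mono divide_right_mono)
  then have "(\<integral>x. F x \<partial>M) \<le> 1 + K" unfolding EF K_def by simp
  also have "\<dots> \<le> exp K" by simp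
  finally have EFK: "(\<integral>x. F x \<partial>M) \<le> exp K" .
  have Fpos: "AE x in M. 0 \<le> F x"
    using Nb
  proof eventually_elim
    case (elim x)
    show ?case using zle[OF elim] exp_gt_zero[of "z x"] unfolding F_def by linarith
  qed
  have "(\<integral>\<^sup>+x. ennreal (exp (l * sqrt (a\<^sup>2 + (\<Sum>j\<in>J. (s j + Y j x)\<^sup>2)))) \<partial>M)
      \<le> (\<integral>\<^sup>+x. ennreal (exp (l * W) * F x) \<partial>M)"
  proof (rule nn_integral_mono_AE)
    show "AE x in M. ennreal (exp (l * sqrt (a\<^sup>2 + (\<Sum>j\<in>J. (s j + Y j x)\<^sup>2)))) \<le> ennreal (exp (l * W) * F x)"
      using Nb
    proof eventually_elim
      case (elim x)
      have "exp (l * W) * exp (z x) \<le> exp (l * W) * F x"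
        using zle[OF elim] unfolding F_def by (intro mult_left_mono) auto
      then show ?case using pt[of x] by (intro ennreal_leI) linarith
    qed
  qed
  also have "\<dots> = ennreal (\<integral>x. exp (l * W) * F x \<partial>M)"
    using intF Fpos by (intro nn_integral_eq_integral) auto
  also have "\<dots> \<le> ennreal (exp (l * W + K))"
    using EFK by (intro ennreal_leI) (simp add: exp_add)
  finally show ?thesis unfolding W_def S_def K_def .
qed

text \<open>Fubini integrates out the newest observation with the others fixed, and the one-step
  bound costs a factor exp K that does not see the others. The empty sum contributes exp(l
  a).\<close>

lemma (in prob_space) nn_integral_exp_smooth_norm_sum:
  fixes Y :: "'b \<Rightarrow> 'a \<Rightarrow> real" and I :: "'i set"
  assumes fin: "finite J"
    and meas [measurable]: "\<And>j. j \<in> J \<Longrightarrow> Y j \<in> borel_measurable M"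
    and bound: "AE x in M. (\<Sum>j\<in>J. (Y j x)\<^sup>2) \<le> b\<^sup>2" "0 \<le> b"
    and cent: "\<And>j. j \<in> J \<Longrightarrow> (\<integral>x. Y j x \<partial>M) = 0"
    and tr: "(\<integral>x. (\<Sum>j\<in>J. (Y j x)\<^sup>2) \<partial>M) \<le> T"
    and weak: "\<And>u. (\<integral>x. (\<Sum>j\<in>J. u j * Y j x)\<^sup>2 \<partial>M) \<le> \<sigma> * (\<Sum>j\<in>J. (u j)\<^sup>2)"
    and a: "0 < a" "b \<le> 2 * a" and l: "0 \<le> l" "l * b \<le> 1 / 2" and \<sigma>: "0 \<le> \<sigma>"
    and I: "finite I"
  shows "(\<integral>\<^sup>+X. ennreal (exp (l * sqrt (a\<^sup>2 + (\<Sum>j\<in>J. (\<Sum>i\<in>I. Y j (X i))\<^sup>2)))) \<partial>PiM I (\<lambda>_. M))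
    \<le> ennreal (exp (l * a + real (card I) * (l * T / (2 * a) + 2 * l\<^sup>2 * \<sigma> + l\<^sup>2 * b\<^sup>2 * T / (2 * a\<^sup>2))))"
  using I
proof (induction I)
  case empty
  interpret P: prob_space "PiM {} (\<lambda>_::'i. M)" by (rule prob_space_PiM) (rule prob_space_axioms)
  show ?case using a P.emeasure_space_1 by simp
next
  case (insert i I)
  define K where "K = l * T / (2 * a) + 2 * l\<^sup>2 * \<sigma> + l\<^sup>2 * b\<^sup>2 * T / (2 * a\<^sup>2)"
  interpret product_sigma_finite "\<lambda>_::'i. M" ..
  define g where "g X = (\<integral>\<^sup>+y. ennreal (exp (l * sqrt (a\<^sup>2 + (\<Sum>j\<in>J. (\<Sum>m\<in>insert i I. Y j ((X(i := y)) m))\<^sup>2)))) \<partial>M)" for X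
  have gle: "g X \<le> ennreal (exp (l * sqrt (a\<^sup>2 + (\<Sum>j\<in>J. (\<Sum>m\<in>I. Y j (X m))\<^sup>2)))) * ennreal (exp K)" for X
  proof -
    have "(\<Sum>m\<in>insert i I. Y j ((X(i := y)) m)) = (\<Sum>m\<in>I. Y j (X m)) + Y j y" for j y
      using insert by (auto intro!: sum.cong)
    then show ?thesis
      unfolding g_def K_def
      using nn_integral_exp_smooth_norm_step[OF fin meas bound cent tr weak a l \<sigma>, of "\<lambda>j. \<Sum>m\<in>I. Y j (X m)"]
      by (simp add: exp_add[symmetric] ennreal_mult[symmetric])
  qed
  have "(\<integral>\<^sup>+X. ennreal (exp (l * sqrt (a\<^sup>2 + (\<Sum>j\<in>J. (\<Sum>m\<in>insert i I. Y j (X m))\<^sup>2)))) \<partial>PiM (insert i I) (\<lambda>_. M))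
     = (\<integral>\<^sup>+X. g X \<partial>PiM I (\<lambda>_. M))"
    unfolding g_def using insert(1,2) by (rule product_nn_integral_insert) measurable
  also have "\<dots> \<le> (\<integral>\<^sup>+X. ennreal (exp (l * sqrt (a\<^sup>2 + (\<Sum>j\<in>J. (\<Sum>m\<in>I. Y j (X m))\<^sup>2)))) * ennreal (exp K) \<partial>PiM I (\<lambda>_. M))"
    by (intro nn_integral_mono gle)
  also have "\<dots> = (\<integral>\<^sup>+X. ennreal (exp (l * sqrt (a\<^sup>2 + (\<Sum>j\<in>J. (\<Sum>m\<in>I. Y j (X m))\<^sup>2)))) \<partial>PiM I (\<lambda>_. M)) * ennreal (exp K)"
    by (rule nn_integral_multc) measurable
  also have "\<dots> \<le> ennreal (exp (l * a + real (card I) * K)) * ennreal (exp K)"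
    using insert.IH by (intro mult_right_mono) (auto simp: K_def)
  also have "\<dots> = ennreal (exp (l * a + real (card (insert i I)) * K))"
    using insert(1,2) by (simp add: ennreal_mult[symmetric] exp_add[symmetric] algebra_simps)
  finally show ?case unfolding K_def .
qed

text \<open>With y = x - b the difference of squares is y^2 + 2 b y, and both powers of y are
  dominated by exp(l y). This is how an exponential moment controls an expected excess.\<close>

lemma sq_diff_le_exp:
  fixes x b l :: real
  assumes "l > 0" "b \<ge> 0" "x \<ge> 0"
  shows "max 0 (x\<^sup>2 - b\<^sup>2) \<le> (2 / l\<^sup>2 + 2 * b / l) * exp (l * (x - b))"
proof (cases "x \<le> b")
  case True
  then have "x\<^sup>2 \<le> b\<^sup>2" using assms by (intro power_mono)
  then show ?thesis using assms by simp
next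
  case False
  define y where "y = x - b"
  have y: "y > 0" using False by (simp add: y_def)
  have e: "1 + l * y + (l * y)\<^sup>2 / 2 \<le> exp (l * y)"
    using exp_lower_Taylor_quadratic[of "l * y"] y assms by simp
  have "(l * y)\<^sup>2 \<le> 2 * exp (l * y)"
    using e y assms mult_nonneg_nonneg[of l y] by linarith
  then have 1: "y\<^sup>2 \<le> 2 / l\<^sup>2 * exp (l * y)" using assms by (simp add: power_mult_distrib field_simps)
  have "l * y \<le> exp (l * y)" using exp_ge_add_one_self[of "l * y"] by linarith
  then have "y \<le> exp (l * y) / l" using assms by (simp add: field_simps)
  from mult_left_mono[OF this, of "2 * b"] have 2: "2 * b * y \<le> 2 * b / l * exp (l * y)" using assms by simp
  have "x\<^sup>2 - b\<^sup>2 = y\<^sup>2 + 2 * b * y" by (simp add: y_def power2_eq_square algebra_simps)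
  also have "\<dots> \<le> (2 / l\<^sup>2 + 2 * b / l) * exp (l * y)" using 1 2 by (simp add: distrib_right)
  finally show ?thesis using assms by (simp add: y_def add_nonneg_nonneg)
qed

text \<open>The two exponentials stem from the two constraints on the exponential parameter l: one
  from the directional variance \<sigma>, the other from the bound b on the norm of a single
  vector.\<close>

theorem (in prob_space) nn_integral_sq_norm_excess_le:
  fixes Y :: "'b \<Rightarrow> 'a \<Rightarrow> real" and I :: "'i set"
  assumes fin: "finite J"
    and meas [measurable]: "\<And>j. j \<in> J \<Longrightarrow> Y j \<in> borel_measurable M"
    and bound: "AE x in M. (\<Sum>j\<in>J. (Y j x)\<^sup>2) \<le> b\<^sup>2"
    and cent: "\<And>j. j \<in> J \<Longrightarrow> (\<integral>x. Y j x \<partial>M) = 0"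
    and tr: "(\<integral>x. (\<Sum>j\<in>J. (Y j x)\<^sup>2) \<partial>M) \<le> T"
    and weak: "\<And>u. (\<integral>x. (\<Sum>j\<in>J. u j * Y j x)\<^sup>2 \<partial>M) \<le> \<sigma> * (\<Sum>j\<in>J. (u j)\<^sup>2)"
    and I: "finite I" "card I = n" "n > 0"
    and T: "T > 0" and b: "0 < b" "b \<le> 2 * sqrt (real n * T)" and \<sigma>: "\<sigma> > 0"
  shows "(\<integral>\<^sup>+X. ennreal (max 0 ((\<Sum>j\<in>J. (\<Sum>i\<in>I. Y j (X i))\<^sup>2) - 25 / 4 * (real n * T))) \<partial>PiM I (\<lambda>_. M))
    \<le> ennreal (2 * real n * ((32 * \<sigma>\<^sup>2 / T + 20 * \<sigma>) * exp (- (T / (8 * \<sigma>)))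
        + 52 * T * exp (- (sqrt (real n * T) / (4 * b)))))"
proof -
  define h where "h = sqrt (real n * T)"
  have n: "real n > 0" using I by simp
  have h: "h > 0" "h\<^sup>2 = real n * T" using n T by (auto simp: h_def)
  \<comment> \<open>The first entry keeps the directional variance term of the exponent at most l h
    / 2, the second gives l b <= 1/2.\<close>
  define l where "l = min (h / (4 * real n * \<sigma>)) (1 / (2 * b))"
  have l: "l > 0" using h n \<sigma> b by (simp add: l_def)
  have lb: "l * b \<le> 1 / 2"
  proof -
    have "l * b \<le> 1 / (2 * b) * b" using b by (intro mult_right_mono) (auto simp: l_def)
    then show ?thesis using b by simp
  qed
  have lh: "2 * real n * l * \<sigma> \<le> h / 2"
  proof -
    have "2 * real n * l * \<sigma> \<le> 2 * real n * (h / (4 * real n * \<sigma>)) * \<sigma>"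
      using n \<sigma> by (intro mult_right_mono mult_left_mono) (auto simp: l_def)
    also have "\<dots> = h / 2" using n \<sigma> by simp
    finally show ?thesis .
  qed
  define S where "S X = (\<Sum>j\<in>J. (\<Sum>i\<in>I. Y j (X i))\<^sup>2)" for X :: "'i \<Rightarrow> 'a"
  have S0: "S X \<ge> 0" for X by (simp add: S_def sum_nonneg)
  have [measurable]: "S \<in> borel_measurable (PiM I (\<lambda>_. M))" unfolding S_def by measurable
  define C where "C = 2 / l\<^sup>2 + 5 * h / l"
  have C0: "C \<ge> 0" using l h by (simp add: C_def add_nonneg_nonneg)
  have pt: "max 0 (S X - 25 / 4 * (real n * T)) \<le> C * exp (- (5 / 2 * l * h)) * exp (l * sqrt (h\<^sup>2 + S X))" for X
  proof -
    have "max 0 (S X - 25 / 4 * (real n * T)) = max 0 ((sqrt (S X))\<^sup>2 - (5 / 2 * h)\<^sup>2)"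
      using S0[of X] h(2) by (simp add: power_mult_distrib power_divide)
    also have "\<dots> \<le> (2 / l\<^sup>2 + 2 * (5 / 2 * h) / l) * exp (l * (sqrt (S X) - 5 / 2 * h))"
      using l h S0 by (intro sq_diff_le_exp) auto
    also have "\<dots> \<le> C * exp (l * (sqrt (h\<^sup>2 + S X) - 5 / 2 * h))"
      unfolding C_def using l h n T by (intro mult_mono) (auto simp: add_nonneg_nonneg)
    also have "\<dots> = C * exp (- (5 / 2 * l * h)) * exp (l * sqrt (h\<^sup>2 + S X))"
      by (simp add: mult_exp_exp algebra_simps)
    finally show ?thesis .
  qed
  \<comment> \<open>The contributions are l h from the empty sum, l h / 2 each from the drift and
    from the directional variance, and 1/8 from the squared curvature. Subtracting (5/2) l h then
    leaves exp(-l h / 2) up to a constant.\<close>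
  have expo: "l * h + real (card I) * (l * T / (2 * h) + 2 * l\<^sup>2 * \<sigma> + l\<^sup>2 * b\<^sup>2 * T / (2 * h\<^sup>2)) \<le> 2 * l * h + 1 / 8"
  proof -
    have "real n * (l * T / (2 * h)) = l * (real n * T) / (2 * h)" by simp
    also have "\<dots> = l * h / 2" using h(1) unfolding h(2)[symmetric] by (simp add: power2_eq_square)
    finally have 1: "real n * (l * T / (2 * h)) = l * h / 2" .
    have 2: "real n * (2 * l\<^sup>2 * \<sigma>) \<le> l * h / 2"
      using mult_left_mono[OF lh, of l] l by (simp add: power2_eq_square mult_ac)
    have "real n * (l\<^sup>2 * b\<^sup>2 * T / (2 * h\<^sup>2)) = (l * b)\<^sup>2 * (real n * T) / (2 * h\<^sup>2)"
      by (simp add: power_mult_distrib)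
    also have "\<dots> = (l * b)\<^sup>2 / 2" using h(1) unfolding h(2)[symmetric] by simp
    also have "\<dots> \<le> (1 / 2)\<^sup>2 / 2" using lb l b by (intro divide_right_mono power_mono) auto
    finally have 3: "real n * (l\<^sup>2 * b\<^sup>2 * T / (2 * h\<^sup>2)) \<le> 1 / 8" by (simp add: power2_eq_square)
    show ?thesis using 1 2 3 unfolding I(2) distrib_left by linarith
  qed
  have "(\<integral>\<^sup>+X. ennreal (max 0 (S X - 25 / 4 * (real n * T))) \<partial>PiM I (\<lambda>_. M))
     \<le> (\<integral>\<^sup>+X. ennreal (C * exp (- (5 / 2 * l * h))) * ennreal (exp (l * sqrt (h\<^sup>2 + S X))) \<partial>PiM I (\<lambda>_. M))"
    using pt C0 by (intro nn_integral_mono) (simp add: ennreal_mult[symmetric] ennreal_leI)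
  also have "\<dots> = ennreal (C * exp (- (5 / 2 * l * h))) * (\<integral>\<^sup>+X. ennreal (exp (l * sqrt (h\<^sup>2 + S X))) \<partial>PiM I (\<lambda>_. M))"
    by (rule nn_integral_cmult) measurable
  also have "\<dots> \<le> ennreal (C * exp (- (5 / 2 * l * h))) * ennreal (exp (2 * l * h + 1 / 8))"
  proof (rule mult_left_mono)
    have "(\<integral>\<^sup>+X. ennreal (exp (l * sqrt (h\<^sup>2 + S X))) \<partial>PiM I (\<lambda>_. M))
       \<le> ennreal (exp (l * h + real (card I) * (l * T / (2 * h) + 2 * l\<^sup>2 * \<sigma> + l\<^sup>2 * b\<^sup>2 * T / (2 * h\<^sup>2))))"
      unfolding S_def
      using b \<sigma> l lb h
      by (intro nn_integral_exp_smooth_norm_sum fin meas bound cent tr weak I(1)) (auto simp: h_def)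
    also have "\<dots> \<le> ennreal (exp (2 * l * h + 1 / 8))" using expo by (intro ennreal_leI) simp
    finally show "(\<integral>\<^sup>+X. ennreal (exp (l * sqrt (h\<^sup>2 + S X))) \<partial>PiM I (\<lambda>_. M)) \<le> ennreal (exp (2 * l * h + 1 / 8))" .
  qed simp
  also have "\<dots> = ennreal (C * exp (1 / 8) * exp (- (l * h / 2)))"
    using C0 by (simp add: ennreal_mult[symmetric] mult.assoc mult_exp_exp algebra_simps)
  also have "\<dots> \<le> ennreal (2 * (C * exp (- (l * h / 2))))"
  proof (rule ennreal_leI)
    have "exp (1 / 8) \<le> (2::real)" using exp_bound[of "1 / 8"] by (simp add: power2_eq_square)
    then have "C * exp (- (l * h / 2)) * exp (1 / 8) \<le> C * exp (- (l * h / 2)) * 2"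
      using C0 by (intro mult_left_mono) auto
    then show "C * exp (1 / 8) * exp (- (l * h / 2)) \<le> 2 * (C * exp (- (l * h / 2)))" by (simp add: mult_ac)
  qed
  also have "\<dots> \<le> ennreal (2 * real n * ((32 * \<sigma>\<^sup>2 / T + 20 * \<sigma>) * exp (- (T / (8 * \<sigma>)))
        + 52 * T * exp (- (h / (4 * b)))))"
  proof (rule ennreal_leI)
    define E1 where "E1 = real n * ((32 * \<sigma>\<^sup>2 / T + 20 * \<sigma>) * exp (- (T / (8 * \<sigma>))))"
    define E2 where "E2 = real n * (52 * T * exp (- (h / (4 * b))))"
    have E: "E1 \<ge> 0" "E2 \<ge> 0" using n T \<sigma> by (auto simp: E1_def E2_def)
    have "C * exp (- (l * h / 2)) \<le> E1 + E2"
    \<comment> \<open>The minimum defining l decides which exponential appears: l h / 2 equals T /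
      (8 \<sigma>) or h / (4 b).\<close>
    proof (cases "h / (4 * real n * \<sigma>) \<le> 1 / (2 * b)")
      case True
      then have le: "l = h / (4 * real n * \<sigma>)" by (simp add: l_def)
      have "2 / l\<^sup>2 = 32 * (real n)\<^sup>2 * \<sigma>\<^sup>2 / h\<^sup>2" using h(1) n \<sigma> by (simp add: le power_divide power_mult_distrib)
      also have "\<dots> = real n * (32 * \<sigma>\<^sup>2 / T)" unfolding h(2) using n T by (simp add: power2_eq_square)
      finally have 1: "2 / l\<^sup>2 = real n * (32 * \<sigma>\<^sup>2 / T)" .
      have 2: "5 * h / l = real n * (20 * \<sigma>)" using h(1) n \<sigma> by (simp add: le)
      have "l * h / 2 = h\<^sup>2 / (8 * real n * \<sigma>)" by (simp add: le power2_eq_square)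
      also have "\<dots> = T / (8 * \<sigma>)" unfolding h(2) using n by simp
      finally have "C * exp (- (l * h / 2)) = E1" unfolding C_def 1 2 E1_def by (simp add: algebra_simps)
      then show ?thesis using E by simp
    next
      case False
      then have le: "l = 1 / (2 * b)" by (simp add: l_def)
      \<comment> \<open>In this regime b <= 2 h turns 8 b^2 + 10 h b into 52 h^2.\<close>
      have "C = 8 * (b * b) + 10 * (h * b)" by (simp add: C_def le power2_eq_square)
      also have "\<dots> \<le> 8 * (2 * h * (2 * h)) + 10 * (h * (2 * h))"
        using b h(1) by (intro add_mono mult_left_mono mult_mono) (auto simp: h_def)
      also have "\<dots> = 52 * h\<^sup>2" by (simp add: power2_eq_square)
      also have "\<dots> = real n * (52 * T)" by (simp add: h(2))
      finally have "C * exp (- (l * h / 2)) \<le> real n * (52 * T) * exp (- (l * h / 2))" by (rule mult_right_mono) simp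
      also have "\<dots> = E2" by (simp add: E2_def le)
      finally show ?thesis using E by simp
    qed
    then show "2 * (C * exp (- (l * h / 2))) \<le> 2 * real n * ((32 * \<sigma>\<^sup>2 / T + 20 * \<sigma>) * exp (- (T / (8 * \<sigma>)))
        + 52 * T * exp (- (h / (4 * b))))" unfolding E1_def E2_def by (simp add: distrib_left mult.assoc)
  qed
  finally show ?thesis unfolding S_def h_def .
qed

text \<open>Chernoff's method for non-negative variables: exp(-y) <= 1 - y + y^2/2 holds for all y
  >= 0, so the first two moments control the Laplace transform at negative arguments and Z may be
  unbounded.\<close>

lemma (in prob_space) emeasure_mean_lower_tail:
  fixes Z :: "'a \<Rightarrow> real" and I :: "'i set"
  assumes [measurable]: "Z \<in> borel_measurable M" and Z0: "\<And>x. Z x \<ge> 0"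
    and int: "integrable M Z" and int2: "integrable M (\<lambda>x. (Z x)\<^sup>2)"
    and m: "(\<integral>x. Z x \<partial>M) = m" and L: "(\<integral>x. (Z x)\<^sup>2 \<partial>M) \<le> L" "L > 0" and I: "finite I" and t: "t > 0"
  shows "emeasure (PiM I (\<lambda>_. M)) {X \<in> space (PiM I (\<lambda>_. M)). (\<Sum>i\<in>I. Z (X i)) \<le> real (card I) * (m - t)}
     \<le> ennreal (exp (- (real (card I) * t\<^sup>2 / (2 * L))))"
proof -
  \<comment> \<open>This value minimises -l t + l^2 L / 2, the exponent per observation.\<close>
  define l where "l = t / L"
  have l: "l > 0" using t L by (simp add: l_def)
  interpret product_sigma_finite "\<lambda>_::'i. M" ..
  have one: "(\<integral>\<^sup>+x. ennreal (exp (- l * Z x)) \<partial>M) \<le> ennreal (exp (- l * m + l\<^sup>2 * L / 2))"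
  proof -
    have "exp (- l * Z x) \<le> 1 - l * Z x + l\<^sup>2 / 2 * (Z x)\<^sup>2" for x
    proof -
      define y where "y = l * Z x"
      have y: "y \<ge> 0" using l Z0 by (simp add: y_def)
      have q: "1 - y + y\<^sup>2 / 2 \<ge> 0" using zero_le_power2[of "y - 1"] by (simp add: power2_eq_square algebra_simps)
      have "1 \<le> 1 + (y\<^sup>2)\<^sup>2 / 4" by simp
      also have "\<dots> = (1 - y + y\<^sup>2 / 2) * (1 + y + y\<^sup>2 / 2)" by (simp add: power2_eq_square field_simps)
      also have "\<dots> \<le> (1 - y + y\<^sup>2 / 2) * exp y"
        using exp_lower_Taylor_quadratic[OF y] q by (rule mult_left_mono)
      finally have "exp (- y) \<le> 1 - y + y\<^sup>2 / 2" by (simp add: exp_minus field_simps)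
      then show ?thesis by (simp add: y_def power_mult_distrib)
    qed
    then have "(\<integral>\<^sup>+x. ennreal (exp (- l * Z x)) \<partial>M) \<le> (\<integral>\<^sup>+x. ennreal (1 - l * Z x + l\<^sup>2 / 2 * (Z x)\<^sup>2) \<partial>M)"
      by (intro nn_integral_mono ennreal_leI)
    also have "\<dots> = ennreal (\<integral>x. 1 - l * Z x + l\<^sup>2 / 2 * (Z x)\<^sup>2 \<partial>M)"
    proof (rule nn_integral_eq_integral)
      show "AE x in M. 0 \<le> 1 - l * Z x + l\<^sup>2 / 2 * (Z x)\<^sup>2"
      proof (rule AE_I2)
        fix x show "0 \<le> 1 - l * Z x + l\<^sup>2 / 2 * (Z x)\<^sup>2"
          using zero_le_power2[of "l * Z x - 1"] by (simp add: power2_eq_square algebra_simps)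
      qed
    qed (use int int2 in auto)
    also have "(\<integral>x. 1 - l * Z x + l\<^sup>2 / 2 * (Z x)\<^sup>2 \<partial>M) = 1 - l * m + l\<^sup>2 / 2 * (\<integral>x. (Z x)\<^sup>2 \<partial>M)"
      using int int2 m by (simp add: prob_space)
    also have "ennreal \<dots> \<le> ennreal (exp (- l * m + l\<^sup>2 * L / 2))"
    proof (rule ennreal_leI)
      have "1 - l * m + l\<^sup>2 / 2 * (\<integral>x. (Z x)\<^sup>2 \<partial>M) \<le> 1 + (- l * m + l\<^sup>2 * L / 2)"
        using mult_left_mono[OF L(1), of "l\<^sup>2 / 2"] by simp
      also have "\<dots> \<le> exp (- l * m + l\<^sup>2 * L / 2)" by (rule exp_ge_add_one_self)
      finally show "1 - l * m + l\<^sup>2 / 2 * (\<integral>x. (Z x)\<^sup>2 \<partial>M) \<le> exp (- l * m + l\<^sup>2 * L / 2)" .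
    qed
    finally show ?thesis .
  qed
  define c where "c = exp (l * (real (card I) * (m - t)))"
  have "emeasure (PiM I (\<lambda>_. M)) {X \<in> space (PiM I (\<lambda>_. M)). (\<Sum>i\<in>I. Z (X i)) \<le> real (card I) * (m - t)}
     = (\<integral>\<^sup>+X. indicator {X \<in> space (PiM I (\<lambda>_. M)). (\<Sum>i\<in>I. Z (X i)) \<le> real (card I) * (m - t)} X \<partial>PiM I (\<lambda>_. M))"
    by (rule nn_integral_indicator[symmetric]) measurable
  also have "\<dots> \<le> (\<integral>\<^sup>+X. ennreal c * (\<Prod>i\<in>I. ennreal (exp (- l * Z (X i)))) \<partial>PiM I (\<lambda>_. M))"
  proof (intro nn_integral_mono)
    fix X
    have "(\<Prod>i\<in>I. ennreal (exp (- l * Z (X i)))) = ennreal (exp (- l * (\<Sum>i\<in>I. Z (X i))))"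
      using I by (simp add: prod_ennreal exp_sum[symmetric] sum_distrib_left sum_negf)
    then have "ennreal c * (\<Prod>i\<in>I. ennreal (exp (- l * Z (X i))))
       = ennreal (exp (l * (real (card I) * (m - t)) - l * (\<Sum>i\<in>I. Z (X i))))"
      by (simp add: c_def ennreal_mult[symmetric] mult_exp_exp)
    moreover have "1 \<le> exp (l * (real (card I) * (m - t)) - l * (\<Sum>i\<in>I. Z (X i)))"
      if "(\<Sum>i\<in>I. Z (X i)) \<le> real (card I) * (m - t)"
      using mult_left_mono[OF that, of l] l by simp
    ultimately show "indicator {X \<in> space (PiM I (\<lambda>_. M)). (\<Sum>i\<in>I. Z (X i)) \<le> real (card I) * (m - t)} X
       \<le> ennreal c * (\<Prod>i\<in>I. ennreal (exp (- l * Z (X i))))"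
      by (auto simp: indicator_def)
  qed
  also have "\<dots> = ennreal c * (\<integral>\<^sup>+X. (\<Prod>i\<in>I. ennreal (exp (- l * Z (X i)))) \<partial>PiM I (\<lambda>_. M))"
    by (rule nn_integral_cmult) measurable
  also have "\<dots> = ennreal c * (\<Prod>i\<in>I. \<integral>\<^sup>+x. ennreal (exp (- l * Z x)) \<partial>M)"
    using I by (subst product_nn_integral_prod[where f = "\<lambda>_ x. ennreal (exp (- l * Z x))"]) auto
  also have "\<dots> \<le> ennreal c * (\<Prod>i\<in>I. ennreal (exp (- l * m + l\<^sup>2 * L / 2)))"
  proof (rule mult_left_mono)
    show "(\<Prod>i\<in>I. \<integral>\<^sup>+x. ennreal (exp (- l * Z x)) \<partial>M) \<le> (\<Prod>i\<in>I. ennreal (exp (- l * m + l\<^sup>2 * L / 2)))"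
      using I
    proof (induction I rule: finite_induct)
      case (insert i F)
      show ?case unfolding prod.insert[OF insert.hyps] by (intro mult_mono one insert.IH) auto
    qed simp
  qed simp
  also have "\<dots> = ennreal (exp (l * (real (card I) * (m - t)) + real (card I) * (- l * m + l\<^sup>2 * L / 2)))"
    by (simp add: c_def ennreal_power ennreal_mult[symmetric] exp_of_nat_mult[symmetric] mult_exp_exp)
  also have "l * (real (card I) * (m - t)) + real (card I) * (- l * m + l\<^sup>2 * L / 2) = - (real (card I) * t\<^sup>2 / (2 * L))"
    using L(2) by (simp add: l_def power2_eq_square field_simps)
  finally show ?thesis .
qed

section \<open>Deterministic oracle inequality\<close>

lemma sum_lessThan_split:
  fixes f :: "nat \<Rightarrow> real"
  assumes "k \<le> l"
  shows "(\<Sum>j<l. f j) = (\<Sum>j<k. f j) + (\<Sum>j\<in>{k..<l}. f j)"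
  using assms by (simp add: lessThan_atLeast0 sum.atLeastLessThan_concat)

text \<open>Read \<open>a\<close> and \<open>ah\<close> as true and estimated coefficients,
  \<open>B\<close> as squared bias, \<open>D\<close> as estimation error, \<open>P\<close> as its
  excess over 25/4 of the trace level t sqrt k, and \<open>c\<close> as the criterion with penalty q
  sqrt k; \<open>k0\<close> is the competitor. Each k is either harmless, its loss being comparable
  to that of \<open>k0\<close> or to \<open>P k\<close>, or its criterion exceeds that of
  \<open>k0\<close> so much that its weight is exponentially small.\<close>

lemma weighted_loss_le:
  fixes a ah pen p c w B D P :: "nat \<Rightarrow> real" and N F q t :: real
  assumes N: "N > 0"
    and B_def: "\<And>k. B k = F - (\<Sum>j<k. (a j)\<^sup>2)" and B0: "\<And>k. B k \<ge> 0"
    and D_def: "\<And>k. D k = (\<Sum>j<k. (ah j - a j)\<^sup>2)"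
    and c_def: "\<And>k. c k = - (\<Sum>j<k. (ah j)\<^sup>2) + q * sqrt (real k)"
    and P_def: "\<And>k. P k = max 0 (D k - 25 / 4 * (t * sqrt (real k)))"
    and t: "N * t \<ge> 1" "42 * t \<le> q"
    and w: "\<And>k. k \<in> {1..M} \<Longrightarrow> 0 \<le> w k" "(\<Sum>k=1..M. w k) = 1"
      "\<And>k l. k \<in> {1..M} \<Longrightarrow> l \<in> {1..M} \<Longrightarrow> w k \<le> exp (- N * (c k - c l))"
    and k0: "k0 \<in> {1..M}"
  shows "(\<Sum>k=1..M. w k * (D k + B k)) \<le> 20 * (B k0 + q * sqrt (real k0) + P k0) + 10 * (\<Sum>k=1..M. P k)
     + 10 / N * (\<Sum>k=1..M. exp (- sqrt (real k)))"
proof -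
  define R where "R = B k0 + q * sqrt (real k0) + P k0"
  have t0: "t > 0" using t(1) N by (smt (verit) mult_nonneg_nonpos)
  have q0: "q > 0" using t(2) t0 by simp
  have P0: "P k \<ge> 0" for k by (simp add: P_def)
  have D0: "D k \<ge> 0" for k by (simp add: D_def sum_nonneg)
  have DP: "D k \<le> 25 / 4 * (t * sqrt (real k)) + P k" for k by (simp add: P_def)
  have pen0: "q * sqrt (real k) \<ge> 0" for k using q0 by simp
  have R0: "R \<ge> 0" unfolding R_def using B0 P0 pen0 by (simp add: add_nonneg_nonneg)
  have pq: "42 * (t * sqrt (real k)) \<le> q * sqrt (real k)" for k
    using mult_right_mono[OF t(2), of "sqrt (real k)"] by simp
  have Np: "sqrt (real k) \<le> N * (t * sqrt (real k))" for k
    using mult_right_mono[OF t(1), of "sqrt (real k)"] by (simp add: mult_ac)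
  have D0R: "D k0 \<le> R" using DP[of k0] pq[of k0] B0[of k0] P0[of k0] pen0[of k0] by (simp add: R_def)
  have BR: "B k0 \<le> R" using pen0[of k0] P0[of k0] by (simp add: R_def)
  have wle1: "w k \<le> 1" if "k \<in> {1..M}" for k
    using member_le_sum[of k "{1..M}" w] that w(1,2) by auto
  \<comment> \<open>Summing this over k proves the claim, as the weights add up to 1.\<close>
  have key: "w k * (D k + B k) \<le> w k * (20 * R) + 10 * P k + 10 / N * exp (- sqrt (real k))"
    if k: "k \<in> {1..M}" for k
  proof -
    note wk = w(1)[OF k] wle1[OF k] w(3)[OF k k0]
    have tail: "0 \<le> 10 / N * exp (- sqrt (real k))" using N by simp
    consider "k = k0" | "k0 < k" | "k < k0" by linarith
    then show ?thesis
    proof cases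
      case 1
      have "D k + B k \<le> 20 * R" using D0R BR R0 unfolding 1 by linarith
      then have "w k * (D k + B k) \<le> w k * (20 * R)" using wk by (intro mult_left_mono)
      then show ?thesis using P0[of k] tail by linarith
    next
      case 2
      define p where "p = t * sqrt (real k)"
      have p0: "p \<ge> 0" using t0 by (simp add: p_def)
      have S: "B k0 = B k + (\<Sum>j\<in>{k0..<k}. (a j)\<^sup>2)" "D k = D k0 + (\<Sum>j\<in>{k0..<k}. (ah j - a j)\<^sup>2)"
        "c k - c k0 = - (\<Sum>j\<in>{k0..<k}. (ah j)\<^sup>2) + q * sqrt (real k) - q * sqrt (real k0)"
        using 2 by (simp_all add: B_def D_def c_def sum_lessThan_split[of k0 k])
      have "(\<Sum>j\<in>{k0..<k}. (ah j)\<^sup>2) \<le> (\<Sum>j\<in>{k0..<k}. 2 * (ah j - a j)\<^sup>2 + 2 * (a j)\<^sup>2)"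
      proof (rule sum_mono)
        fix j show "(ah j)\<^sup>2 \<le> 2 * (ah j - a j)\<^sup>2 + 2 * (a j)\<^sup>2"
          using zero_le_power2[of "ah j - 2 * a j"] by (simp add: power2_eq_square algebra_simps)
      qed
      then have cd: "c k - c k0 \<ge> q * sqrt (real k) - 2 * D k - 2 * B k0 - q * sqrt (real k0)"
        using S D0[of k0] B0[of k] by (simp add: sum.distrib sum_distrib_left[symmetric])
      have Bk: "B k \<le> B k0" using S(1) by (simp add: sum_nonneg)
      have Dk: "D k \<le> 25 / 4 * p + P k" using DP by (simp add: p_def)
      \<comment> \<open>Here k is too large and the loss is driven by \<open>D k\<close>. If neither
        the excess nor R dominates the variance level p, the surplus of the penalty makes the weight
        small.\<close>
      consider "p \<le> P k" | "p \<le> R" | "P k < p" "R < p" by linarith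
      then show ?thesis
      proof cases
        case 1
        have "w k * (D k + B k) \<le> w k * R + w k * (8 * P k)"
          unfolding distrib_left[symmetric] using 1 Dk Bk BR P0[of k] wk by (intro mult_left_mono) auto
        also have "w k * (8 * P k) \<le> 1 * (8 * P k)" using wk P0 by (intro mult_right_mono) auto
        finally show ?thesis using P0[of k] tail mult_left_mono[of R "20 * R" "w k"] R0 wk by linarith
      next
        case 2
        have "w k * (D k + B k) \<le> w k * (20 * R) + w k * P k"
          unfolding distrib_left[symmetric] using 2 Dk Bk BR R0 wk by (intro mult_left_mono) auto
        also have "w k * P k \<le> 1 * P k" using wk P0 by (intro mult_right_mono) auto
        finally show ?thesis using P0[of k] tail by linarith
      next
        case 3
        \<comment> \<open>The count is 42 - 25/2 - 2 - 2 = 25.5: the penalty of k, minus twice its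
          estimation error with \<open>P k\<close> < p, minus the terms of \<open>k0\<close>, which
          are at most 2 R < 2 p.\<close>
        have "c k - c k0 \<ge> 25 * p"
          using cd Dk 3 pq[of k] P0[of k0] B0[of k0] pen0[of k0] unfolding R_def p_def by linarith
        then have "- N * (c k - c k0) \<le> - N * (25 * p)" using N by simp
        then have "w k \<le> exp (- N * (25 * p))" using wk(3) by (meson exp_le_cancel_iff order_trans)
        moreover have "D k + B k \<le> 10 * p" using Dk Bk BR 3 p0 by linarith
        ultimately have "w k * (D k + B k) \<le> exp (- N * (25 * p)) * (10 * p)"
          using D0[of k] B0[of k] by (intro mult_mono) auto
        also have "\<dots> = 10 / N * ((N * p) * exp (- (25 * (N * p))))" using N by (simp add: mult_ac)
        also have "\<dots> \<le> 10 / N * exp (- sqrt (real k))"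
        proof (rule mult_left_mono)
          \<comment> \<open>y exp(-25 y) <= exp(-24 y), and N t >= 1 bounds y below by sqrt k; this
            makes the remainder summable over k.\<close>
          define y where "y = N * p"
          have y: "0 \<le> y" "sqrt (real k) \<le> y" using N p0 Np[of k] by (auto simp: y_def p_def)
          have "y \<le> exp y" using exp_ge_add_one_self[of y] by linarith
          then have "y * exp (- (25 * y)) \<le> exp y * exp (- (25 * y))" by (rule mult_right_mono) simp
          also have "\<dots> = exp (- (24 * y))" by (simp add: mult_exp_exp)
          also have "\<dots> \<le> exp (- sqrt (real k))" using y by simp
          finally show "N * p * exp (- (25 * (N * p))) \<le> exp (- sqrt (real k))" by (simp add: y_def)
        qed (use N in auto)
        finally show ?thesis using P0[of k] mult_nonneg_nonneg[of "w k" "20 * R"] R0 wk by linarith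
      qed
    next
      case 3
      have S: "B k = B k0 + (\<Sum>j\<in>{k..<k0}. (a j)\<^sup>2)" "D k0 = D k + (\<Sum>j\<in>{k..<k0}. (ah j - a j)\<^sup>2)"
        "c k - c k0 = (\<Sum>j\<in>{k..<k0}. (ah j)\<^sup>2) + q * sqrt (real k) - q * sqrt (real k0)"
        using 3 by (simp_all add: B_def D_def c_def sum_lessThan_split[of k k0])
      have "(\<Sum>j\<in>{k..<k0}. (a j)\<^sup>2) \<le> (\<Sum>j\<in>{k..<k0}. 2 * (ah j)\<^sup>2 + 2 * (ah j - a j)\<^sup>2)"
      proof (rule sum_mono)
        fix j show "(a j)\<^sup>2 \<le> 2 * (ah j)\<^sup>2 + 2 * (ah j - a j)\<^sup>2"
          using zero_le_power2[of "2 * ah j - a j"] by (simp add: power2_eq_square algebra_simps)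
      qed
      then have lin: "(\<Sum>j\<in>{k..<k0}. (a j)\<^sup>2) \<le> 2 * (\<Sum>j\<in>{k..<k0}. (ah j)\<^sup>2) + 2 * (\<Sum>j\<in>{k..<k0}. (ah j - a j)\<^sup>2)"
        by (simp add: sum.distrib sum_distrib_left)
      \<comment> \<open>Here k is too small and the bias is the danger, while \<open>D k\<close> is
        at most \<open>D k0\<close>. Q collects everything that can offset half of the bias in the
        gap of the criterion.\<close>
      define Q where "Q = B k0 / 2 + D k0 + q * sqrt (real k0)"
      have cd: "c k - c k0 \<ge> B k / 2 - Q"
        using lin S D0[of k] pen0[of k] unfolding Q_def by linarith
      have QR: "Q \<le> 2 * R" using DP[of k0] pq[of k0] B0[of k0] P0[of k0] pen0[of k0] unfolding Q_def R_def distrib_left by linarith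
      have Dk: "D k \<le> R" using S(2) D0R by (smt (verit) sum_nonneg zero_le_power2)
      show ?thesis
      proof (cases "B k \<le> 4 * Q")
        case True
        have "w k * (D k + B k) \<le> w k * (20 * R)" using True QR Dk R0 wk by (intro mult_left_mono) auto
        then show ?thesis using P0[of k] tail by linarith
      next
        case False
        \<comment> \<open>A bias above 4 Q leaves at least \<open>B k\<close> / 4 of the gap. As 4 Q
          contains the penalty of \<open>k0\<close>, N times the bias is then at least 8 sqrt
          k.\<close>
        then have "c k - c k0 \<ge> B k / 4" using cd by linarith
        then have "- N * (c k - c k0) \<le> - N * (B k / 4)" using N by simp
        then have we: "w k \<le> exp (- N * (B k / 4))" using wk(3) by (meson exp_le_cancel_iff order_trans)
        have "w k * B k \<le> exp (- N * (B k / 4)) * B k" using we B0 by (rule mult_right_mono)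
        also have "\<dots> = 1 / N * ((N * B k) * exp (- (N * B k) / 4))" using N by (simp add: mult_ac)
        also have "\<dots> \<le> 1 / N * (8 * exp (- sqrt (real k)))"
        proof (rule mult_left_mono)
          define y where "y = N * B k"
          have "sqrt (real k) \<le> sqrt (real k0)" using 3 by simp
          also have "\<dots> \<le> N * (t * sqrt (real k0))" by (rule Np)
          also have "\<dots> \<le> N * (B k / 8)"
            using False pq[of k0] pen0[of k0] B0[of k0] D0[of k0] N unfolding Q_def distrib_left by (intro mult_left_mono) linarith+
          finally have y: "sqrt (real k) \<le> y / 8" by (simp add: y_def)
          have "y \<le> 8 * exp (y / 8)" using exp_ge_add_one_self[of "y / 8"] by linarith
          then have "y * exp (- y / 4) \<le> 8 * exp (y / 8) * exp (- y / 4)" by (rule mult_right_mono) simp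
          also have "\<dots> = 8 * exp (- (y / 8))" by (simp add: mult_exp_exp)
          also have "\<dots> \<le> 8 * exp (- sqrt (real k))" using y by simp
          finally show "N * B k * exp (- (N * B k) / 4) \<le> 8 * exp (- sqrt (real k))" by (simp add: y_def)
        qed (use N in auto)
        also have "\<dots> \<le> 10 / N * exp (- sqrt (real k))" using N by (simp add: divide_right_mono)
        finally have "w k * B k \<le> 10 / N * exp (- sqrt (real k))" .
        moreover have "w k * D k \<le> w k * (20 * R)" using Dk R0 wk by (intro mult_left_mono) auto
        ultimately show ?thesis using P0[of k] by (simp add: distrib_left)
      qed
    qed
  qed
  have "(\<Sum>k=1..M. w k * (D k + B k)) \<le> (\<Sum>k=1..M. w k * (20 * R) + 10 * P k + 10 / N * exp (- sqrt (real k)))"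
    by (intro sum_mono key)
  also have "\<dots> = (\<Sum>k=1..M. w k) * (20 * R) + 10 * (\<Sum>k=1..M. P k) + 10 / N * (\<Sum>k=1..M. exp (- sqrt (real k)))"
    by (simp add: sum.distrib sum_distrib_left sum_distrib_right)
  finally show ?thesis using w(2) by (simp add: R_def)
qed

section \<open>Numerical sums and the consequences of the choice of M_n\<close>

lemma sum_inverse_squares_le: "(\<Sum>k=1..M. 1 / (real k)\<^sup>2) \<le> 2"
proof -
  have "(\<Sum>k=1..Suc m. 1 / (real k)\<^sup>2) \<le> 2 - 1 / real (Suc m)" for m
  proof (induction m)
    case (Suc m)
    define r where "r = real m + 1"
    have "r \<ge> 1" by (simp add: r_def)
    then have "1 / (r + 1)\<^sup>2 \<le> 1 / (r * (r + 1))"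
      by (intro divide_left_mono) (auto simp: power2_eq_square)
    also have "\<dots> = 1 / r - 1 / (r + 1)" using \<open>r \<ge> 1\<close> by (simp add: field_simps)
    finally have "1 / (real (Suc (Suc m)))\<^sup>2 \<le> 1 / real (Suc m) - 1 / real (Suc (Suc m))"
      by (simp add: r_def add_ac)
    then show ?case using Suc by simp
  qed simp
  from this[of "M - 1"] show ?thesis by (cases M) (auto intro: order_trans)
qed

text \<open>The fourth power turns sqrt k into k^2, whose reciprocals sum to at most 2; the factor
  48 is 2 times 4!.\<close>

lemma sum_exp_neg_sqrt_le:
  assumes "c > 0"
  shows "(\<Sum>k=1..M. exp (- (c * sqrt (real k)))) \<le> 48 / c ^ 4"
proof -
  have "exp (- (c * sqrt (real k))) \<le> 24 / c ^ 4 * (1 / (real k)\<^sup>2)" if "k \<in> {1..M}" for k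
  proof -
    have "(c * sqrt (real k)) ^ 4 \<le> fact 4 / 1 ^ 4 * exp (1 * (c * sqrt (real k)))"
      using assms by (intro power_le_fact_exp) auto
    moreover have "sqrt (real k) ^ 4 = (real k)\<^sup>2"
      by (simp add: power4_eq_xxxx power2_eq_square)
    ultimately have "c ^ 4 * (real k)\<^sup>2 \<le> 24 * exp (c * sqrt (real k))"
      by (simp add: power_mult_distrib fact_numeral)
    then show ?thesis using that assms by (simp add: exp_minus field_simps)
  qed
  then have "(\<Sum>k=1..M. exp (- (c * sqrt (real k)))) \<le> (\<Sum>k=1..M. 24 / c ^ 4 * (1 / (real k)\<^sup>2))"
    by (rule sum_mono)
  also have "\<dots> = 24 / c ^ 4 * (\<Sum>k=1..M. 1 / (real k)\<^sup>2)" by (simp add: sum_distrib_left)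
  also have "\<dots> \<le> 24 / c ^ 4 * 2" using assms by (intro mult_left_mono sum_inverse_squares_le) auto
  finally show ?thesis by simp
qed

lemma ln_ge_1_if_ge_3: "n \<ge> 3 \<Longrightarrow> ln (real n) \<ge> 1"
  using exp_le ln_ge_iff[of "real n" 1] by (simp add: ln_ge_iff)

lemma max_dim_Laguerre_bound:
  assumes n: "n \<ge> 3" and k: "1 \<le> k" "k \<le> max_dim Laguerre n"
  shows "sqrt (real k) * (600 * ln (real n))\<^sup>2 \<le> real n"
proof -
  define l where "l = 600 * ln (real n)"
  have l: "l > 0" using ln_ge_1_if_ge_3[OF n] by (simp add: l_def)
  have "real k \<le> (real n)\<^sup>2 * l powr (- 4)"
  proof -
    have "0 \<le> (real n)\<^sup>2 * l powr (- 4)" by simp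
    then have "real (nat \<lfloor>(real n)\<^sup>2 * l powr (- 4)\<rfloor>) \<le> (real n)\<^sup>2 * l powr (- 4)" by linarith
    moreover have "k \<le> nat \<lfloor>(real n)\<^sup>2 * l powr (- 4)\<rfloor>" using k(2) by (simp add: l_def)
    ultimately show ?thesis using of_nat_mono by (meson order_trans)
  qed
  also have "l powr (- 4) = 1 / l ^ 4" using l by (simp add: powr_minus powr_numeral divide_inverse)
  finally have "real k * l ^ 4 \<le> (real n)\<^sup>2" using l by (simp add: field_simps)
  then have "sqrt (real k * l ^ 4) \<le> sqrt ((real n)\<^sup>2)" by (rule real_sqrt_le_mono)
  moreover have "sqrt (l ^ 4) = l\<^sup>2"
    by (rule real_sqrt_unique) (simp_all add: power_mult[symmetric])
  ultimately show ?thesis by (simp add: real_sqrt_mult l_def)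
qed

lemma sqrt_max_dim_le:
  assumes n: "n \<ge> 3" and k: "1 \<le> k" "k \<le> max_dim s n"
  shows "sqrt (real k) \<le> real n"
proof (cases s)
  case Laguerre
  have "sqrt (real k) * 1 \<le> sqrt (real k) * (600 * ln (real n))\<^sup>2"
    using ln_ge_1_if_ge_3[OF n] by (intro mult_left_mono one_le_power) auto
  then show ?thesis using max_dim_Laguerre_bound[OF n k(1)] k(2) Laguerre by simp
next
  case Hermite
  then have "real k \<le> (real n)\<^sup>2" using k by (metis max_dim.simps(2) of_nat_mono of_nat_power)
  then show ?thesis by (simp add: real_le_lsqrt)
qed

text \<open>The decay n^{-3} is tailored to a sum over at most n^2 dimensions with factors sqrt k <=
  n. The constant depends on the setting alone and enters the numerical constant of the
  theorem.\<close>

lemma exp_tail_max_dim: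
  "\<exists>K>0. \<forall>n\<ge>3. \<forall>k. 1 \<le> k \<longrightarrow> k \<le> max_dim s n \<longrightarrow>
     exp (- (sqrt (real n * sqrt (real k) / real k powr dexp s) / 8)) \<le> K / real n ^ 3"
proof (cases s)
  case Laguerre
  show ?thesis
  proof (intro exI[of _ 1] conjI allI impI)
    fix n k :: nat assume n: "n \<ge> 3" and k: "1 \<le> k" "k \<le> max_dim s n"
    define l where "l = ln (real n)"
    have l: "l \<ge> 1" using ln_ge_1_if_ge_3[OF n] by (simp add: l_def)
    have b: "sqrt (real k) * (600 * l)\<^sup>2 \<le> real n"
      using max_dim_Laguerre_bound[OF n k(1)] k(2) Laguerre by (simp add: l_def)
    have "sqrt (real k) / real k = 1 / sqrt (real k)" using k real_sqrt_mult_self[of "real k"] by (simp add: field_simps)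
    moreover have "real n * sqrt (real k) / real k powr dexp s = real n * (sqrt (real k) / real k)"
      using Laguerre by simp
    ultimately have "real n * sqrt (real k) / real k powr dexp s = real n / sqrt (real k)" by simp
    moreover have "(600 * l)\<^sup>2 \<le> real n / sqrt (real k)" using b k by (simp add: field_simps)
    ultimately have "600 * l \<le> sqrt (real n * sqrt (real k) / real k powr dexp s)"
      using real_le_rsqrt by presburger
    \<comment> \<open>The exponent is at least 600/8 = 75 times log n, well above the multiple 3
      that is asked for.\<close>
    then have "exp (- (sqrt (real n * sqrt (real k) / real k powr dexp s) / 8)) \<le> exp (- (3 * l))"
      using l by simp
    also have "\<dots> = 1 / real n ^ 3" using n exp_of_nat_mult[of 3 l] by (simp add: l_def exp_minus divide_inverse)
    finally show "exp (- (sqrt (real n * sqrt (real k) / real k powr dexp s) / 8)) \<le> 1 / real n ^ 3" .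
  qed simp
next
  case Hermite
  show ?thesis
  \<comment> \<open>The 18th power of x = n^{1/6} is n^3, so the 18th term of the exponential series
    is used; the eights come from the rate 1/8.\<close>
  proof (intro exI[of _ "fact 18 * 8 ^ 18"] conjI allI impI)
    fix n k :: nat assume n: "n \<ge> 3" and k: "1 \<le> k" "k \<le> max_dim s n"
    have kn: "real k \<le> real n powr 2" using k Hermite n
      by (metis max_dim.simps(2) of_nat_0_le_iff of_nat_le_iff of_nat_power powr_numeral)
    define x where "x = real n powr (1 / 6)"
    have x0: "x > 0" using n by (simp add: x_def)
    \<comment> \<open>1/2 - 10/12 = -1/3, and k <= n^2 then gives n k^{-1/3} >= n^{1/3}.\<close>
    have "real n * sqrt (real k) / real k powr dexp s = real n * real k powr (- (1 / 3))"
      using Hermite k by (simp add: powr_half_sqrt[symmetric] powr_diff[symmetric] times_divide_eq_right[symmetric] del: times_divide_eq_right)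
    also have "\<dots> \<ge> real n powr 1 * (real n powr 2) powr (- (1 / 3))"
      using kn k by (intro mult_mono powr_mono2') auto
    also have "real n powr 1 * (real n powr 2) powr (- (1 / 3)) = x\<^sup>2"
    proof -
      have "(real n powr 2) powr (- (1 / 3)) = real n powr (- (2 / 3))" by (subst powr_powr) simp
      then have "real n powr 1 * (real n powr 2) powr (- (1 / 3)) = real n powr (1 + - (2 / 3))"
        by (simp only: powr_add)
      also have "\<dots> = x\<^sup>2" unfolding x_def power2_eq_square powr_add[symmetric] by simp
      finally show ?thesis .
    qed
    finally have "x \<le> sqrt (real n * sqrt (real k) / real k powr dexp s)" by (rule real_le_rsqrt)
    then have "exp (- (sqrt (real n * sqrt (real k) / real k powr dexp s) / 8)) \<le> exp (- (x / 8))" by simp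
    also have "\<dots> \<le> fact 18 * 8 ^ 18 / real n ^ 3"
    proof -
      have "x ^ 18 \<le> fact 18 / (1 / 8) ^ 18 * exp (1 / 8 * x)" using x0 by (intro power_le_fact_exp) auto
      moreover have "x ^ 18 = real n ^ 3"
      proof -
        have "x ^ 18 = x powr 18" using x0 powr_realpow[of x 18] by simp
        also have "\<dots> = real n powr 3" by (simp add: x_def powr_powr)
        finally show ?thesis using n by (simp add: powr_numeral)
      qed
      ultimately have "real n ^ 3 \<le> fact 18 * 8 ^ 18 * exp (x / 8)" by (simp add: power_divide)
      then show ?thesis using n by (simp add: exp_minus field_simps del: fact_numeral)
    qed
    finally show "exp (- (sqrt (real n * sqrt (real k) / real k powr dexp s) / 8)) \<le> fact 18 * 8 ^ 18 / real n ^ 3" .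
  qed simp
qed

section \<open>Projection estimators\<close>

lemma phi_orthonormal_basis: "orthonormal_basis (dom_of s) (phi s)"
proof (cases s)
  case Laguerre
  have "laguerre_fun j x = 0" if "x \<notin> {0<..}" for j x using that by (simp add: laguerre_fun_def)
  then show ?thesis unfolding Laguerre
    by (unfold_locales) (auto simp: laguerre_fun_orthonormal intro: laguerre_fun_complete)
next
  case Hermite
  then show ?thesis
    by (unfold_locales) (auto simp: hermite_fun_orthonormal intro: hermite_fun_complete)
qed

lemma dom_of_measurable [measurable]: "dom_of s \<in> sets borel"
  by (cases s) auto

lemma norm_on_sq:
  assumes "\<And>x. x \<notin> A \<Longrightarrow> g x = 0"
  shows "(norm_on A g)\<^sup>2 = (\<integral>x. (g x)\<^sup>2 \<partial>lborel)"
proof -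
  have "indicator A x *\<^sub>R (g x * g x) = (g x)\<^sup>2" for x
    using assms[of x] by (cases "x \<in> A") (auto simp: power2_eq_square)
  then show ?thesis by (simp add: norm_on_def inner_on_def set_lebesgue_integral_def)
qed

text \<open>K plays the role of C_{omega,L}. The sup norm is bounded through its square, so f itself
  is at most sqrt K almost everywhere.\<close>

locale density_setting =
  fixes s :: setting and f :: "real \<Rightarrow> real" and Cphi K :: real
  assumes dens: "f \<in> densities s" and basis: "basis_constant s Cphi" and K1: "K \<ge> 1"
    and vK: "v_mom s f \<le> ennreal K" and supK: "(sup_norm_on (dom_of s) f)\<^sup>2 \<le> ennreal K"
    and normK: "(norm_on (dom_of s) f)\<^sup>2 \<le> K" and momK: "moment f (2 * alpha s) \<le> ennreal K"
begin

sublocale orthonormal_basis "dom_of s" "phi s" by (rule phi_orthonormal_basis)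

lemma Cphi1: "Cphi \<ge> 1" using basis by (simp add: basis_constant_def)

lemma f_meas [measurable]: "f \<in> borel_measurable borel"
  and f_nonneg: "0 \<le> f x" and f_supp: "x \<notin> dom_of s \<Longrightarrow> f x = 0"
  using dens by (auto simp: densities_def)

lemma f_sq_integrable: "integrable lborel (\<lambda>x. (f x)\<^sup>2)"
proof -
  have "indicator (dom_of s) x *\<^sub>R (f x)\<^sup>2 = (f x)\<^sup>2" for x
    using f_supp[of x] by (cases "x \<in> dom_of s") auto
  moreover have "integrable lborel (\<lambda>x. indicator (dom_of s) x *\<^sub>R (f x)\<^sup>2)"
    using dens by (auto simp: densities_def L2_on_def set_integrable_def)
  ultimately show ?thesis by (simp only:)
qed

lemma sets_law [measurable_cong]: "sets (law f) = sets borel"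
  and space_law: "space (law f) = UNIV"
  by (simp_all add: law_def)

lemma prob_law: "prob_space (law f)"
  using dens by (intro prob_spaceI) (simp add: law_def emeasure_density densities_def)

sublocale M: prob_space "law f" by (rule prob_law)

lemma integral_law:
  assumes [measurable]: "g \<in> borel_measurable borel"
  shows "(\<integral>x. g x \<partial>law f) = (\<integral>x. f x * g x \<partial>lborel)"
  unfolding law_def using f_nonneg by (subst integral_real_density) auto

lemma integrable_law:
  assumes [measurable]: "g \<in> borel_measurable borel"
  shows "integrable (law f) g \<longleftrightarrow> integrable lborel (\<lambda>x. f x * g x)"
  unfolding law_def using f_nonneg by (subst integrable_real_density) auto

lemma AE_lawI:
  assumes "AE x in lborel. x \<in> dom_of s \<longrightarrow> P x"
  shows "AE x in law f. P x"
proof -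
  have "AE x in lborel. 0 < ennreal (f x) \<longrightarrow> P x"
    using assms
  proof eventually_elim
    case (elim x)
    then show ?case using f_supp[of x] by (cases "x \<in> dom_of s") auto
  qed
  then show ?thesis unfolding law_def by (subst AE_density) auto
qed

lemma f_le: "AE x in lborel. f x \<le> sqrt K"
proof -
  define e where "e = sup_norm_on (dom_of s) f"
  have le: "e \<le> ennreal (sqrt K)"
  proof (cases e)
    case (real r)
    then have "ennreal (r\<^sup>2) \<le> ennreal K" using supK by (simp add: e_def ennreal_power)
    then have "r\<^sup>2 \<le> K" using K1 by (simp add: ennreal_le_iff)
    then show ?thesis using real by (simp add: ennreal_leI real_le_rsqrt)
  next
    case top
    then show ?thesis using supK by (simp add: e_def power2_eq_square ennreal_mult_top top_unique)
  qed
  have "AE x in restrict_space lborel (dom_of s). ennreal \<bar>f x\<bar> \<le> e"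
    unfolding e_def sup_norm_on_def by (rule esssup_AE)
  then have "AE x in lborel. x \<in> dom_of s \<longrightarrow> ennreal \<bar>f x\<bar> \<le> e"
    by (subst (asm) AE_restrict_space_iff) auto
  then show ?thesis
  proof eventually_elim
    case (elim x)
    show ?case
    proof (cases "x \<in> dom_of s")
      case True
      then have "ennreal \<bar>f x\<bar> \<le> ennreal (sqrt K)" using elim le by (meson order_trans)
      then show ?thesis using K1 by (simp add: ennreal_le_iff)
    qed (use f_supp K1 in auto)
  qed
qed

definition v :: real where "v = enn2real (v_mom s f)"

lemma v_eq: "v_mom s f = ennreal v"
proof -
  have "v_mom s f < \<top>" using vK by (rule le_less_trans) simp
  then show ?thesis by (simp add: v_def)
qed

lemma v_le: "v \<le> K"
  using vK K1 unfolding v_eq by (simp add: ennreal_le_iff)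

lemma v_ge: "v \<ge> 1"
proof -
  have "ennreal 1 \<le> ennreal v" unfolding v_eq[symmetric] v_mom_def by simp
  moreover have "v \<ge> 0" by (simp add: v_def)
  ultimately show ?thesis by (simp add: ennreal_le_iff)
qed

text \<open>Bounds the trace of the covariance of the first k basis functions at one observation; it
  is the T of the concentration theorem.\<close>

definition trace_bd :: "nat \<Rightarrow> real" where "trace_bd k = Cphi * v * sqrt (real k)"

lemma trace_bd_ge: "sqrt (real k) \<le> trace_bd k"
proof -
  have "1 * sqrt (real k) \<le> (Cphi * v) * sqrt (real k)"
    using Cphi1 v_ge mult_mono[of 1 Cphi 1 v] by (intro mult_right_mono) auto
  then show ?thesis by (simp add: trace_bd_def)
qed

lemma trace_bd_le: "trace_bd k \<le> Cphi * K * sqrt (real k)"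
  unfolding trace_bd_def using Cphi1 v_le v_ge by (intro mult_right_mono mult_left_mono) auto

lemma phi_sq_bound:
  assumes k: "k \<ge> 1"
  shows "AE x in law f. (\<Sum>j<k. (phi s j x)\<^sup>2) \<le> Cphi * real k powr dexp s"
proof (rule AE_lawI)
  define g where "g x = (\<Sum>j<k. (phi s j x)\<^sup>2)" for x
  have g0: "g x \<ge> 0" for x by (simp add: g_def sum_nonneg)
  have "AE x in restrict_space lborel (dom_of s). ennreal \<bar>g x\<bar> \<le> sup_norm_on (dom_of s) g"
    unfolding sup_norm_on_def by (rule esssup_AE)
  then have AE: "AE x in lborel. x \<in> dom_of s \<longrightarrow> ennreal \<bar>g x\<bar> \<le> sup_norm_on (dom_of s) g"
    by (subst (asm) AE_restrict_space_iff) auto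
  have le: "sup_norm_on (dom_of s) g \<le> ennreal (Cphi * real k powr dexp s)"
    using basis k unfolding basis_constant_def g_def by blast
  from AE have "AE x in lborel. x \<in> dom_of s \<longrightarrow> ennreal (g x) \<le> ennreal (Cphi * real k powr dexp s)"
    by (rule AE_mp) (use le g0 in \<open>auto intro!: AE_I2 intro: order_trans\<close>)
  then show "AE x in lborel. x \<in> dom_of s \<longrightarrow> (\<Sum>j<k. (phi s j x)\<^sup>2) \<le> Cphi * real k powr dexp s"
    using Cphi1 by (simp add: ennreal_le_iff g_def)
qed

lemma integrable_phi_sq: "integrable (law f) (\<lambda>x. (phi s j x)\<^sup>2)"
proof (rule M.integrable_const_bound)
  show "AE x in law f. norm ((phi s j x)\<^sup>2) \<le> Cphi * real (Suc j) powr dexp s"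
    using phi_sq_bound[of "Suc j", OF le_add1[of 1 j, unfolded plus_1_eq_Suc]]
  proof eventually_elim
    case (elim x)
    have "(phi s j x)\<^sup>2 \<le> (\<Sum>j<Suc j. (phi s j x)\<^sup>2)" by (simp add: sum_nonneg)
    then show ?case using elim by simp
  qed
qed measurable

lemma integrable_phi: "integrable (law f) (phi s j)"
  by (rule M.square_integrable_imp_integrable) (use integrable_phi_sq in auto)

lemma expectation_phi: "(\<integral>x. phi s j x \<partial>law f) = fcoeff f j"
  by (simp add: integral_law fcoeff_def)

lemma trace_le:
  assumes k: "k \<ge> 1"
  shows "(\<integral>x. (\<Sum>j<k. (phi s j x)\<^sup>2) \<partial>law f) \<le> trace_bd k"
proof -
  have "ennreal (\<integral>x. (\<Sum>j<k. (phi s j x)\<^sup>2) \<partial>law f) = (\<integral>\<^sup>+x. ennreal (\<Sum>j<k. (phi s j x)\<^sup>2) \<partial>law f)"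
    using integrable_phi_sq by (intro nn_integral_eq_integral[symmetric]) (auto intro!: AE_I2 sum_nonneg)
  also have "\<dots> = (\<integral>\<^sup>+x. (\<Sum>j<k. ennreal ((phi s j x)\<^sup>2)) \<partial>law f)" by (simp add: sum_ennreal)
  also have "\<dots> = (\<Sum>j<k. \<integral>\<^sup>+x. ennreal ((phi s j x)\<^sup>2) \<partial>law f)" by (rule nn_integral_sum) measurable
  also have "\<dots> \<le> ennreal Cphi * v_mom s f * ennreal (real k powr (1 / 2))"
    using basis k dens unfolding basis_constant_def by blast
  also have "\<dots> = ennreal (trace_bd k)"
    using Cphi1 v_ge by (simp add: v_eq trace_bd_def ennreal_mult[symmetric] powr_half_sqrt)
  finally show ?thesis using trace_bd_ge[of k] order_trans[OF _ trace_bd_ge[of k], of 0] by (simp add: ennreal_le_iff)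
qed

lemma sum_fcoeff_sq_le:
  assumes k: "k \<ge> 1"
  shows "(\<Sum>j<k. (fcoeff f j)\<^sup>2) \<le> Cphi * real k powr dexp s"
proof -
  have "(fcoeff f j)\<^sup>2 \<le> (\<integral>x. (phi s j x)\<^sup>2 \<partial>law f)" for j
  proof -
    have "0 \<le> M.variance (phi s j)" by (rule M.variance_positive)
    also have "\<dots> = (\<integral>x. (phi s j x)\<^sup>2 \<partial>law f) - (fcoeff f j)\<^sup>2"
      using integrable_phi_sq integrable_phi by (subst M.variance_eq) (auto simp: expectation_phi)
    finally show ?thesis by simp
  qed
  then have "(\<Sum>j<k. (fcoeff f j)\<^sup>2) \<le> (\<Sum>j<k. \<integral>x. (phi s j x)\<^sup>2 \<partial>law f)" by (rule sum_mono)
  also have "\<dots> = (\<integral>x. (\<Sum>j<k. (phi s j x)\<^sup>2) \<partial>law f)"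
    using integrable_phi_sq by (subst Bochner_Integration.integral_sum) auto
  also have "\<dots> \<le> Cphi * real k powr dexp s"
    using phi_sq_bound[OF k] integrable_phi_sq by (intro M.integral_le_const) auto
  finally show ?thesis .
qed

section \<open>Centred basis functions and the excess of the estimation error\<close>

definition phi_dev :: "nat \<Rightarrow> real \<Rightarrow> real" where "phi_dev j x = phi s j x - fcoeff f j"

lemma phi_dev_measurable [measurable]: "phi_dev j \<in> borel_measurable borel"
  unfolding phi_dev_def by measurable

text \<open>Centring doubles the bound on the norm: the squared means obey the same bound as the
  squares, by Jensen's inequality.\<close>

lemma phi_dev_bound:
  assumes k: "k \<ge> 1"
  shows "AE x in law f. (\<Sum>j<k. (phi_dev j x)\<^sup>2) \<le> (2 * sqrt (Cphi * real k powr dexp s))\<^sup>2"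
  using phi_sq_bound[OF k]
proof eventually_elim
  case (elim x)
  have "(\<Sum>j<k. (phi_dev j x)\<^sup>2) \<le> (\<Sum>j<k. 2 * (phi s j x)\<^sup>2 + 2 * (fcoeff f j)\<^sup>2)"
  proof (rule sum_mono)
    fix j show "(phi_dev j x)\<^sup>2 \<le> 2 * (phi s j x)\<^sup>2 + 2 * (fcoeff f j)\<^sup>2"
      using zero_le_power2[of "phi s j x + fcoeff f j"] by (simp add: phi_dev_def power2_eq_square algebra_simps)
  qed
  also have "\<dots> = 2 * (\<Sum>j<k. (phi s j x)\<^sup>2) + 2 * (\<Sum>j<k. (fcoeff f j)\<^sup>2)"
    by (simp add: sum.distrib sum_distrib_left)
  also have "\<dots> \<le> 4 * (Cphi * real k powr dexp s)" using elim sum_fcoeff_sq_le[OF k] by simp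
  also have "\<dots> = (2 * sqrt (Cphi * real k powr dexp s))\<^sup>2"
    using Cphi1 by (simp add: power_mult_distrib)
  finally show ?case .
qed

lemma phi_dev_centered: "(\<integral>x. phi_dev j x \<partial>law f) = 0"
  using integrable_phi by (simp add: phi_dev_def expectation_phi M.prob_space)

lemma integrable_phi_dev_sq: "integrable (law f) (\<lambda>x. (phi_dev j x)\<^sup>2)"
proof -
  have "(phi_dev j x)\<^sup>2 = (phi s j x)\<^sup>2 - 2 * fcoeff f j * phi s j x + (fcoeff f j)\<^sup>2" for x
    by (simp add: phi_dev_def power2_diff)
  then show ?thesis using integrable_phi integrable_phi_sq by simp
qed

lemma phi_dev_trace:
  assumes k: "k \<ge> 1"
  shows "(\<integral>x. (\<Sum>j<k. (phi_dev j x)\<^sup>2) \<partial>law f) \<le> trace_bd k"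
proof -
  have "(\<integral>x. (phi_dev j x)\<^sup>2 \<partial>law f) \<le> (\<integral>x. (phi s j x)\<^sup>2 \<partial>law f)" for j
  proof -
    have "(\<integral>x. (phi_dev j x)\<^sup>2 \<partial>law f) = M.variance (phi s j)" by (simp add: phi_dev_def expectation_phi)
    also have "\<dots> = (\<integral>x. (phi s j x)\<^sup>2 \<partial>law f) - (fcoeff f j)\<^sup>2"
      using integrable_phi_sq integrable_phi by (subst M.variance_eq) (auto simp: expectation_phi)
    finally show ?thesis by simp
  qed
  then have "(\<Sum>j<k. \<integral>x. (phi_dev j x)\<^sup>2 \<partial>law f) \<le> (\<Sum>j<k. \<integral>x. (phi s j x)\<^sup>2 \<partial>law f)" by (rule sum_mono)
  also have "\<dots> = (\<integral>x. (\<Sum>j<k. (phi s j x)\<^sup>2) \<partial>law f)"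
    using integrable_phi_sq by (subst Bochner_Integration.integral_sum) auto
  also have "\<dots> \<le> trace_bd k" by (rule trace_le[OF k])
  finally show ?thesis using integrable_phi_dev_sq by (subst Bochner_Integration.integral_sum) auto
qed

text \<open>The variance of the combination g with coefficients u is at most the integral of g^2
  against f. Bounding f by sqrt K and using orthonormality leaves a constant that does not grow with
  k.\<close>

lemma phi_dev_weak:
  "(\<integral>x. (\<Sum>j<k. u j * phi_dev j x)\<^sup>2 \<partial>law f) \<le> sqrt K * (\<Sum>j<k. (u j)\<^sup>2)"
proof -
  define g where "g x = (\<Sum>j<k. u j * phi s j x)" for x
  have [measurable]: "g \<in> borel_measurable borel" unfolding g_def by measurable
  have g2: "integrable lborel (\<lambda>x. (g x)\<^sup>2)" "(\<integral>x. (g x)\<^sup>2 \<partial>lborel) = (\<Sum>j<k. (u j)\<^sup>2)"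
    unfolding g_def by (auto simp: combination_sq)
  have AE: "AE x in lborel. f x * (g x)\<^sup>2 \<le> sqrt K * (g x)\<^sup>2"
    using f_le by eventually_elim (auto intro: mult_right_mono)
  have fg: "integrable lborel (\<lambda>x. f x * (g x)\<^sup>2)"
  proof (rule Bochner_Integration.integrable_bound)
    show "integrable lborel (\<lambda>x. sqrt K * (g x)\<^sup>2)" using g2 by simp
    show "AE x in lborel. norm (f x * (g x)\<^sup>2) \<le> norm (sqrt K * (g x)\<^sup>2)"
      using AE by eventually_elim (use f_nonneg K1 in \<open>auto simp: abs_mult\<close>)
  qed measurable
  have gl2: "integrable (law f) (\<lambda>x. (g x)\<^sup>2)" using fg by (subst integrable_law) auto
  have gl: "integrable (law f) g" unfolding g_def using integrable_phi by auto
  have "(\<integral>x. g x \<partial>law f) = (\<Sum>j<k. u j * fcoeff f j)"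
    unfolding g_def using integrable_phi by (subst Bochner_Integration.integral_sum) (auto simp: expectation_phi)
  then have "(\<Sum>j<k. u j * phi_dev j x) = g x - (\<integral>x. g x \<partial>law f)" for x
    by (simp add: g_def phi_dev_def right_diff_distrib sum_subtractf)
  then have "(\<integral>x. (\<Sum>j<k. u j * phi_dev j x)\<^sup>2 \<partial>law f) = M.variance g" by simp
  also have "\<dots> = (\<integral>x. (g x)\<^sup>2 \<partial>law f) - (\<integral>x. g x \<partial>law f)\<^sup>2"
    using gl gl2 by (rule M.variance_eq)
  also have "\<dots> \<le> (\<integral>x. f x * (g x)\<^sup>2 \<partial>lborel)" by (simp add: integral_law)
  also have "\<dots> \<le> (\<integral>x. sqrt K * (g x)\<^sup>2 \<partial>lborel)"
    using fg g2 AE by (intro integral_mono_AE) auto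
  also have "\<dots> = sqrt K * (\<Sum>j<k. (u j)\<^sup>2)" by (simp add: g2)
  finally show ?thesis .
qed

definition est_err :: "nat \<Rightarrow> (nat \<Rightarrow> real) \<Rightarrow> nat \<Rightarrow> real" where
  "est_err n X k = (\<Sum>j<k. (ahat s n X j - fcoeff f j)\<^sup>2)"

text \<open>The subtracted level is 25/4 times \<open>trace_bd k\<close> / n, above which the
  concentration theorem makes the expected excess small.\<close>

definition excess :: "nat \<Rightarrow> (nat \<Rightarrow> real) \<Rightarrow> nat \<Rightarrow> real" where
  "excess n X k = max 0 (est_err n X k - 25 / 4 * (Cphi * v / real n * sqrt (real k)))"

lemma excess_eq:
  assumes "n \<ge> 1"
  shows "excess n X k = 1 / (real n)\<^sup>2 * max 0 ((\<Sum>j<k. (\<Sum>i\<in>{1..n}. phi_dev j (X i))\<^sup>2) - 25 / 4 * (real n * trace_bd k))"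
proof -
  have eq: "ahat s n X j - fcoeff f j = (\<Sum>i\<in>{1..n}. phi_dev j (X i)) / real n" for j
    using assms by (simp add: ahat_def phi_dev_def sum_subtractf diff_divide_distrib)
  have "est_err n X k = (\<Sum>j<k. (\<Sum>i\<in>{1..n}. phi_dev j (X i))\<^sup>2) / (real n)\<^sup>2"
    by (simp only: est_err_def eq power_divide) (simp only: sum_divide_distrib)
  moreover have "Cphi * v / real n * sqrt (real k) = real n * trace_bd k / (real n)\<^sup>2"
    using assms by (simp add: trace_bd_def power2_eq_square)
  ultimately have "excess n X k = max 0 (((\<Sum>j<k. (\<Sum>i\<in>{1..n}. phi_dev j (X i))\<^sup>2) - 25 / 4 * (real n * trace_bd k)) / (real n)\<^sup>2)"
    by (simp add: excess_def diff_divide_distrib)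
  moreover have "max 0 (a / q) = 1 / q * max 0 a" if "q > 0" for a q :: real
    using that by (simp add: max_def zero_le_divide_iff)
  ultimately show ?thesis using assms by simp
qed

lemma ahat_measurable [measurable]: "(\<lambda>X. ahat s n X j) \<in> borel_measurable (sample_law f n)"
  unfolding ahat_def sample_law_def by measurable

lemma excess_measurable [measurable]: "(\<lambda>X. excess n X k) \<in> borel_measurable (sample_law f n)"
  unfolding excess_def est_err_def by measurable

lemma vhat_measurable [measurable]: "(\<lambda>X. vhat s n X) \<in> borel_measurable (sample_law f n)"
  unfolding vhat_def sample_law_def by measurable

text \<open>The concentration theorem with T = \<open>trace_bd k\<close>, \<sigma> = sqrt K and b =
  2 sqrt(C_phi k^d), divided by n^2. The factor 104 is 2 times 52, as 32 \<sigma>^2 / T + 20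
  \<sigma> <= 52 K by T >= 1 and \<sigma> >= 1.\<close>

lemma nn_integral_excess_le:
  assumes n: "n \<ge> 1" and k: "k \<ge> 1" "sqrt (real k) \<le> real n"
  shows "(\<integral>\<^sup>+X. ennreal (excess n X k) \<partial>sample_law f n)
    \<le> ennreal (104 / real n * (K * exp (- (1 / (8 * sqrt K) * sqrt (real k)))
        + Cphi * K * sqrt (real k) * exp (- (sqrt (real n * sqrt (real k) / real k powr dexp s) / 8))))"
proof -
  define \<sigma> where "\<sigma> = sqrt K"
  define kd where "kd = real k powr dexp s"
  define b where "b = 2 * sqrt (Cphi * kd)"
  have \<sigma>: "\<sigma> \<ge> 1" "\<sigma>\<^sup>2 = K" using K1 by (auto simp: \<sigma>_def)
  have kd: "kd > 0" using k by (simp add: kd_def)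
  have sk: "sqrt (real k) \<ge> 1" using k by simp
  have T1: "trace_bd k \<ge> 1" using trace_bd_ge[of k] sk by linarith
  have b0: "b > 0" using kd Cphi1 by (simp add: b_def)
  \<comment> \<open>This follows from d <= 1 and sqrt k <= n, and it makes b at most 2 sqrt(n
    T).\<close>
  have kdn: "kd \<le> real n * sqrt (real k)"
  proof -
    have "kd \<le> real k powr 1" unfolding kd_def using k by (intro powr_mono) (cases s, auto)
    also have "\<dots> = sqrt (real k) * sqrt (real k)" using k by simp
    also have "\<dots> \<le> real n * sqrt (real k)" using k by (intro mult_right_mono) auto
    finally show ?thesis .
  qed
  have nT: "Cphi * (real n * sqrt (real k)) \<le> real n * trace_bd k"
  proof -
    have "Cphi * (real n * sqrt (real k)) * 1 \<le> Cphi * (real n * sqrt (real k)) * v"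
      using v_ge Cphi1 by (intro mult_left_mono) auto
    then show ?thesis by (simp add: trace_bd_def mult_ac)
  qed
  have "Cphi * kd \<le> real n * trace_bd k"
    using mult_left_mono[OF kdn, of Cphi] Cphi1 nT by linarith
  then have b2: "b \<le> 2 * sqrt (real n * trace_bd k)" by (simp add: b_def)
  have main: "(\<integral>\<^sup>+X. ennreal (max 0 ((\<Sum>j<k. (\<Sum>i\<in>{1..n}. phi_dev j (X i))\<^sup>2) - 25 / 4 * (real n * trace_bd k))) \<partial>sample_law f n)
    \<le> ennreal (2 * real n * ((32 * \<sigma>\<^sup>2 / trace_bd k + 20 * \<sigma>) * exp (- (trace_bd k / (8 * \<sigma>)))
        + 52 * trace_bd k * exp (- (sqrt (real n * trace_bd k) / (4 * b)))))"
    unfolding sample_law_def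
    by (rule M.nn_integral_sq_norm_excess_le)
       (use n T1 \<sigma> b0 b2 phi_dev_bound[OF k(1)] phi_dev_centered phi_dev_trace[OF k(1)] phi_dev_weak in \<open>auto simp: b_def kd_def \<sigma>_def\<close>)
  have le: "2 * real n * ((32 * \<sigma>\<^sup>2 / trace_bd k + 20 * \<sigma>) * exp (- (trace_bd k / (8 * \<sigma>)))
        + 52 * trace_bd k * exp (- (sqrt (real n * trace_bd k) / (4 * b))))
     \<le> 2 * real n * (52 * K * exp (- (1 / (8 * \<sigma>) * sqrt (real k)))
        + 52 * (Cphi * K * sqrt (real k)) * exp (- (sqrt (real n * sqrt (real k) / kd) / 8)))"
  proof (intro mult_left_mono add_mono mult_mono)
    have "32 * \<sigma>\<^sup>2 / trace_bd k \<le> 32 * \<sigma>\<^sup>2 / 1" using T1 by (intro divide_left_mono) auto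
    moreover have "\<sigma> \<le> \<sigma>\<^sup>2" using \<sigma>(1) by (intro self_le_power) auto
    ultimately show "32 * \<sigma>\<^sup>2 / trace_bd k + 20 * \<sigma> \<le> 52 * K" using \<sigma>(2) by linarith
    have "sqrt (real k) / (8 * \<sigma>) \<le> trace_bd k / (8 * \<sigma>)" using trace_bd_ge \<sigma> by (intro divide_right_mono) auto
    then show "exp (- (trace_bd k / (8 * \<sigma>))) \<le> exp (- (1 / (8 * \<sigma>) * sqrt (real k)))" by simp
    show "trace_bd k \<le> Cphi * K * sqrt (real k)" by (rule trace_bd_le)
    \<comment> \<open>The factor C_phi is common to T and b^2 and cancels in the exponent; v >= 1
      lets T be replaced by C_phi sqrt k.\<close>
    have "sqrt (real n * sqrt (real k) / kd) / 8 = sqrt (Cphi * (real n * sqrt (real k)) / (Cphi * kd)) / 8"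
      using Cphi1 by simp
    also have "\<dots> \<le> sqrt (real n * trace_bd k / (Cphi * kd)) / 8"
      using nT Cphi1 kd by (intro divide_right_mono real_sqrt_le_mono) auto
    also have "\<dots> = sqrt (real n * trace_bd k) / (4 * b)" by (simp add: b_def real_sqrt_divide)
    finally show "exp (- (sqrt (real n * trace_bd k) / (4 * b))) \<le> exp (- (sqrt (real n * sqrt (real k) / kd) / 8))" by simp
  qed (use K1 Cphi1 T1 in auto)
  have "(\<integral>\<^sup>+X. ennreal (excess n X k) \<partial>sample_law f n)
     = (\<integral>\<^sup>+X. ennreal (1 / (real n)\<^sup>2) * ennreal (max 0 ((\<Sum>j<k. (\<Sum>i\<in>{1..n}. phi_dev j (X i))\<^sup>2) - 25 / 4 * (real n * trace_bd k))) \<partial>sample_law f n)"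
    by (intro nn_integral_cong) (subst excess_eq[OF n], rule ennreal_mult, auto)
  also have "\<dots> = ennreal (1 / (real n)\<^sup>2) * (\<integral>\<^sup>+X. ennreal (max 0 ((\<Sum>j<k. (\<Sum>i\<in>{1..n}. phi_dev j (X i))\<^sup>2) - 25 / 4 * (real n * trace_bd k))) \<partial>sample_law f n)"
    by (rule nn_integral_cmult) (simp add: sample_law_def)
  also have "\<dots> \<le> ennreal (1 / (real n)\<^sup>2) * ennreal (2 * real n * (52 * K * exp (- (1 / (8 * \<sigma>) * sqrt (real k)))
        + 52 * (Cphi * K * sqrt (real k)) * exp (- (sqrt (real n * sqrt (real k) / kd) / 8))))"
    by (intro mult_left_mono order_trans[OF main] ennreal_leI le) simp
  also have "\<dots> = ennreal (1 / (real n)\<^sup>2 * (2 * real n * (52 * K * exp (- (1 / (8 * \<sigma>) * sqrt (real k)))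
        + 52 * (Cphi * K * sqrt (real k)) * exp (- (sqrt (real n * sqrt (real k) / kd) / 8)))))"
    using K1 Cphi1 by (intro ennreal_mult[symmetric]) auto
  also have "1 / (real n)\<^sup>2 * (2 * real n * (52 * K * exp (- (1 / (8 * \<sigma>) * sqrt (real k)))
        + 52 * (Cphi * K * sqrt (real k)) * exp (- (sqrt (real n * sqrt (real k) / kd) / 8))))
     = 104 / real n * (K * exp (- (1 / (8 * \<sigma>) * sqrt (real k)))
        + Cphi * K * sqrt (real k) * exp (- (sqrt (real n * sqrt (real k) / kd) / 8)))"
    using n by (simp add: power2_eq_square field_simps)
  finally show ?thesis by (simp add: kd_def \<sigma>_def)
qed


section \<open>Squared bias and the loss of a convex combination\<close>

definition bias :: "nat \<Rightarrow> real" where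
  "bias k = (\<integral>x. (f x)\<^sup>2 \<partial>lborel) - (\<Sum>j<k. (fcoeff f j)\<^sup>2)"

lemma bias_nonneg: "bias k \<ge> 0"
  using bessel[OF f_meas f_sq_integrable, of "{..<k}"] by (simp add: bias_def)

lemma bias_le: "bias k \<le> K"
proof -
  have "bias k \<le> (\<integral>x. (f x)\<^sup>2 \<partial>lborel)" by (simp add: bias_def sum_nonneg)
  also have "\<dots> = (norm_on (dom_of s) f)\<^sup>2" using f_supp by (simp add: norm_on_sq)
  also have "\<dots> \<le> K" by (rule normK)
  finally show ?thesis .
qed

lemma coef_eq: "coef s f j = fcoeff f j"
proof -
  have "indicator (dom_of s) x *\<^sub>R (f x * phi s j x) = f x * phi s j x" for x
    using f_supp[of x] by (cases "x \<in> dom_of s") auto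
  then show ?thesis by (simp only: coef_def inner_on_def set_lebesgue_integral_def fcoeff_def)
qed

lemma crit_eq:
  "crit s \<Delta> n X k = - (\<Sum>j<k. (ahat s n X j)\<^sup>2) + (\<Delta> * vhat s n X / real n) * sqrt (real k)"
proof -
  have "(norm_on (dom_of s) (fhat s n X k))\<^sup>2 = (\<integral>x. (fhat s n X k x)\<^sup>2 \<partial>lborel)"
    by (rule norm_on_sq) (simp add: fhat_def supp)
  also have "\<dots> = (\<Sum>j<k. (ahat s n X j)\<^sup>2)" unfolding fhat_def by (rule combination_sq) simp
  finally show ?thesis by (simp add: crit_def penhat_def powr_half_sqrt)
qed

text \<open>Convexity of the squared norm, done in coordinates: all estimators are padded with zeros
  to length M, and Jensen's inequality is applied to each coordinate.\<close>

lemma aggregate_loss_le: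
  fixes W :: "nat \<Rightarrow> real"
  assumes W: "\<And>k. k \<in> {1..M} \<Longrightarrow> W k \<ge> 0" "(\<Sum>k=1..M. W k) = 1"
  shows "(norm_on (dom_of s) (\<lambda>x. (\<Sum>k=1..M. W k * fhat s n X k x) - f x))\<^sup>2
    \<le> (\<Sum>k=1..M. W k * (est_err n X k + bias k))"
proof -
  define a where "a = fcoeff f"
  define y where "y k j = (if j < k then ahat s n X j else 0)" for k j :: nat
  define c where "c j = (\<Sum>k=1..M. W k * y k j)" for j
  have fh: "fhat s n X k x = (\<Sum>j<M. y k j * phi s j x)" if "k \<in> {1..M}" for k x
    unfolding fhat_def y_def using that by (intro sum.mono_neutral_cong_left) auto
  have agg: "(\<Sum>k=1..M. W k * fhat s n X k x) = (\<Sum>j<M. c j * phi s j x)" for x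
  proof -
    have "(\<Sum>k=1..M. W k * fhat s n X k x) = (\<Sum>k=1..M. \<Sum>j<M. W k * y k j * phi s j x)"
      by (intro sum.cong refl) (simp add: fh sum_distrib_left mult.assoc)
    also have "\<dots> = (\<Sum>j<M. \<Sum>k=1..M. W k * y k j * phi s j x)" by (rule sum.swap)
    finally show ?thesis by (simp add: c_def sum_distrib_right)
  qed
  have jensen: "(c j - a j)\<^sup>2 \<le> (\<Sum>k=1..M. W k * (y k j - a j)\<^sup>2)" for j
  proof -
    have "c j - a j = (\<Sum>k=1..M. W k * y k j) - (\<Sum>k=1..M. W k) * a j" unfolding W(2) by (simp add: c_def)
    also have "\<dots> = (\<Sum>k=1..M. W k * (y k j - a j))"
      unfolding sum_distrib_right sum_subtractf[symmetric] by (simp add: right_diff_distrib)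
    \<comment> \<open>Splitting each weight into two square roots lets the Cauchy-Schwarz inequality
      yield Jensen's.\<close>
    also have "\<dots> = (\<Sum>k=1..M. sqrt (W k) * (sqrt (W k) * (y k j - a j)))"
      using W(1) by (intro sum.cong refl) (simp add: mult.assoc[symmetric])
    finally have "(c j - a j)\<^sup>2 \<le> (\<Sum>k=1..M. (sqrt (W k))\<^sup>2) * (\<Sum>k=1..M. (sqrt (W k) * (y k j - a j))\<^sup>2)"
      by (simp only: Cauchy_Schwarz_ineq_sum)
    also have "(\<Sum>k=1..M. (sqrt (W k))\<^sup>2) = (\<Sum>k=1..M. W k)" using W(1) by (intro sum.cong) auto
    also have "\<dots> = 1" by (rule W(2))
    also have "(\<Sum>k=1..M. (sqrt (W k) * (y k j - a j))\<^sup>2) = (\<Sum>k=1..M. W k * (y k j - a j)\<^sup>2)"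
      using W(1) by (intro sum.cong refl) (simp add: power_mult_distrib)
    finally show ?thesis by simp
  qed
  \<comment> \<open>The part of f beyond dimension M is common to all estimators. It is split off as
    \<open>bias M\<close> and cancels at the end because the weights sum to 1.\<close>
  have ys: "(\<Sum>j<M. (y k j - a j)\<^sup>2) = est_err n X k + bias k - bias M" if "k \<in> {1..M}" for k
  proof -
    have "k \<le> M" using that by simp
    have "(\<Sum>j<M. (y k j - a j)\<^sup>2) = (\<Sum>j<k. (y k j - a j)\<^sup>2) + (\<Sum>j\<in>{k..<M}. (y k j - a j)\<^sup>2)"
      by (rule sum_lessThan_split[OF \<open>k \<le> M\<close>])
    also have "(\<Sum>j<k. (y k j - a j)\<^sup>2) = est_err n X k" by (simp add: y_def est_err_def a_def)
    also have "(\<Sum>j\<in>{k..<M}. (y k j - a j)\<^sup>2) = (\<Sum>j\<in>{k..<M}. (a j)\<^sup>2)" by (simp add: y_def)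
    also have "\<dots> = bias k - bias M" using sum_lessThan_split[OF \<open>k \<le> M\<close>, of "\<lambda>j. (a j)\<^sup>2"] by (simp add: bias_def a_def)
    finally show ?thesis by simp
  qed
  have "(norm_on (dom_of s) (\<lambda>x. (\<Sum>k=1..M. W k * fhat s n X k x) - f x))\<^sup>2
     = (\<integral>x. ((\<Sum>j<M. c j * phi s j x) - f x)\<^sup>2 \<partial>lborel)"
    unfolding agg by (rule norm_on_sq) (simp add: supp f_supp)
  also have "\<dots> = bias M + (\<Sum>j<M. (c j - a j)\<^sup>2)"
    by (subst diff_combination_sq(2)[OF f_meas f_sq_integrable]) (auto simp: bias_def a_def)
  also have "\<dots> \<le> bias M + (\<Sum>j<M. \<Sum>k=1..M. W k * (y k j - a j)\<^sup>2)"
    by (intro add_left_mono sum_mono jensen)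
  also have "(\<Sum>j<M. \<Sum>k=1..M. W k * (y k j - a j)\<^sup>2) = (\<Sum>k=1..M. W k * (\<Sum>j<M. (y k j - a j)\<^sup>2))"
    unfolding sum_distrib_left by (rule sum.swap)
  also have "\<dots> = (\<Sum>k=1..M. W k * (est_err n X k + bias k)) - (\<Sum>k=1..M. W k) * bias M"
    unfolding sum_distrib_right sum_subtractf[symmetric]
    by (intro sum.cong refl) (simp add: ys right_diff_distrib)
  finally show ?thesis unfolding W(2) by simp
qed

section \<open>The moment estimator \<open>vhat\<close>\<close>

definition abs_pow :: "real \<Rightarrow> real" where "abs_pow x = \<bar>x\<bar> powr alpha s"

lemma abs_pow_measurable [measurable]: "abs_pow \<in> borel_measurable borel"
  unfolding abs_pow_def by measurable

lemma abs_pow_nonneg: "abs_pow x \<ge> 0" by (simp add: abs_pow_def)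

lemma nn_integral_abs_pow: "(\<integral>\<^sup>+x. ennreal (abs_pow x) \<partial>law f) = ennreal (v - 1)"
proof -
  have eq: "(\<integral>\<^sup>+x. ennreal (abs_pow x) \<partial>law f) + 1 = ennreal v"
    unfolding v_eq[symmetric] by (simp add: v_mom_def moment_def abs_pow_def)
  show ?thesis
  proof (cases "\<integral>\<^sup>+x. ennreal (abs_pow x) \<partial>law f")
    case (real r)
    then have "ennreal (r + 1) = ennreal v" using eq by simp
    then have "r + 1 = v" using real v_ge by (subst (asm) ennreal_inj) auto
    then show ?thesis using real by simp
  qed (use eq in simp)
qed

lemma integrable_abs_pow: "integrable (law f) abs_pow"
  by (rule integrableI_nonneg) (auto simp: nn_integral_abs_pow abs_pow_nonneg)

lemma expectation_abs_pow: "(\<integral>x. abs_pow x \<partial>law f) = v - 1"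
  using nn_integral_abs_pow v_ge abs_pow_nonneg by (subst integral_eq_nn_integral) auto

lemma abs_pow_sq: "(abs_pow x)\<^sup>2 = \<bar>x\<bar> powr (2 * alpha s)"
  by (simp add: abs_pow_def power2_eq_square powr_add[symmetric])

lemma nn_integral_abs_pow_sq: "(\<integral>\<^sup>+x. ennreal ((abs_pow x)\<^sup>2) \<partial>law f) \<le> ennreal K"
  using momK by (simp add: abs_pow_sq moment_def)

lemma integrable_abs_pow_sq: "integrable (law f) (\<lambda>x. (abs_pow x)\<^sup>2)"
  by (rule integrableI_nonneg) (auto intro: le_less_trans[OF nn_integral_abs_pow_sq])

lemma expectation_abs_pow_sq: "(\<integral>x. (abs_pow x)\<^sup>2 \<partial>law f) \<le> K"
  using nn_integral_abs_pow_sq K1 by (subst integral_eq_nn_integral) (auto intro!: enn2real_leI)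

lemma vhat_eq: "vhat s n X = 1 + (\<Sum>i=1..n. abs_pow (X i)) / real n"
  by (simp add: vhat_def abs_pow_def)

lemma vhat_ge: "vhat s n X \<ge> 1"
  by (simp add: vhat_eq sum_nonneg abs_pow_nonneg)

lemma prob_sample_law: "prob_space (sample_law f n)"
  unfolding sample_law_def by (intro prob_space_PiM prob_law)

text \<open>The random penalty at the comparison dimension enters the loss bound linearly, so
  unbiasedness replaces it by a multiple of v.\<close>

lemma nn_integral_vhat:
  assumes n: "n \<ge> 1"
  shows "(\<integral>\<^sup>+X. ennreal (vhat s n X) \<partial>sample_law f n) = ennreal v"
proof -
  interpret S: prob_space "sample_law f n" by (rule prob_sample_law)
  have comp: "(\<integral>\<^sup>+X. ennreal (abs_pow (X i)) \<partial>sample_law f n) = ennreal (v - 1)" if "i \<in> {1..n}" for i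
  proof -
    have "(\<integral>\<^sup>+X. ennreal (abs_pow (X i)) \<partial>sample_law f n) = (\<integral>\<^sup>+x. ennreal (abs_pow x) \<partial>distr (sample_law f n) (law f) (\<lambda>X. X i))"
      using that by (subst nn_integral_distr) (auto simp: sample_law_def)
    also have "distr (sample_law f n) (law f) (\<lambda>X. X i) = law f"
      unfolding sample_law_def using that prob_law by (rule distr_PiM_component[where M = "\<lambda>_. law f", rotated])
    finally show ?thesis by (simp add: nn_integral_abs_pow)
  qed
  have [measurable]: "(\<lambda>X. abs_pow (X i)) \<in> borel_measurable (sample_law f n)" if "i \<in> {1..n}" for i
    using that unfolding sample_law_def by measurable
  have "(\<integral>\<^sup>+X. ennreal (vhat s n X) \<partial>sample_law f n)
     = (\<integral>\<^sup>+X. 1 + (\<Sum>i=1..n. ennreal (1 / real n) * ennreal (abs_pow (X i))) \<partial>sample_law f n)"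
  proof (intro nn_integral_cong)
    fix X
    have "ennreal (vhat s n X) = ennreal 1 + ennreal (\<Sum>i=1..n. 1 / real n * abs_pow (X i))"
      unfolding vhat_eq sum_divide_distrib by (subst ennreal_plus[symmetric]) (auto simp: abs_pow_nonneg intro!: sum_nonneg)
    also have "ennreal (\<Sum>i=1..n. 1 / real n * abs_pow (X i)) = (\<Sum>i=1..n. ennreal (1 / real n * abs_pow (X i)))"
      by (subst sum_ennreal) (auto simp: abs_pow_nonneg)
    also have "\<dots> = (\<Sum>i=1..n. ennreal (1 / real n) * ennreal (abs_pow (X i)))"
      by (intro sum.cong refl ennreal_mult) (auto simp: abs_pow_nonneg)
    finally show "ennreal (vhat s n X) = 1 + (\<Sum>i=1..n. ennreal (1 / real n) * ennreal (abs_pow (X i)))" by simp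
  qed
  also have "\<dots> = 1 + (\<Sum>i=1..n. ennreal (1 / real n) * ennreal (v - 1))"
  proof -
    have "(\<integral>\<^sup>+X. 1 + (\<Sum>i=1..n. ennreal (1 / real n) * ennreal (abs_pow (X i))) \<partial>sample_law f n)
      = 1 + (\<integral>\<^sup>+X. (\<Sum>i=1..n. ennreal (1 / real n) * ennreal (abs_pow (X i))) \<partial>sample_law f n)"
      by (subst nn_integral_add) (auto simp: S.emeasure_space_1)
    also have "(\<integral>\<^sup>+X. (\<Sum>i=1..n. ennreal (1 / real n) * ennreal (abs_pow (X i))) \<partial>sample_law f n)
       = (\<Sum>i=1..n. \<integral>\<^sup>+X. ennreal (1 / real n) * ennreal (abs_pow (X i)) \<partial>sample_law f n)"
      by (rule nn_integral_sum) measurable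
    also have "\<dots> = (\<Sum>i=1..n. ennreal (1 / real n) * ennreal (v - 1))"
      by (intro sum.cong refl) (subst nn_integral_cmult, auto simp: comp)
    finally show ?thesis .
  qed
  also have "(\<Sum>i=1..n. ennreal (1 / real n) * ennreal (v - 1)) = ennreal (\<Sum>i=1..n. 1 / real n * (v - 1))"
    using v_ge by (simp add: ennreal_mult[symmetric] sum_ennreal del: sum_constant)
  also have "(\<Sum>i=1..n. 1 / real n * (v - 1)) = v - 1" using n by simp
  also have "1 + ennreal (v - 1) = ennreal v"
    using v_ge by (simp add: ennreal_1[symmetric] ennreal_plus[symmetric] del: ennreal_1 ennreal_plus)
  finally show ?thesis .
qed

text \<open>The lower tail of a mean of non-negative variables with second moment at most K is
  exponential in n / K; the inequality exp(-y) <= 1/y turns this into the order K / n.\<close>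

lemma emeasure_vhat_small:
  assumes n: "n \<ge> 1"
  shows "emeasure (sample_law f n) {X \<in> space (sample_law f n). vhat s n X < v / 2} \<le> ennreal (8 * K / real n)"
proof -
  \<comment> \<open>Both v and \<open>vhat\<close> are shifted by 1: \<open>abs_pow\<close> has mean
    v - 1, so \<open>vhat\<close> < v/2 is a deviation by t = v/2.\<close>
  define E where "E = {X \<in> space (PiM {1..n} (\<lambda>_. law f)). (\<Sum>i\<in>{1..n}. abs_pow (X i)) \<le> real (card {1..n}) * ((v - 1) - v / 2)}"
  have [measurable]: "E \<in> sets (PiM {1..n} (\<lambda>_. law f))" unfolding E_def by measurable
  have "{X \<in> space (sample_law f n). vhat s n X < v / 2} \<subseteq> E"
    using n by (auto simp: E_def sample_law_def vhat_eq field_simps)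
  then have "emeasure (sample_law f n) {X \<in> space (sample_law f n). vhat s n X < v / 2} \<le> emeasure (PiM {1..n} (\<lambda>_. law f)) E"
    unfolding sample_law_def by (rule emeasure_mono) measurable
  also have "\<dots> \<le> ennreal (exp (- (real (card {1..n}) * (v / 2)\<^sup>2 / (2 * K))))"
    unfolding E_def
    by (rule M.emeasure_mean_lower_tail)
       (use abs_pow_nonneg integrable_abs_pow integrable_abs_pow_sq expectation_abs_pow expectation_abs_pow_sq K1 v_ge in auto)
  also have "\<dots> \<le> ennreal (8 * K / real n)"
  proof (rule ennreal_leI)
    define y where "y = real n / (8 * K)"
    have y: "y > 0" using n K1 by (simp add: y_def)
    have "(1 / 2)\<^sup>2 \<le> (v / 2)\<^sup>2" using v_ge by (intro power_mono) auto
    then have "real n * (1 / 4) / (2 * K) \<le> real n * (v / 2)\<^sup>2 / (2 * K)"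
      using K1 by (intro divide_right_mono mult_left_mono) (auto simp: power2_eq_square)
    then have "exp (- (real (card {1..n}) * (v / 2)\<^sup>2 / (2 * K))) \<le> exp (- y)" by (simp add: y_def)
    also have "\<dots> \<le> 1 / y"
    proof -
      have "y \<le> exp y" using exp_ge_add_one_self[of y] by linarith
      then show ?thesis using y by (simp add: exp_minus field_simps)
    qed
    finally show "exp (- (real (card {1..n}) * (v / 2)\<^sup>2 / (2 * K))) \<le> 8 * K / real n" by (simp add: y_def)
  qed
  finally show ?thesis .
qed

text \<open>If \<open>vhat\<close> >= v/2, the penalty is at least 42 times the trace level and the
  deterministic oracle inequality applies. Otherwise every candidate loss is bounded crudely by
  order K plus the excesses, which the small probability of this event tolerates.\<close>

lemma loss_le:
  fixes W :: "nat \<Rightarrow> real"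
  assumes M_def: "M = max_dim s n" and n: "n \<ge> 3" and \<Delta>: "\<Delta> \<ge> 84 * Cphi" and k0: "k0 \<in> {1..M}"
    and W: "\<And>k. k \<in> {1..M} \<Longrightarrow> W k \<ge> 0" "(\<Sum>k=1..M. W k) = 1"
      "\<And>k l. k \<in> {1..M} \<Longrightarrow> l \<in> {1..M} \<Longrightarrow> W k \<le> exp (- real n * (crit s \<Delta> n X k - crit s \<Delta> n X l))"
  shows "(\<Sum>k=1..M. W k * (est_err n X k + bias k))
    \<le> (20 * bias k0 + 480 / real n) + 20 * \<Delta> * (sqrt (real k0) / real n) * vhat s n X + 31 * (\<Sum>k=1..M. excess n X k)
      + (25 / 4 * Cphi + 1) * K * (if vhat s n X < v / 2 then 1 else 0)"
proof -
  have nn: "real n > 0" using n by simp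
  have P0: "excess n X k \<ge> 0" for k by (simp add: excess_def)
  have SP: "excess n X k \<le> (\<Sum>k=1..M. excess n X k)" if "k \<in> {1..M}" for k
    using that P0 by (intro member_le_sum) auto
  have D0: "\<Delta> \<ge> 0" using \<Delta> Cphi1 by simp
  have pen0: "20 * \<Delta> * (sqrt (real k0) / real n) * vhat s n X \<ge> 0"
    using D0 vhat_ge[of n X] by simp
  have SP0: "(\<Sum>k=1..M. excess n X k) \<ge> 0" using P0 by (simp add: sum_nonneg)
  show ?thesis
  proof (cases "vhat s n X < v / 2")
    case False
    define q where "q = \<Delta> * vhat s n X / real n"
    define t where "t = Cphi * v / real n"
    have nt: "real n * t \<ge> 1"
      using mult_mono[of 1 Cphi 1 v] Cphi1 v_ge nn by (simp add: t_def)
    \<comment> \<open>The 84 of the theorem is spent here: \<open>vhat\<close> >= v/2 halves it to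
      42.\<close>
    have "42 * (Cphi * v) = (84 * Cphi) * (v / 2)" by simp
    also have "\<dots> \<le> \<Delta> * vhat s n X" using False \<Delta> D0 v_ge by (intro mult_mono) auto
    finally have tq: "42 * t \<le> q" using nn by (simp add: t_def q_def divide_right_mono)
    have "(\<Sum>k=1..M. W k * (est_err n X k + bias k)) \<le> 20 * (bias k0 + q * sqrt (real k0) + excess n X k0) + 10 * (\<Sum>k=1..M. excess n X k)
      + 10 / real n * (\<Sum>k=1..M. exp (- sqrt (real k)))"
      by (rule weighted_loss_le[where a = "fcoeff f" and ah = "ahat s n X" and c = "crit s \<Delta> n X" and t = t and F = "\<integral>x. (f x)\<^sup>2 \<partial>lborel"])
         (use nn bias_nonneg nt tq W k0 in \<open>auto simp: bias_def est_err_def crit_eq q_def excess_def t_def\<close>)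
    also have "(\<Sum>k=1..M. exp (- sqrt (real k))) \<le> 48" using sum_exp_neg_sqrt_le[of 1 M] by simp
    then have "10 / real n * (\<Sum>k=1..M. exp (- sqrt (real k))) \<le> 480 / real n"
      using nn by (simp add: divide_right_mono)
    moreover have "20 * (q * sqrt (real k0)) = 20 * \<Delta> * (sqrt (real k0) / real n) * vhat s n X" by (simp add: q_def)
    ultimately show ?thesis using SP[OF k0] SP0 False by simp
  next
    case True
    \<comment> \<open>By sqrt k <= n the variance level is at most 25/4 C_phi K, and the squared
      bias is at most K.\<close>
    have le: "est_err n X k + bias k \<le> (\<Sum>k=1..M. excess n X k) + (25 / 4 * Cphi + 1) * K" if k: "k \<in> {1..M}" for k
    proof -
      have "sqrt (real k) / real n \<le> 1" using sqrt_max_dim_le[OF n, of k s] k nn by (simp add: M_def)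
      then have "(Cphi * v) * (sqrt (real k) / real n) \<le> (Cphi * K) * 1"
        using Cphi1 v_ge v_le by (intro mult_mono) auto
      then have "est_err n X k \<le> 25 / 4 * (Cphi * K) + excess n X k" by (simp add: excess_def)
      then show ?thesis using bias_le[of k] SP[OF k] by (simp add: algebra_simps)
    qed
    have "(\<Sum>k=1..M. W k * (est_err n X k + bias k)) \<le> (\<Sum>k=1..M. W k * ((\<Sum>k=1..M. excess n X k) + (25 / 4 * Cphi + 1) * K))"
      using W(1) le by (intro sum_mono mult_left_mono) auto
    also have "\<dots> = (\<Sum>k=1..M. excess n X k) + (25 / 4 * Cphi + 1) * K"
      unfolding sum_distrib_right[symmetric] W(2) by simp
    also have "\<dots> \<le> (20 * bias k0 + 480 / real n) + 20 * \<Delta> * (sqrt (real k0) / real n) * vhat s n X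
      + 31 * (\<Sum>k=1..M. excess n X k) + (25 / 4 * Cphi + 1) * K"
      using SP0 bias_nonneg[of k0] by (intro add_mono add_increasing[OF add_nonneg_nonneg[OF _ pen0]]) auto
    finally show ?thesis by (simp only: True if_True mult_1_right)
  qed
qed

text \<open>The weights enter only through their sign, their sum and the exponential comparison, so
  one argument serves both families.\<close>

lemma risk_le:
  fixes w :: "(nat \<Rightarrow> real) \<Rightarrow> nat \<Rightarrow> real"
  assumes M_def: "M = max_dim s n" and n: "n \<ge> 3" and \<Delta>: "\<Delta> \<ge> 84 * Cphi" and k0: "k0 \<in> {1..M}"
    and w: "\<And>X k. k \<in> {1..M} \<Longrightarrow> w X k \<ge> 0" "\<And>X. (\<Sum>k=1..M. w X k) = 1"
      "\<And>X k l. k \<in> {1..M} \<Longrightarrow> l \<in> {1..M} \<Longrightarrow> w X k \<le> exp (- real n * (crit s \<Delta> n X k - crit s \<Delta> n X l))"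
    and Q: "Q > 0" "\<And>k. 1 \<le> k \<Longrightarrow> k \<le> M \<Longrightarrow>
       exp (- (sqrt (real n * sqrt (real k) / real k powr dexp s) / 8)) \<le> Q / real n ^ 3"
  shows "risk s n w f \<le> ennreal (20 * bias k0 + 20 * \<Delta> * K * (sqrt (real k0) / real n)
     + (480 + 31 * 104 * (196608 + Cphi * Q) + 8 * (25 / 4 * Cphi + 1)) * (K ^ 3 / real n))"
proof -
  have nn: "real n > 0" using n by simp
  have D0: "\<Delta> \<ge> 0" using \<Delta> Cphi1 by simp
  interpret S: prob_space "sample_law f n" by (rule prob_sample_law)
  define c1 where "c1 = 20 * bias k0 + 480 / real n"
  define c2 where "c2 = 20 * \<Delta> * (sqrt (real k0) / real n)"
  define c3 where "c3 = (25 / 4 * Cphi + 1) * K"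
  define U where "U = {X \<in> space (sample_law f n). vhat s n X < v / 2}"
  have [measurable]: "U \<in> sets (sample_law f n)" unfolding U_def by measurable
  have c: "c1 \<ge> 0" "c2 \<ge> 0" "c3 \<ge> 0"
    using bias_nonneg[of k0] D0 nn Cphi1 K1 by (auto simp: c1_def c2_def c3_def)
  have P0: "excess n X k \<ge> 0" for X k by (simp add: excess_def)
  \<comment> \<open>Passing to a measurable majorant first allows the integral to be split into its
    summands.\<close>
  have "risk s n w f \<le> (\<integral>\<^sup>+X. ennreal c1 + ennreal c2 * ennreal (vhat s n X)
      + ennreal 31 * (\<Sum>k=1..M. ennreal (excess n X k)) + ennreal c3 * indicator U X \<partial>sample_law f n)"
    unfolding risk_def
  proof (rule nn_integral_mono)
    fix X assume X: "X \<in> space (sample_law f n)"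
    have "(norm_on (dom_of s) (\<lambda>x. aggregate s n w X x - f x))\<^sup>2 \<le> (\<Sum>k=1..M. w X k * (est_err n X k + bias k))"
      unfolding aggregate_def M_def[symmetric] using w by (intro aggregate_loss_le) auto
    also have "\<dots> \<le> c1 + c2 * vhat s n X + 31 * (\<Sum>k=1..M. excess n X k) + c3 * (if vhat s n X < v / 2 then 1 else 0)"
      unfolding c1_def c2_def c3_def by (rule loss_le[OF M_def n \<Delta> k0]) (use w in auto)
    also have "(if vhat s n X < v / 2 then 1 else 0) = indicator U X" using X by (simp add: U_def)
    finally have "ennreal ((norm_on (dom_of s) (\<lambda>x. aggregate s n w X x - f x))\<^sup>2)
      \<le> ennreal (c1 + c2 * vhat s n X + 31 * (\<Sum>k=1..M. excess n X k) + c3 * indicator U X)" by (rule ennreal_leI)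
    also have "\<dots> = ennreal c1 + ennreal c2 * ennreal (vhat s n X)
      + ennreal 31 * (\<Sum>k=1..M. ennreal (excess n X k)) + ennreal c3 * indicator U X"
      using c P0 vhat_ge[of n X] order_trans[OF zero_le_one vhat_ge[of n X]]
      by (simp add: sum_nonneg sum_ennreal ennreal_mult ennreal_indicator[symmetric] del: ennreal_indicator ennreal_numeral)
    finally show "ennreal ((norm_on (dom_of s) (\<lambda>x. aggregate s n w X x - f x))\<^sup>2) \<le> \<dots>" .
  qed
  also have "\<dots> = ennreal c1 + ennreal c2 * (\<integral>\<^sup>+X. ennreal (vhat s n X) \<partial>sample_law f n)
      + ennreal 31 * (\<Sum>k=1..M. \<integral>\<^sup>+X. ennreal (excess n X k) \<partial>sample_law f n) + ennreal c3 * emeasure (sample_law f n) U"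
    by (simp add: nn_integral_add nn_integral_cmult nn_integral_sum S.emeasure_space_1 del: ennreal_numeral)
  also have "\<dots> \<le> ennreal c1 + ennreal c2 * ennreal K
      + ennreal 31 * ennreal (104 * (196608 * K ^ 3 + Cphi * Q * K) / real n) + ennreal c3 * ennreal (8 * K / real n)"
  proof (intro add_mono mult_left_mono order_refl)
    show "(\<integral>\<^sup>+X. ennreal (vhat s n X) \<partial>sample_law f n) \<le> ennreal K"
      using n v_le by (simp add: nn_integral_vhat ennreal_leI)
    show "emeasure (sample_law f n) U \<le> ennreal (8 * K / real n)"
      unfolding U_def using n by (intro emeasure_vhat_small) simp
    define e1 where "e1 k = exp (- (1 / (8 * sqrt K) * sqrt (real k)))" for k :: nat
    define e2 where "e2 k = sqrt (real k) * exp (- (sqrt (real n * sqrt (real k) / real k powr dexp s) / 8))" for k :: nat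
    have "(\<Sum>k=1..M. \<integral>\<^sup>+X. ennreal (excess n X k) \<partial>sample_law f n) \<le> (\<Sum>k=1..M. ennreal (104 / real n * (K * e1 k + Cphi * K * e2 k)))"
    proof (rule sum_mono)
      fix k assume "k \<in> {1..M}"
      then show "(\<integral>\<^sup>+X. ennreal (excess n X k) \<partial>sample_law f n) \<le> ennreal (104 / real n * (K * e1 k + Cphi * K * e2 k))"
        using nn_integral_excess_le[of n k] sqrt_max_dim_le[OF n, of k s] n
        by (simp add: M_def e1_def e2_def mult.assoc)
    qed
    also have "\<dots> = ennreal (\<Sum>k=1..M. 104 / real n * (K * e1 k + Cphi * K * e2 k))"
      using K1 Cphi1 by (subst sum_ennreal) (auto simp: e1_def e2_def)
    also have "(\<Sum>k=1..M. 104 / real n * (K * e1 k + Cphi * K * e2 k))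
      = 104 / real n * (K * (\<Sum>k=1..M. e1 k) + Cphi * K * (\<Sum>k=1..M. e2 k))"
      by (simp only: sum_distrib_left[symmetric] sum.distrib)
    also have "ennreal \<dots> \<le> ennreal (104 / real n * (K * (196608 * K\<^sup>2) + Cphi * K * Q))"
    proof (intro ennreal_leI mult_left_mono add_mono)
      \<comment> \<open>48 times 8^4 is 196608, and (sqrt K)^4 = K^2; with the prefactor K this is
        the origin of C_{omega,L}^3.\<close>
      have "(\<Sum>k=1..M. e1 k) \<le> 48 / (1 / (8 * sqrt K)) ^ 4"
        unfolding e1_def using K1 by (intro sum_exp_neg_sqrt_le) simp
      also have "\<dots> = 196608 * (sqrt K) ^ 4" by (simp add: power_divide power_mult_distrib)
      also have "(sqrt K) ^ 4 = K\<^sup>2" using K1 by (simp add: power4_eq_xxxx power2_eq_square)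
      finally show "(\<Sum>k=1..M. e1 k) \<le> 196608 * K\<^sup>2" .
      \<comment> \<open>Each term is at most n times Q / n^3, and there are M <= n^2 of
        them.\<close>
      have "(\<Sum>k=1..M. e2 k) \<le> (\<Sum>k=1..M. real n * (Q / real n ^ 3))"
        unfolding e2_def using Q sqrt_max_dim_le[OF n, of _ s] by (intro sum_mono mult_mono) (auto simp: M_def)
      also have "\<dots> = real M * (Q / (real n)\<^sup>2)" using nn by (simp add: power2_eq_square power3_eq_cube)
      also have "\<dots> \<le> (real n)\<^sup>2 * (Q / (real n)\<^sup>2)"
      proof (rule mult_right_mono)
        have "sqrt (real M) \<le> real n" using sqrt_max_dim_le[OF n, of M s] k0 by (simp add: M_def)
        then show "real M \<le> (real n)\<^sup>2" by (metis of_nat_0_le_iff real_sqrt_ge_0_iff real_sqrt_pow2 power_mono)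
      qed (use Q in simp)
      also have "\<dots> = Q" using nn by simp
      finally show "(\<Sum>k=1..M. e2 k) \<le> Q" .
    qed (use K1 Cphi1 nn in auto)
    also have "104 / real n * (K * (196608 * K\<^sup>2) + Cphi * K * Q) = 104 * (196608 * K ^ 3 + Cphi * Q * K) / real n"
      by (simp add: power2_eq_square power3_eq_cube mult_ac)
    finally show "(\<Sum>k=1..M. \<integral>\<^sup>+X. ennreal (excess n X k) \<partial>sample_law f n) \<le> ennreal (104 * (196608 * K ^ 3 + Cphi * Q * K) / real n)" .
  qed simp_all
  also have "\<dots> = ennreal (c1 + c2 * K + 31 * (104 * (196608 * K ^ 3 + Cphi * Q * K) / real n) + c3 * (8 * K / real n))"
  proof -
    have "ennreal c1 + ennreal c2 * ennreal K + ennreal 31 * ennreal x + ennreal c3 * ennreal y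
       = ennreal (c1 + c2 * K + 31 * x + c3 * y)" if "x \<ge> 0" "y \<ge> 0" for x y
      using that c K1 by (simp add: ennreal_mult[symmetric] ennreal_plus[symmetric] del: ennreal_plus ennreal_numeral)
    then show ?thesis using K1 Q Cphi1 by simp
  qed
  also have "\<dots> \<le> ennreal (20 * bias k0 + 20 * \<Delta> * K * (sqrt (real k0) / real n)
     + (480 + 31 * 104 * (196608 + Cphi * Q) + 8 * (25 / 4 * Cphi + 1)) * (K ^ 3 / real n))"
  proof (rule ennreal_leI)
    define r where "r = K ^ 3 / real n"
    \<comment> \<open>Since K >= 1, all remainders can be brought to the common scale K^3 /
      n.\<close>
    have K13: "1 \<le> K ^ 3" "K \<le> K ^ 3" "K\<^sup>2 \<le> K ^ 3"
      using K1 self_le_power[of K 3] power_increasing[of 2 3 K] by auto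
    have "480 / real n \<le> 480 * r" using K13(1) nn by (simp add: r_def divide_right_mono)
    moreover have "31 * (104 * (196608 * K ^ 3 + Cphi * Q * K) / real n) \<le> 31 * 104 * (196608 + Cphi * Q) * r"
    proof -
      have "196608 * K ^ 3 + Cphi * Q * K \<le> 196608 * K ^ 3 + Cphi * Q * K ^ 3"
        using K13(2) Cphi1 Q by (intro add_left_mono mult_left_mono) auto
      then have "(196608 * K ^ 3 + Cphi * Q * K) / real n \<le> (196608 * K ^ 3 + Cphi * Q * K ^ 3) / real n"
        using nn by (intro divide_right_mono) auto
      also have "\<dots> = (196608 + Cphi * Q) * r" by (simp add: r_def add_divide_distrib algebra_simps)
      finally have le: "(196608 * K ^ 3 + Cphi * Q * K) / real n \<le> (196608 + Cphi * Q) * r" .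
      have "31 * (104 * x / real n) \<le> 31 * 104 * y * r" if "x / real n \<le> y * r" for x y
      proof -
        have "31 * (104 * x / real n) = 3224 * (x / real n)" by simp
        also have "\<dots> \<le> 3224 * (y * r)" using that by (rule mult_left_mono) simp
        finally show ?thesis by simp
      qed
      from this[OF le] show ?thesis .
    qed
    moreover have "c3 * (8 * K / real n) \<le> 8 * (25 / 4 * Cphi + 1) * r"
    proof -
      have "c3 * (8 * K / real n) = 8 * (25 / 4 * Cphi + 1) * (K\<^sup>2 / real n)" by (simp add: c3_def power2_eq_square)
      also have "\<dots> \<le> 8 * (25 / 4 * Cphi + 1) * (K ^ 3 / real n)"
        using K13(3) Cphi1 nn by (intro mult_left_mono divide_right_mono) auto
      finally show ?thesis by (simp add: r_def)
    qed
    moreover have "c2 * K = 20 * \<Delta> * K * (sqrt (real k0) / real n)" by (simp add: c2_def)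
    ultimately show "c1 + c2 * K + 31 * (104 * (196608 * K ^ 3 + Cphi * Q * K) / real n) + c3 * (8 * K / real n)
       \<le> 20 * bias k0 + 20 * \<Delta> * K * (sqrt (real k0) / real n)
     + (480 + 31 * 104 * (196608 + Cphi * Q) + 8 * (25 / 4 * Cphi + 1)) * (K ^ 3 / real n)"
      unfolding c1_def r_def[symmetric] distrib_right by linarith
  qed
  finally show ?thesis .
qed

end

section \<open>The common properties of the two families of weights\<close>

lemma bayes_weight_nonneg: "bayes_weight s \<Delta> \<kappa> n X k \<ge> 0"
  by (simp add: bayes_weight_def sum_nonneg)

lemma sum_bayes_weight:
  assumes "max_dim s n \<ge> 1"
  shows "(\<Sum>k=1..max_dim s n. bayes_weight s \<Delta> \<kappa> n X k) = 1"
proof -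
  have "(\<Sum>l=1..max_dim s n. exp (- \<kappa> * real n * crit s \<Delta> n X l)) > 0"
    using assms by (intro sum_pos) auto
  then show ?thesis unfolding bayes_weight_def sum_divide_distrib[symmetric] by simp
qed

text \<open>For a non-negative gap of the criteria the denominator is bounded below by its term at
  l, and \<kappa> >= 1 only sharpens the decay; for a negative gap the right-hand side exceeds
  1.\<close>

lemma bayes_weight_le:
  assumes \<kappa>: "\<kappa> \<ge> 1" and kl: "k \<in> {1..max_dim s n}" "l \<in> {1..max_dim s n}"
  shows "bayes_weight s \<Delta> \<kappa> n X k \<le> exp (- real n * (crit s \<Delta> n X k - crit s \<Delta> n X l))"
proof -
  define e where "e l = exp (- \<kappa> * real n * crit s \<Delta> n X l)" for l
  define S where "S = (\<Sum>l=1..max_dim s n. e l)"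
  define d where "d = real n * (crit s \<Delta> n X k - crit s \<Delta> n X l)"
  have e0: "e l > 0" for l by (simp add: e_def)
  have le: "e l \<le> S" "e k \<le> S" unfolding S_def using kl by (auto intro!: member_le_sum simp: e_def)
  have S0: "S > 0" using e0[of l] le by linarith
  have w: "bayes_weight s \<Delta> \<kappa> n X k = e k / S" by (simp add: bayes_weight_def e_def S_def)
  show ?thesis
  proof (cases "d \<ge> 0")
    case True
    have "e k / S \<le> e k / e l" using le e0[of k] e0[of l] S0 by (intro divide_left_mono) auto
    also have "\<dots> = exp (- (\<kappa> * d))" by (simp add: e_def d_def exp_diff[symmetric] algebra_simps)
    also have "\<dots> \<le> exp (- d)" using True \<kappa> mult_right_mono[of 1 \<kappa> d] by simp
    finally show ?thesis by (simp add: w d_def)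
  next
    case False
    have "e k / S \<le> 1" using le S0 by simp
    also have "1 \<le> exp (- d)" using False by simp
    finally show ?thesis by (simp add: w d_def)
  qed
qed

lemma khat_least:
  assumes "max_dim s n \<ge> 1"
  shows "khat s \<Delta> n X \<in> {1..max_dim s n}"
    and "l \<in> {1..max_dim s n} \<Longrightarrow> crit s \<Delta> n X (khat s \<Delta> n X) \<le> crit s \<Delta> n X l"
proof -
  have "finite {1..max_dim s n}" "{1..max_dim s n} \<noteq> {}" using assms by auto
  from ex_min_if_finite[OF finite_imageI[OF this(1), of "crit s \<Delta> n X"]] this
  have "\<exists>k. k \<in> {1..max_dim s n} \<and> (\<forall>l\<in>{1..max_dim s n}. crit s \<Delta> n X k \<le> crit s \<Delta> n X l)"
    by (auto simp: not_less)
  from LeastI_ex[OF this]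
  show "khat s \<Delta> n X \<in> {1..max_dim s n}"
    and "l \<in> {1..max_dim s n} \<Longrightarrow> crit s \<Delta> n X (khat s \<Delta> n X) \<le> crit s \<Delta> n X l"
    unfolding khat_def by auto
qed

lemma sum_ms_weight:
  assumes "max_dim s n \<ge> 1"
  shows "(\<Sum>k=1..max_dim s n. ms_weight s \<Delta> n X k) = 1"
  using khat_least(1)[OF assms, of \<Delta> X] by (simp add: ms_weight_def)

text \<open>At the selected dimension the exponent is non-negative by minimality, so the right-hand
  side is at least 1; elsewhere the weight is 0.\<close>

lemma ms_weight_le:
  assumes "k \<in> {1..max_dim s n}" "l \<in> {1..max_dim s n}"
  shows "ms_weight s \<Delta> n X k \<le> exp (- real n * (crit s \<Delta> n X k - crit s \<Delta> n X l))"
proof -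
  have "max_dim s n \<ge> 1" using assms by simp
  note le = khat_least(2)[OF this assms(2), of \<Delta> X]
  have "1 \<le> exp (- real n * (crit s \<Delta> n X k - crit s \<Delta> n X l))" if "k = khat s \<Delta> n X"
    using le mult_nonneg_nonneg[of "real n" "crit s \<Delta> n X l - crit s \<Delta> n X k"] by (simp add: that algebra_simps)
  then show ?thesis by (simp add: ms_weight_def)
qed

theorem theorem3p8:
  fixes s :: setting and Cphi \<Delta> \<kappa> :: real
  assumes "basis_constant s Cphi"
    and "\<Delta> \<ge> 84 * Cphi"
    and "\<kappa> \<ge> 1"
  shows "\<exists>C::real. C > 0 \<and>
    (\<forall>(L::real) (\<omega>::nat \<Rightarrow> real) (Comega::real).
       L > 0 \<longrightarrow>
       (\<forall>k\<ge>1. \<omega> k > 0) \<longrightarrow>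
       antimono_on {1..} \<omega> \<longrightarrow>
       \<omega> 1 \<le> 1 \<longrightarrow>
       \<omega> \<longlonglongrightarrow> 0 \<longrightarrow>
       Comega > 0 \<longrightarrow>
       (\<forall>f\<in>ellipsoid s \<omega> L.
          let m = max (ennreal L) (max (v_mom s f)
                    (max (ennreal ((norm_on (dom_of s) f)\<^sup>2)) ((sup_norm_on (dom_of s) f)\<^sup>2)))
          in 1 \<le> m \<and> m \<le> ennreal Comega) \<longrightarrow>
       (\<forall>n\<ge>3. max_dim s n \<ge> 1 \<longrightarrow>
          (\<forall>w\<in>{bayes_weight s \<Delta> \<kappa> n, ms_weight s \<Delta> n}.
             (SUP f\<in>ellipsoid s \<omega> L. risk s n w f)
               \<le> ennreal (C * (Comega * rate s Cphi Comega \<omega> n + Comega ^ 3 / real n)))))"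
proof -
  \<comment> \<open>Q depends on the setting alone, so the constant built from Q, C_phi and \<Delta>
    is numerical.\<close>
  obtain Q where Q: "Q > 0" and Qb: "\<And>n k. n \<ge> 3 \<Longrightarrow> 1 \<le> k \<Longrightarrow> k \<le> max_dim s n \<Longrightarrow>
     exp (- (sqrt (real n * sqrt (real k) / real k powr dexp s) / 8)) \<le> Q / real n ^ 3"
    using exp_tail_max_dim by blast
  have Cphi1: "Cphi \<ge> 1" using assms(1) by (simp add: basis_constant_def)
  have \<Delta>0: "\<Delta> > 0" using assms(2) Cphi1 by linarith
  define C1 where "C1 = 480 + 31 * 104 * (196608 + Cphi * Q) + 8 * (25 / 4 * Cphi + 1)"
  have C1: "C1 > 0" using Cphi1 Q by (simp add: C1_def add_pos_nonneg)
  define C where "C = 20 + 20 * \<Delta> + C1"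
  have C0: "C > 0" using \<Delta>0 C1 by (simp add: C_def)
  show ?thesis
  proof (intro exI[of _ C] conjI C0 allI impI ballI SUP_least)
    fix L Comega :: real and \<omega> :: "nat \<Rightarrow> real" and n :: nat and w f
    assume L: "L > 0" and \<omega>: "\<forall>k\<ge>1. \<omega> k > 0" "antimono_on {1..} \<omega>"
      and "Comega > 0"
      and m: "\<forall>f\<in>ellipsoid s \<omega> L.
          let m = max (ennreal L) (max (v_mom s f)
                    (max (ennreal ((norm_on (dom_of s) f)\<^sup>2)) ((sup_norm_on (dom_of s) f)\<^sup>2)))
          in 1 \<le> m \<and> m \<le> ennreal Comega"
      and n: "n \<ge> 3" and M: "max_dim s n \<ge> 1"
      and w: "w \<in> {bayes_weight s \<Delta> \<kappa> n, ms_weight s \<Delta> n}"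
      and f: "f \<in> ellipsoid s \<omega> L"
    define m' where "m' = max (ennreal L) (max (v_mom s f)
                    (max (ennreal ((norm_on (dom_of s) f)\<^sup>2)) ((sup_norm_on (dom_of s) f)\<^sup>2)))"
    have m': "1 \<le> m'" "m' \<le> ennreal Comega" using m f by (auto simp: m'_def Let_def)
    have parts: "ennreal L \<le> ennreal Comega" "v_mom s f \<le> ennreal Comega"
      "ennreal ((norm_on (dom_of s) f)\<^sup>2) \<le> ennreal Comega" "(sup_norm_on (dom_of s) f)\<^sup>2 \<le> ennreal Comega"
      using m'(2) by (simp_all add: m'_def)
    \<comment> \<open>That the constant is at least 1 is known only through a member of the
      ellipsoid, so it is derived after f has been fixed.\<close>
    have "ennreal 1 \<le> ennreal Comega" using order_trans[OF m'] by simp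
    then have K1: "Comega \<ge> 1" using \<open>Comega > 0\<close> by (simp add: ennreal_le_iff del: ennreal_1)
    have LK: "L \<le> Comega" using parts(1) K1 by (simp add: ennreal_le_iff)
    have ell: "f \<in> densities s" "(\<Sum>k. ennreal (\<bar>coef s f (Suc k)\<bar>\<^sup>2 / \<omega> (Suc k))) \<le> ennreal L"
      "moment f (2 * alpha s) \<le> ennreal L"
      using f by (auto simp: ellipsoid_def)
    interpret density_setting s f Cphi Comega
    proof
      show "moment f (2 * alpha s) \<le> ennreal Comega" using ell(3) parts(1) by (rule order_trans)
      show "(norm_on (dom_of s) f)\<^sup>2 \<le> Comega" using parts(3) K1 by (simp add: ennreal_le_iff)
    qed (use ell assms K1 parts in auto)
    define r where "r = rate s Cphi Comega \<omega> n"
    \<comment> \<open>A minimum over a non-empty finite set is attained; the minimiser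
      \<open>k0\<close> becomes the competitor in the oracle inequality.\<close>
    have "r \<in> (\<lambda>k. max (rate_k \<omega> n k)
     (exp (- (Cphi * real k powr (1 / 2) / (400 * Comega))))) ` {1..max_dim s n}"
      unfolding r_def rate_def using M by (intro Min_in) auto
    then obtain k0 where k0: "k0 \<in> {1..max_dim s n}" and rk: "r = max (rate_k \<omega> n k0)
     (exp (- (Cphi * real k0 powr (1 / 2) / (400 * Comega))))" by auto
    have r: "\<omega> k0 \<le> r" "sqrt (real k0) / real n \<le> r" unfolding rk rate_k_def by (auto simp: powr_half_sqrt)
    have wk: "w X k \<ge> 0" "(\<Sum>k=1..max_dim s n. w X k) = 1" for X k
      using w bayes_weight_nonneg sum_bayes_weight[OF M] sum_ms_weight[OF M] by (auto simp: ms_weight_def[of s \<Delta> n X k])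
    have wk_le: "w X k \<le> exp (- real n * (crit s \<Delta> n X k - crit s \<Delta> n X l))"
      if "k \<in> {1..max_dim s n}" "l \<in> {1..max_dim s n}" for X k l
      using w that bayes_weight_le[OF assms(3)] ms_weight_le by blast
    have bias: "bias k0 \<le> Comega * r"
    proof -
      \<comment> \<open>As \<open>k0\<close> >= 1, the ellipsoid controls the whole tail from
        \<open>k0\<close> on, although its series leaves out the coefficient of index 0.\<close>
      have "bias k0 \<le> L * \<omega> k0"
        unfolding bias_def
        by (rule parseval_tail_le) (use f_sq_integrable f_supp \<omega> ell(2) L k0 in \<open>auto simp: coef_eq\<close>)
      also have "\<dots> \<le> Comega * r" using LK r(1) \<omega>(1) k0 L K1 by (intro mult_mono) auto
      finally show ?thesis .
    qed
    have r0: "r \<ge> 0" using order_trans[OF _ r(2), of 0] by simp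
    have "risk s n w f \<le> ennreal (20 * bias k0 + 20 * \<Delta> * Comega * (sqrt (real k0) / real n) + C1 * (Comega ^ 3 / real n))"
      unfolding C1_def by (rule risk_le[OF refl n assms(2) k0]) (use wk wk_le Q Qb[OF n] in blast)+
    also have "\<dots> \<le> ennreal (C * (Comega * r + Comega ^ 3 / real n))"
    proof (rule ennreal_leI)
      have "20 * \<Delta> * Comega * (sqrt (real k0) / real n) \<le> 20 * \<Delta> * Comega * r"
        using r(2) \<Delta>0 K1 by (intro mult_left_mono) auto
      moreover have "(20 + 20 * \<Delta>) * (Comega * r) \<le> C * (Comega * r)"
        using C1 K1 r0 by (intro mult_right_mono) (auto simp: C_def)
      moreover have "C1 * (Comega ^ 3 / real n) \<le> C * (Comega ^ 3 / real n)"
        using \<Delta>0 K1 by (intro mult_right_mono) (auto simp: C_def)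
      ultimately show "20 * bias k0 + 20 * \<Delta> * Comega * (sqrt (real k0) / real n) + C1 * (Comega ^ 3 / real n)
        \<le> C * (Comega * r + Comega ^ 3 / real n)" using bias by (simp add: distrib_left distrib_right)
    qed
    finally show "risk s n w f \<le> ennreal (C * (Comega * rate s Cphi Comega \<omega> n + Comega ^ 3 / real n))"
      by (simp add: r_def)
  qed
qed

end
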